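(* Over $\mathsf{ACA}_0^\omega+\mathsf{IND}_0$, $\mathsf{NIN}$ follows from $\mathsf{HBU}_{\mathsf{semi}}$, and $\mathsf{NIN}$ follows from $\mathsf{HBU}_{\mathsf{Borel}}$; the extra induction $\mathsf{IND}_0$ is only needed in the first case (i.e. $\mathsf{ACA}_0^\omega$ proves $\mathsf{HBU}_{\mathsf{Borel}}\to\mathsf{NIN}$).
   Context: Work in higher-order arithmetic: $\mathsf{ACA}_0^\omega$ is Kohlenbach's base theory $\mathsf{RCA}_0^\omega$ plus $(\exists^2)$: there is $\varphi^2\le_2 1$ with $(\exists n)(f(n)=0)\leftrightarrow\varphi(f)=0$ for all $f\in\mathbb{N}^{\mathbb{N}}$. Reals are fast-converging Cauchy sequences; functions on reals respect real equality; sets of reals are characteristic functions. $\mathsf{IND}_0$: for every $Y^2$ such that for each $n$ there is at most one $f\in2^{\mathbb{N}}$ with $Y(f,n)=0$, and every $k$, there is a finite sequence $w$ such that for all $m\le k$: $(\exists i<|w|)(w(i)\in2^{\mathbb{N}}\wedge Y(w(i),m)=0)\leftrightarrow(\exists f\in2^{\mathbb{N}})(Y(f,m)=0)$. $\mathsf{NIN}$: there is no injection $Y:[0,1]\to\mathbb{N}$. $\mathsf{HBU}$ (Cousin's lemma): for every $\Psi:[0,1]\to\mathbb{R}^+$ there are $y_0,\dots,y_k\in[0,1]$ with $[0,1]\subset\bigcup_{i\le k}B(y_i,\Psi(y_i))$, where $B(y,r)$ is the open ball of radius $r$ around $y$. $\mathsf{HBU}_{\mathsf{semi}}$ (resp.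 $\mathsf{HBU}_{\mathsf{Borel}}$) is $\mathsf{HBU}$ restricted to $\Psi$ that are upper semi-continuous, i.e. $\Psi(x_0)\ge\limsup_{x\to x_0}\Psi(x)$ for all $x_0$ (resp. Borel, i.e. $\{x\in[0,1]:\Psi(x)>a\}$ is a Borel set for all $a\in\mathbb{R}$, Borel sets defined as usual using $(\exists^2)$ for countable unions). *)

theory Defs
  imports Main
begin

section \<open>The language of all finite types\<close>

datatype ty = N | Fn ty ty  (infixr "\<rightarrow>" 70)

text \<open>
  Terms are combinatory, as in Feferman's system underlying Kohlenbach's base theory:
  zero, successor, the combinators \<open>Pi\<close> and \<open>Sg\<close>, and the recursor \<open>Rec\<close> for primitive
  recursion with values of type 0.  The syntax is locally nameless: \<open>Fr n \<rho>\<close> is the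
  \<open>n\<close>-th free variable of type \<open>\<rho>\<close>, and \<open>Bd k\<close> is a de Bruijn index bound by a quantifier.
\<close>

datatype tm =
    Bd nat
  | Fr nat ty
  | Zero
  | Succ
  | Pi ty ty
  | Sg ty ty ty
  | Rec
  | App tm tm  (infixl "\<cdot>" 100)

text \<open>Equality is primitive at type 0 only.\<close>

datatype fm =
    Eq tm tm
  | Fls  ("\<^bold>\<bottom>")
  | Imp fm fm  (infixr "\<^bold>\<longrightarrow>" 25)
  | All ty fm

inductive has_ty :: "ty list \<Rightarrow> tm \<Rightarrow> ty \<Rightarrow> bool" where
  "k < length \<Delta> \<Longrightarrow> has_ty \<Delta> (Bd k) (\<Delta> ! k)"
| "has_ty \<Delta> (Fr n \<rho>) \<rho>"
| "has_ty \<Delta> Zero N"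
| "has_ty \<Delta> Succ (N \<rightarrow> N)"
| "has_ty \<Delta> (Pi \<rho> \<tau>) (\<rho> \<rightarrow> \<tau> \<rightarrow> \<rho>)"
| "has_ty \<Delta> (Sg \<delta> \<rho> \<tau>) ((\<delta> \<rightarrow> \<rho> \<rightarrow> \<tau>) \<rightarrow> (\<delta> \<rightarrow> \<rho>) \<rightarrow> \<delta> \<rightarrow> \<tau>)"
| "has_ty \<Delta> Rec (N \<rightarrow> N \<rightarrow> (N \<rightarrow> N \<rightarrow> N) \<rightarrow> N)"
| "has_ty \<Delta> s (\<rho> \<rightarrow> \<tau>) \<Longrightarrow> has_ty \<Delta> t \<rho> \<Longrightarrow> has_ty \<Delta> (s \<cdot> t) \<tau>"

fun wf_fm :: "ty list \<Rightarrow> fm \<Rightarrow> bool" where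
  "wf_fm \<Delta> (Eq s t) \<longleftrightarrow> has_ty \<Delta> s N \<and> has_ty \<Delta> t N"
| "wf_fm \<Delta> Fls \<longleftrightarrow> True"
| "wf_fm \<Delta> (Imp \<phi> \<psi>) \<longleftrightarrow> wf_fm \<Delta> \<phi> \<and> wf_fm \<Delta> \<psi>"
| "wf_fm \<Delta> (All \<rho> \<phi>) \<longleftrightarrow> wf_fm (\<rho> # \<Delta>) \<phi>"

fun qf :: "fm \<Rightarrow> bool" where
  "qf (Eq s t) \<longleftrightarrow> True"
| "qf Fls \<longleftrightarrow> True"
| "qf (Imp \<phi> \<psi>) \<longleftrightarrow> qf \<phi> \<and> qf \<psi>"
| "qf (All \<rho> \<phi>) \<longleftrightarrow> False"

fun fv_tm :: "tm \<Rightarrow> (nat \<times> ty) set" where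
  "fv_tm (Fr n \<rho>) = {(n, \<rho>)}"
| "fv_tm (s \<cdot> t) = fv_tm s \<union> fv_tm t"
| "fv_tm _ = {}"

fun fv_fm :: "fm \<Rightarrow> (nat \<times> ty) set" where
  "fv_fm (Eq s t) = fv_tm s \<union> fv_tm t"
| "fv_fm Fls = {}"
| "fv_fm (Imp \<phi> \<psi>) = fv_fm \<phi> \<union> fv_fm \<psi>"
| "fv_fm (All \<rho> \<phi>) = fv_fm \<phi>"

text \<open>
  Replacing the index \<open>k\<close> by a term.  Only terms without loose indices are ever substituted,
  so no lifting is needed.
\<close>

fun inst_tm :: "nat \<Rightarrow> tm \<Rightarrow> tm \<Rightarrow> tm" where
  "inst_tm k u (Bd i) = (if i = k then u else Bd i)"
| "inst_tm k u (s \<cdot> t) = inst_tm k u s \<cdot> inst_tm k u t"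
| "inst_tm k u t = t"

fun inst_fm :: "nat \<Rightarrow> tm \<Rightarrow> fm \<Rightarrow> fm" where
  "inst_fm k u (Eq s t) = Eq (inst_tm k u s) (inst_tm k u t)"
| "inst_fm k u Fls = Fls"
| "inst_fm k u (Imp \<phi> \<psi>) = Imp (inst_fm k u \<phi>) (inst_fm k u \<psi>)"
| "inst_fm k u (All \<rho> \<phi>) = All \<rho> (inst_fm (Suc k) u \<phi>)"

text \<open>Abstracting a free variable to the index \<open>k\<close>.\<close>

fun bind_tm :: "nat \<Rightarrow> nat \<Rightarrow> ty \<Rightarrow> tm \<Rightarrow> tm" where
  "bind_tm k n \<rho> (Fr m \<sigma>) = (if m = n \<and> \<sigma> = \<rho> then Bd k else Fr m \<sigma>)"
| "bind_tm k n \<rho> (s \<cdot> t) = bind_tm k n \<rho> s \<cdot> bind_tm k n \<rho> t"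
| "bind_tm k n \<rho> t = t"

fun bind_fm :: "nat \<Rightarrow> nat \<Rightarrow> ty \<Rightarrow> fm \<Rightarrow> fm" where
  "bind_fm k n \<rho> (Eq s t) = Eq (bind_tm k n \<rho> s) (bind_tm k n \<rho> t)"
| "bind_fm k n \<rho> Fls = Fls"
| "bind_fm k n \<rho> (Imp \<phi> \<psi>) = Imp (bind_fm k n \<rho> \<phi>) (bind_fm k n \<rho> \<psi>)"
| "bind_fm k n \<rho> (All \<sigma> \<phi>) = All \<sigma> (bind_fm (Suc k) n \<rho> \<phi>)"


section \<open>Derivability in classical many-sorted predicate logic\<close>

text \<open>
  Natural deduction from a set \<open>T\<close> of axioms and a finite list \<open>\<Gamma>\<close> of assumptions.
  Free variables of axioms are read universally (they are parameters of axiom schemes),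
  so the eigenvariable condition concerns only \<open>\<Gamma>\<close>.
\<close>

inductive derives :: "fm set \<Rightarrow> fm list \<Rightarrow> fm \<Rightarrow> bool" for T where
  Ax: "\<phi> \<in> T \<Longrightarrow> derives T \<Gamma> \<phi>"
| Assm: "\<phi> \<in> set \<Gamma> \<Longrightarrow> derives T \<Gamma> \<phi>"
| ImpI: "wf_fm [] \<phi> \<Longrightarrow> derives T (\<phi> # \<Gamma>) \<psi> \<Longrightarrow> derives T \<Gamma> (\<phi> \<^bold>\<longrightarrow> \<psi>)"
| ImpE: "derives T \<Gamma> (\<phi> \<^bold>\<longrightarrow> \<psi>) \<Longrightarrow> derives T \<Gamma> \<phi> \<Longrightarrow> derives T \<Gamma> \<psi>"
| Contr: "wf_fm [] \<phi> \<Longrightarrow> derives T ((\<phi> \<^bold>\<longrightarrow> \<^bold>\<bottom>) # \<Gamma>) \<^bold>\<bottom> \<Longrightarrow> derives T \<Gamma> \<phi>"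
| AllI: "derives T \<Gamma> (inst_fm 0 (Fr n \<rho>) \<phi>) \<Longrightarrow> (n, \<rho>) \<notin> fv_fm \<phi> \<Longrightarrow>
    (\<And>\<psi>. \<psi> \<in> set \<Gamma> \<Longrightarrow> (n, \<rho>) \<notin> fv_fm \<psi>) \<Longrightarrow> derives T \<Gamma> (All \<rho> \<phi>)"
| AllE: "derives T \<Gamma> (All \<rho> \<phi>) \<Longrightarrow> has_ty [] t \<rho> \<Longrightarrow> derives T \<Gamma> (inst_fm 0 t \<phi>)"

definition proves :: "fm set \<Rightarrow> fm \<Rightarrow> bool"  (infix "\<turnstile>" 20) where
  "(T \<turnstile> \<phi>) \<longleftrightarrow> derives T [] \<phi>"


section \<open>Notation for formulas and terms\<close>

text \<open>
  Quantified formulas and lambda terms are written with a body \<open>F :: tm \<Rightarrow> _\<close>.  The body is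
  evaluated at a free variable occurring in none of its parameters, which is then bound.
  \<open>F Zero\<close> serves only to collect the variables of the parameters.
\<close>

fun fresh_tm :: "tm \<Rightarrow> nat" where
  "fresh_tm (Fr n \<rho>) = Suc n"
| "fresh_tm (s \<cdot> t) = max (fresh_tm s) (fresh_tm t)"
| "fresh_tm _ = 0"

fun fresh_fm :: "fm \<Rightarrow> nat" where
  "fresh_fm (Eq s t) = max (fresh_tm s) (fresh_tm t)"
| "fresh_fm Fls = 0"
| "fresh_fm (Imp \<phi> \<psi>) = max (fresh_fm \<phi>) (fresh_fm \<psi>)"
| "fresh_fm (All \<rho> \<phi>) = fresh_fm \<phi>"

definition all :: "ty \<Rightarrow> (tm \<Rightarrow> fm) \<Rightarrow> fm" where
  "all \<rho> F = (let n = fresh_fm (F Zero) in All \<rho> (bind_fm 0 n \<rho> (F (Fr n \<rho>))))"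

definition Neg :: "fm \<Rightarrow> fm"  ("\<^bold>\<not> _" [40] 40) where
  "(\<^bold>\<not> \<phi>) = (\<phi> \<^bold>\<longrightarrow> \<^bold>\<bottom>)"

definition Conj :: "fm \<Rightarrow> fm \<Rightarrow> fm"  (infixr "\<^bold>\<and>" 35) where
  "(\<phi> \<^bold>\<and> \<psi>) = (\<^bold>\<not> (\<phi> \<^bold>\<longrightarrow> \<^bold>\<not> \<psi>))"

definition Iff :: "fm \<Rightarrow> fm \<Rightarrow> fm"  (infixr "\<^bold>\<longleftrightarrow>" 25) where
  "(\<phi> \<^bold>\<longleftrightarrow> \<psi>) = ((\<phi> \<^bold>\<longrightarrow> \<psi>) \<^bold>\<and> (\<psi> \<^bold>\<longrightarrow> \<phi>))"

definition ex :: "ty \<Rightarrow> (tm \<Rightarrow> fm) \<Rightarrow> fm" where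
  "ex \<rho> F = (\<^bold>\<not> all \<rho> (\<lambda>x. \<^bold>\<not> F x))"

abbreviation ty1 :: ty where "ty1 \<equiv> N \<rightarrow> N"
abbreviation ty2 :: ty where "ty2 \<equiv> ty1 \<rightarrow> N"
abbreviation ty3 :: ty where "ty3 \<equiv> ty2 \<rightarrow> N"

abbreviation all0 (binder "\<^bold>\<forall>\<^sup>0" 10) where "all0 \<equiv> all N"
abbreviation ex0 (binder "\<^bold>\<exists>\<^sup>0" 10) where "ex0 \<equiv> ex N"
abbreviation all1 (binder "\<^bold>\<forall>\<^sup>1" 10) where "all1 \<equiv> all ty1"
abbreviation ex1 (binder "\<^bold>\<exists>\<^sup>1" 10) where "ex1 \<equiv> ex ty1"
abbreviation all2 (binder "\<^bold>\<forall>\<^sup>2" 10) where "all2 \<equiv> all ty2"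
abbreviation ex2 (binder "\<^bold>\<exists>\<^sup>2" 10) where "ex2 \<equiv> ex ty2"

primrec eq :: "ty \<Rightarrow> tm \<Rightarrow> tm \<Rightarrow> fm" where
  "eq N s t = Eq s t"
| "eq (\<rho> \<rightarrow> \<tau>) s t = all \<rho> (\<lambda>x. eq \<tau> (s \<cdot> x) (t \<cdot> x))"

abbreviation eq0 (infix "\<^bold>=" 50) where "s \<^bold>= t \<equiv> Eq s t"

text \<open>
  Lambda abstraction is the usual defined operation on combinatory terms.
  \<open>ty_of\<close> is the type of a well-typed term without loose indices.
\<close>

fun ty_of :: "tm \<Rightarrow> ty" where
  "ty_of (Bd k) = N"
| "ty_of (Fr n \<rho>) = \<rho>"
| "ty_of Zero = N"
| "ty_of Succ = (N \<rightarrow> N)"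
| "ty_of (Pi \<rho> \<tau>) = (\<rho> \<rightarrow> \<tau> \<rightarrow> \<rho>)"
| "ty_of (Sg \<delta> \<rho> \<tau>) = ((\<delta> \<rightarrow> \<rho> \<rightarrow> \<tau>) \<rightarrow> (\<delta> \<rightarrow> \<rho>) \<rightarrow> \<delta> \<rightarrow> \<tau>)"
| "ty_of Rec = (N \<rightarrow> N \<rightarrow> (N \<rightarrow> N \<rightarrow> N) \<rightarrow> N)"
| "ty_of (s \<cdot> t) = (case ty_of s of \<rho> \<rightarrow> \<tau> \<Rightarrow> \<tau> | N \<Rightarrow> N)"

fun bracket :: "nat \<Rightarrow> ty \<Rightarrow> tm \<Rightarrow> tm" where
  "bracket n \<rho> (s \<cdot> t) =
    (if (n, \<rho>) \<in> fv_tm (s \<cdot> t)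
     then Sg \<rho> (ty_of t) (ty_of (s \<cdot> t)) \<cdot> bracket n \<rho> s \<cdot> bracket n \<rho> t
     else Pi (ty_of (s \<cdot> t)) \<rho> \<cdot> (s \<cdot> t))"
| "bracket n \<rho> t =
    (if t = Fr n \<rho> then Sg \<rho> (\<rho> \<rightarrow> \<rho>) \<rho> \<cdot> Pi \<rho> (\<rho> \<rightarrow> \<rho>) \<cdot> Pi \<rho> \<rho> else Pi (ty_of t) \<rho> \<cdot> t)"

definition lam :: "ty \<Rightarrow> (tm \<Rightarrow> tm) \<Rightarrow> tm" where
  "lam \<rho> F = (let n = fresh_tm (F Zero) in bracket n \<rho> (F (Fr n \<rho>)))"

abbreviation lam0 (binder "\<^bold>\<lambda>\<^sup>0" 10) where "lam0 \<equiv> lam N"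
abbreviation lam1 (binder "\<^bold>\<lambda>\<^sup>1" 10) where "lam1 \<equiv> lam ty1"


section \<open>The systems\<close>

definition equality_axioms :: "fm set" where
  "equality_axioms =
    {\<^bold>\<forall>\<^sup>0 x. x \<^bold>= x,
     \<^bold>\<forall>\<^sup>0 x. \<^bold>\<forall>\<^sup>0 y. x \<^bold>= y \<^bold>\<longrightarrow> y \<^bold>= x,
     \<^bold>\<forall>\<^sup>0 x. \<^bold>\<forall>\<^sup>0 y. \<^bold>\<forall>\<^sup>0 z. x \<^bold>= y \<^bold>\<longrightarrow> y \<^bold>= z \<^bold>\<longrightarrow> x \<^bold>= z}"

definition extensionality_axioms :: "fm set" where
  "extensionality_axioms =
    {all \<rho> (\<lambda>x. all \<rho> (\<lambda>y. all (\<rho> \<rightarrow> \<tau>) (\<lambda>z. eq \<rho> x y \<^bold>\<longrightarrow> eq \<tau> (z \<cdot> x) (z \<cdot> y)))) | \<rho> \<tau>. True}"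

definition successor_axioms :: "fm set" where
  "successor_axioms =
    {\<^bold>\<forall>\<^sup>0 x. \<^bold>\<not> Succ \<cdot> x \<^bold>= Zero,
     \<^bold>\<forall>\<^sup>0 x. \<^bold>\<forall>\<^sup>0 y. Succ \<cdot> x \<^bold>= Succ \<cdot> y \<^bold>\<longrightarrow> x \<^bold>= y}"

definition combinator_axioms :: "fm set" where
  "combinator_axioms =
    {all \<rho> (\<lambda>x. all \<tau> (\<lambda>y. eq \<rho> (Pi \<rho> \<tau> \<cdot> x \<cdot> y) x)) | \<rho> \<tau>. True} \<union>
    {all (\<delta> \<rightarrow> \<rho> \<rightarrow> \<tau>) (\<lambda>x. all (\<delta> \<rightarrow> \<rho>) (\<lambda>y. all \<delta> (\<lambda>z.
       eq \<tau> (Sg \<delta> \<rho> \<tau> \<cdot> x \<cdot> y \<cdot> z) (x \<cdot> z \<cdot> (y \<cdot> z))))) | \<delta> \<rho> \<tau>. True}"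

definition recursor_axioms :: "fm set" where
  "recursor_axioms =
    {\<^bold>\<forall>\<^sup>0 y. all (N \<rightarrow> N \<rightarrow> N) (\<lambda>z. Rec \<cdot> Zero \<cdot> y \<cdot> z \<^bold>= y),
     \<^bold>\<forall>\<^sup>0 x. \<^bold>\<forall>\<^sup>0 y. all (N \<rightarrow> N \<rightarrow> N) (\<lambda>z.
       Rec \<cdot> (Succ \<cdot> x) \<cdot> y \<cdot> z \<^bold>= z \<cdot> (Rec \<cdot> x \<cdot> y \<cdot> z) \<cdot> x)}"

definition qf_induction :: "fm set" where
  "qf_induction =
    {inst_fm 0 Zero \<phi> \<^bold>\<and> (\<^bold>\<forall>\<^sup>0 n. inst_fm 0 n \<phi> \<^bold>\<longrightarrow> inst_fm 0 (Succ \<cdot> n) \<phi>)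
       \<^bold>\<longrightarrow> (\<^bold>\<forall>\<^sup>0 n. inst_fm 0 n \<phi>)
     | \<phi>. qf \<phi> \<and> wf_fm [N] \<phi>}"

text \<open>In \<open>\<phi>\<close>, index 0 stands for the number and index 1 for the function.\<close>

definition QF_AC10 :: "fm set" where
  "QF_AC10 =
    {(\<^bold>\<forall>\<^sup>1 f. \<^bold>\<exists>\<^sup>0 n. inst_fm 1 f (inst_fm 0 n \<phi>))
       \<^bold>\<longrightarrow> (\<^bold>\<exists>\<^sup>2 Y. \<^bold>\<forall>\<^sup>1 f. inst_fm 1 f (inst_fm 0 (Y \<cdot> f) \<phi>))
     | \<phi>. qf \<phi> \<and> wf_fm [N, ty1] \<phi>}"

definition RCA0\<omega> :: "fm set" where
  "RCA0\<omega> = equality_axioms \<union> extensionality_axioms \<union> successor_axioms \<union> combinator_axioms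
    \<union> recursor_axioms \<union> qf_induction \<union> QF_AC10"


subsection \<open>Primitive recursive arithmetic\<close>

text \<open>Functions are closed terms of the object language, applied by the infix notations.\<close>

definition rec0 :: "tm \<Rightarrow> tm \<Rightarrow> (tm \<Rightarrow> tm \<Rightarrow> tm) \<Rightarrow> tm" where
  "rec0 x y G = Rec \<cdot> x \<cdot> y \<cdot> (\<^bold>\<lambda>\<^sup>0 v. \<^bold>\<lambda>\<^sup>0 m. G v m)"

abbreviation One :: tm where "One \<equiv> Succ \<cdot> Zero"

definition Add :: tm where
  "Add = (\<^bold>\<lambda>\<^sup>0 s. \<^bold>\<lambda>\<^sup>0 t. rec0 t s (\<lambda>v m. Succ \<cdot> v))"

abbreviation add :: "tm \<Rightarrow> tm \<Rightarrow> tm"  (infixl "\<^bold>+" 65) where "s \<^bold>+ t \<equiv> Add \<cdot> s \<cdot> t"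

definition Mul :: tm where
  "Mul = (\<^bold>\<lambda>\<^sup>0 s. \<^bold>\<lambda>\<^sup>0 t. rec0 t Zero (\<lambda>v m. v \<^bold>+ s))"

abbreviation mul :: "tm \<Rightarrow> tm \<Rightarrow> tm"  (infixl "\<^bold>*" 70) where "s \<^bold>* t \<equiv> Mul \<cdot> s \<cdot> t"

definition Pred :: tm where
  "Pred = (\<^bold>\<lambda>\<^sup>0 t. rec0 t Zero (\<lambda>v m. m))"

text \<open>Truncated subtraction.\<close>

definition Monus :: tm where
  "Monus = (\<^bold>\<lambda>\<^sup>0 s. \<^bold>\<lambda>\<^sup>0 t. rec0 t s (\<lambda>v m. Pred \<cdot> v))"

abbreviation monus :: "tm \<Rightarrow> tm \<Rightarrow> tm"  (infixl "\<^bold>-" 65) where "s \<^bold>- t \<equiv> Monus \<cdot> s \<cdot> t"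

definition Pow2 :: tm where
  "Pow2 = (\<^bold>\<lambda>\<^sup>0 t. rec0 t One (\<lambda>v m. v \<^bold>+ v))"

definition le :: "tm \<Rightarrow> tm \<Rightarrow> fm"  (infix "\<^bold>\<le>" 50) where
  "s \<^bold>\<le> t = (s \<^bold>- t \<^bold>= Zero)"

definition less :: "tm \<Rightarrow> tm \<Rightarrow> fm"  (infix "\<^bold><" 50) where
  "s \<^bold>< t = (Succ \<cdot> s \<^bold>\<le> t)"

text \<open>
  Cantor's bijective pairing: the pair of \<open>s\<close> and \<open>t\<close> is \<open>Tri (s + t) + t\<close>, where
  \<open>Tri n = 0 + 1 + \<dots> + n\<close>.  \<open>Tri_Root t\<close> is the largest \<open>w\<close> with \<open>Tri w \<le> t\<close>; its
  recursion step adds 1 exactly if \<open>Tri (v + 1) \<le> m + 1\<close>.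
\<close>

definition Tri :: tm where
  "Tri = (\<^bold>\<lambda>\<^sup>0 t. rec0 t Zero (\<lambda>v m. v \<^bold>+ Succ \<cdot> m))"

definition Pair :: tm where
  "Pair = (\<^bold>\<lambda>\<^sup>0 s. \<^bold>\<lambda>\<^sup>0 t. Tri \<cdot> (s \<^bold>+ t) \<^bold>+ t)"

definition Tri_Root :: tm where
  "Tri_Root = (\<^bold>\<lambda>\<^sup>0 t. rec0 t Zero (\<lambda>v m. v \<^bold>+ (One \<^bold>- (Tri \<cdot> (Succ \<cdot> v) \<^bold>- Succ \<cdot> m))))"

definition Proj2 :: tm where
  "Proj2 = (\<^bold>\<lambda>\<^sup>0 t. t \<^bold>- Tri \<cdot> (Tri_Root \<cdot> t))"

definition Proj1 :: tm where
  "Proj1 = (\<^bold>\<lambda>\<^sup>0 t. Tri_Root \<cdot> t \<^bold>- Proj2 \<cdot> t)"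


subsection \<open>Rationals\<close>

text \<open>The number coding the triple \<open>(a, b, d - 1)\<close> represents the rational \<open>(a - b) / d\<close>.\<close>

definition Rat :: tm where
  "Rat = (\<^bold>\<lambda>\<^sup>0 a. \<^bold>\<lambda>\<^sup>0 b. \<^bold>\<lambda>\<^sup>0 d. Pair \<cdot> a \<cdot> (Pair \<cdot> b \<cdot> (Pred \<cdot> d)))"

definition Pos :: tm where "Pos = Proj1"
definition Neg_Part :: tm where "Neg_Part = (\<^bold>\<lambda>\<^sup>0 q. Proj1 \<cdot> (Proj2 \<cdot> q))"
definition Den :: tm where "Den = (\<^bold>\<lambda>\<^sup>0 q. Succ \<cdot> (Proj2 \<cdot> (Proj2 \<cdot> q)))"

definition AddQ :: tm where
  "AddQ = (\<^bold>\<lambda>\<^sup>0 q. \<^bold>\<lambda>\<^sup>0 r. Rat \<cdot> (Pos \<cdot> q \<^bold>* Den \<cdot> r \<^bold>+ Pos \<cdot> r \<^bold>* Den \<cdot> q)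
     \<cdot> (Neg_Part \<cdot> q \<^bold>* Den \<cdot> r \<^bold>+ Neg_Part \<cdot> r \<^bold>* Den \<cdot> q) \<cdot> (Den \<cdot> q \<^bold>* Den \<cdot> r))"

abbreviation addQ :: "tm \<Rightarrow> tm \<Rightarrow> tm"  (infixl "+\<^sub>Q" 65) where "q +\<^sub>Q r \<equiv> AddQ \<cdot> q \<cdot> r"

definition UminusQ :: tm where
  "UminusQ = (\<^bold>\<lambda>\<^sup>0 q. Rat \<cdot> (Neg_Part \<cdot> q) \<cdot> (Pos \<cdot> q) \<cdot> (Den \<cdot> q))"

definition AbsQ :: tm where
  "AbsQ = (\<^bold>\<lambda>\<^sup>0 q. Rat \<cdot> ((Pos \<cdot> q \<^bold>- Neg_Part \<cdot> q) \<^bold>+ (Neg_Part \<cdot> q \<^bold>- Pos \<cdot> q)) \<cdot> Zero \<cdot> (Den \<cdot> q))"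

definition leQ :: "tm \<Rightarrow> tm \<Rightarrow> fm"  (infix "\<le>\<^sub>Q" 50) where
  "q \<le>\<^sub>Q r = (Pos \<cdot> q \<^bold>* Den \<cdot> r \<^bold>+ Neg_Part \<cdot> r \<^bold>* Den \<cdot> q
           \<^bold>\<le> Pos \<cdot> r \<^bold>* Den \<cdot> q \<^bold>+ Neg_Part \<cdot> q \<^bold>* Den \<cdot> r)"

definition lessQ :: "tm \<Rightarrow> tm \<Rightarrow> fm"  (infix "<\<^sub>Q" 50) where
  "q <\<^sub>Q r = (Pos \<cdot> q \<^bold>* Den \<cdot> r \<^bold>+ Neg_Part \<cdot> r \<^bold>* Den \<cdot> q
           \<^bold>< Pos \<cdot> r \<^bold>* Den \<cdot> q \<^bold>+ Neg_Part \<cdot> q \<^bold>* Den \<cdot> r)"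

text \<open>\<open>2\<^sup>-\<^sup>n\<close>\<close>

definition Inv_Pow2 :: tm where
  "Inv_Pow2 = (\<^bold>\<lambda>\<^sup>0 n. Rat \<cdot> One \<cdot> Zero \<cdot> (Pow2 \<cdot> n))"


subsection \<open>Reals\<close>

definition is_real :: "tm \<Rightarrow> fm" where
  "is_real x = (\<^bold>\<forall>\<^sup>0 n. \<^bold>\<forall>\<^sup>0 i. AbsQ \<cdot> (x \<cdot> n +\<^sub>Q UminusQ \<cdot> (x \<cdot> (n \<^bold>+ i))) <\<^sub>Q Inv_Pow2 \<cdot> n)"

text \<open>
  For fast-converging sequences, \<open>x \<le> y\<close> iff \<open>x\<^sub>n \<le> y\<^sub>n + 2\<^sup>-\<^sup>n\<^sup>+\<^sup>1\<close> for all \<open>n\<close>, and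
  \<open>x = y\<close> iff \<open>\<bar>x\<^sub>n - y\<^sub>n\<bar> \<le> 2\<^sup>-\<^sup>n\<^sup>+\<^sup>1\<close> for all \<open>n\<close>.
\<close>

definition eqR :: "tm \<Rightarrow> tm \<Rightarrow> fm"  (infix "=\<^sub>R" 50) where
  "x =\<^sub>R y = (\<^bold>\<forall>\<^sup>0 n. AbsQ \<cdot> (x \<cdot> n +\<^sub>Q UminusQ \<cdot> (y \<cdot> n)) \<le>\<^sub>Q Inv_Pow2 \<cdot> n +\<^sub>Q Inv_Pow2 \<cdot> n)"

definition leR :: "tm \<Rightarrow> tm \<Rightarrow> fm"  (infix "\<le>\<^sub>R" 50) where
  "x \<le>\<^sub>R y = (\<^bold>\<forall>\<^sup>0 n. x \<cdot> n \<le>\<^sub>Q y \<cdot> n +\<^sub>Q (Inv_Pow2 \<cdot> n +\<^sub>Q Inv_Pow2 \<cdot> n))"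

definition lessR :: "tm \<Rightarrow> tm \<Rightarrow> fm"  (infix "<\<^sub>R" 50) where
  "x <\<^sub>R y = (\<^bold>\<not> y \<le>\<^sub>R x)"

definition Of_Rat :: tm where
  "Of_Rat = (\<^bold>\<lambda>\<^sup>0 q. \<^bold>\<lambda>\<^sup>0 n. q)"

abbreviation zeroR :: tm where "zeroR \<equiv> Of_Rat \<cdot> (Rat \<cdot> Zero \<cdot> Zero \<cdot> One)"
abbreviation oneR :: tm where "oneR \<equiv> Of_Rat \<cdot> (Rat \<cdot> One \<cdot> Zero \<cdot> One)"

text \<open>The index shift keeps the sum of two fast-converging sequences fast-converging.\<close>

definition AddR :: tm where
  "AddR = (\<^bold>\<lambda>\<^sup>1 x. \<^bold>\<lambda>\<^sup>1 y. \<^bold>\<lambda>\<^sup>0 n. x \<cdot> (Succ \<cdot> n) +\<^sub>Q y \<cdot> (Succ \<cdot> n))"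

abbreviation addR :: "tm \<Rightarrow> tm \<Rightarrow> tm"  (infixl "+\<^sub>R" 65) where "x +\<^sub>R y \<equiv> AddR \<cdot> x \<cdot> y"

definition UminusR :: tm where
  "UminusR = (\<^bold>\<lambda>\<^sup>1 x. \<^bold>\<lambda>\<^sup>0 n. UminusQ \<cdot> (x \<cdot> n))"

definition AbsR :: tm where
  "AbsR = (\<^bold>\<lambda>\<^sup>1 x. \<^bold>\<lambda>\<^sup>0 n. AbsQ \<cdot> (x \<cdot> n))"

definition DistR :: tm where
  "DistR = (\<^bold>\<lambda>\<^sup>1 x. \<^bold>\<lambda>\<^sup>1 y. AbsR \<cdot> (x +\<^sub>R UminusR \<cdot> y))"

definition in_ball :: "tm \<Rightarrow> tm \<Rightarrow> tm \<Rightarrow> fm" where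
  "in_ball x y r = (DistR \<cdot> x \<cdot> y <\<^sub>R r)"

definition in_unit :: "tm \<Rightarrow> fm" where
  "in_unit x = (is_real x \<^bold>\<and> zeroR \<le>\<^sub>R x \<^bold>\<and> x \<le>\<^sub>R oneR)"

definition allR (binder "\<^bold>\<forall>\<^sub>R" 10) where
  "(\<^bold>\<forall>\<^sub>R x. F x) = (\<^bold>\<forall>\<^sup>1 x. is_real x \<^bold>\<longrightarrow> F x)"

definition allI (binder "\<^bold>\<forall>\<^sub>I" 10) where
  "(\<^bold>\<forall>\<^sub>I x. F x) = (\<^bold>\<forall>\<^sup>1 x. in_unit x \<^bold>\<longrightarrow> F x)"

definition exI (binder "\<^bold>\<exists>\<^sub>I" 10) where
  "(\<^bold>\<exists>\<^sub>I x. F x) = (\<^bold>\<exists>\<^sup>1 x. in_unit x \<^bold>\<and> F x)"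


section \<open>The principles\<close>

definition exists2 :: fm where
  "exists2 = (\<^bold>\<exists>\<^sup>2 \<phi>. (\<^bold>\<forall>\<^sup>1 f. \<phi> \<cdot> f \<^bold>\<le> One) \<^bold>\<and>
     (\<^bold>\<forall>\<^sup>1 f. (\<^bold>\<exists>\<^sup>0 n. f \<cdot> n \<^bold>= Zero) \<^bold>\<longleftrightarrow> \<phi> \<cdot> f \<^bold>= Zero))"

definition ACA0\<omega> :: "fm set" where
  "ACA0\<omega> = RCA0\<omega> \<union> {exists2}"

definition in_cantor :: "tm \<Rightarrow> fm" where
  "in_cantor f = (\<^bold>\<forall>\<^sup>0 n. f \<cdot> n \<^bold>\<le> One)"

text \<open>
  A finite sequence of objects of type 1 is a length \<open>l\<close> together with \<open>w\<close> of type \<open>0 \<rightarrow> 1\<close>.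
\<close>

definition IND0 :: fm where
  "IND0 = all (ty1 \<rightarrow> N \<rightarrow> N) (\<lambda>Y.
     (\<^bold>\<forall>\<^sup>0 n. \<^bold>\<forall>\<^sup>1 f. \<^bold>\<forall>\<^sup>1 g. in_cantor f \<^bold>\<and> in_cantor g \<^bold>\<and> Y \<cdot> f \<cdot> n \<^bold>= Zero \<^bold>\<and> Y \<cdot> g \<cdot> n \<^bold>= Zero
        \<^bold>\<longrightarrow> eq ty1 f g)
     \<^bold>\<longrightarrow> (\<^bold>\<forall>\<^sup>0 k. \<^bold>\<exists>\<^sup>0 l. ex (N \<rightarrow> ty1) (\<lambda>w. \<^bold>\<forall>\<^sup>0 m. m \<^bold>\<le> k \<^bold>\<longrightarrow>
           ((\<^bold>\<exists>\<^sup>0 i. i \<^bold>< l \<^bold>\<and> in_cantor (w \<cdot> i) \<^bold>\<and> Y \<cdot> (w \<cdot> i) \<cdot> m \<^bold>= Zero)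
             \<^bold>\<longleftrightarrow> (\<^bold>\<exists>\<^sup>1 f. in_cantor f \<^bold>\<and> Y \<cdot> f \<cdot> m \<^bold>= Zero)))))"

definition NIN :: fm where
  "NIN = (\<^bold>\<not> (\<^bold>\<exists>\<^sup>2 Y.
     (\<^bold>\<forall>\<^sub>I x. \<^bold>\<forall>\<^sub>I y. x =\<^sub>R y \<^bold>\<longrightarrow> Y \<cdot> x \<^bold>= Y \<cdot> y) \<^bold>\<and>
     (\<^bold>\<forall>\<^sub>I x. \<^bold>\<forall>\<^sub>I y. Y \<cdot> x \<^bold>= Y \<cdot> y \<^bold>\<longrightarrow> x =\<^sub>R y)))"

text \<open>\<open>\<Psi>\<close>, of type \<open>1 \<rightarrow> 1\<close>, is a function from the unit interval to the positive reals.\<close>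

definition gauge :: "tm \<Rightarrow> fm" where
  "gauge \<Psi> = ((\<^bold>\<forall>\<^sub>I x. is_real (\<Psi> \<cdot> x) \<^bold>\<and> zeroR <\<^sub>R \<Psi> \<cdot> x) \<^bold>\<and>
     (\<^bold>\<forall>\<^sub>I x. \<^bold>\<forall>\<^sub>I y. x =\<^sub>R y \<^bold>\<longrightarrow> \<Psi> \<cdot> x =\<^sub>R \<Psi> \<cdot> y))"

definition has_finite_subcover :: "tm \<Rightarrow> fm" where
  "has_finite_subcover \<Psi> = (\<^bold>\<exists>\<^sup>0 k. ex (N \<rightarrow> ty1) (\<lambda>y.
     (\<^bold>\<forall>\<^sup>0 i. i \<^bold>\<le> k \<^bold>\<longrightarrow> in_unit (y \<cdot> i)) \<^bold>\<and>
     (\<^bold>\<forall>\<^sub>I x. \<^bold>\<exists>\<^sup>0 i. i \<^bold>\<le> k \<^bold>\<and> in_ball x (y \<cdot> i) (\<Psi> \<cdot> (y \<cdot> i)))))"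

text \<open>
  The limes superior of \<open>\<Psi>\<close> at \<open>x\<^sub>0\<close>, over the punctured neighbourhoods of \<open>x\<^sub>0\<close> in the unit
  interval, is at most \<open>a\<close>.  The suprema involved need not exist as reals over the base
  theory, so the inequality is unfolded.
\<close>

definition limsup_le :: "tm \<Rightarrow> tm \<Rightarrow> tm \<Rightarrow> fm" where
  "limsup_le \<Psi> x0 a = (\<^bold>\<forall>\<^sup>0 k. \<^bold>\<exists>\<^sup>0 n. \<^bold>\<forall>\<^sub>I x.
     zeroR <\<^sub>R DistR \<cdot> x \<cdot> x0 \<^bold>\<and> DistR \<cdot> x \<cdot> x0 <\<^sub>R Of_Rat \<cdot> (Inv_Pow2 \<cdot> n) \<^bold>\<longrightarrow> \<Psi> \<cdot> x \<le>\<^sub>R a +\<^sub>R Of_Rat \<cdot> (Inv_Pow2 \<cdot> k))"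

definition upper_semicontinuous :: "tm \<Rightarrow> fm" where
  "upper_semicontinuous \<Psi> = (\<^bold>\<forall>\<^sub>I x0. limsup_le \<Psi> x0 (\<Psi> \<cdot> x0))"

definition HBU_semi :: fm where
  "HBU_semi = all (ty1 \<rightarrow> ty1) (\<lambda>\<Psi>.
     gauge \<Psi> \<^bold>\<and> upper_semicontinuous \<Psi> \<^bold>\<longrightarrow> has_finite_subcover \<Psi>)"

text \<open>Sets of reals, as characteristic functions of type 2.\<close>

definition is_setR :: "tm \<Rightarrow> fm" where
  "is_setR E = ((\<^bold>\<forall>\<^sub>R x. E \<cdot> x \<^bold>\<le> One) \<^bold>\<and> (\<^bold>\<forall>\<^sub>R x. \<^bold>\<forall>\<^sub>R y. x =\<^sub>R y \<^bold>\<longrightarrow> E \<cdot> x \<^bold>= E \<cdot> y))"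

definition mem :: "tm \<Rightarrow> tm \<Rightarrow> fm"  (infix "\<^bold>\<in>" 50) where
  "x \<^bold>\<in> E = (E \<cdot> x \<^bold>= One)"

definition is_open :: "tm \<Rightarrow> fm" where
  "is_open E = (\<^bold>\<forall>\<^sub>R x. x \<^bold>\<in> E \<^bold>\<longrightarrow> (\<^bold>\<exists>\<^sup>0 n. \<^bold>\<forall>\<^sub>R y. in_ball y x (Of_Rat \<cdot> (Inv_Pow2 \<cdot> n)) \<^bold>\<longrightarrow> y \<^bold>\<in> E))"

text \<open>
  The characteristic function \<open>S\<close>, of type 3, of a family of sets of reals: the family contains
  the open sets and is closed under complements and countable unions.  Closure under
  complements makes \<open>S\<close> independent of the functional representing a set.
\<close>

definition sigma_algebra_of_opens :: "tm \<Rightarrow> fm" where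
  "sigma_algebra_of_opens S =
    ((\<^bold>\<forall>\<^sup>2 E. is_setR E \<^bold>\<and> is_open E \<^bold>\<longrightarrow> S \<cdot> E \<^bold>= One) \<^bold>\<and>
     (\<^bold>\<forall>\<^sup>2 E. \<^bold>\<forall>\<^sup>2 D. is_setR E \<^bold>\<and> is_setR D \<^bold>\<and> S \<cdot> E \<^bold>= One \<^bold>\<and> (\<^bold>\<forall>\<^sub>R x. x \<^bold>\<in> D \<^bold>\<longleftrightarrow> \<^bold>\<not> x \<^bold>\<in> E)
        \<^bold>\<longrightarrow> S \<cdot> D \<^bold>= One) \<^bold>\<and>
     all (N \<rightarrow> ty2) (\<lambda>E. \<^bold>\<forall>\<^sup>2 D.
        (\<^bold>\<forall>\<^sup>0 n. is_setR (E \<cdot> n) \<^bold>\<and> S \<cdot> (E \<cdot> n) \<^bold>= One) \<^bold>\<and> is_setR D \<^bold>\<and>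
        (\<^bold>\<forall>\<^sub>R x. x \<^bold>\<in> D \<^bold>\<longleftrightarrow> (\<^bold>\<exists>\<^sup>0 n. x \<^bold>\<in> E \<cdot> n))
        \<^bold>\<longrightarrow> S \<cdot> D \<^bold>= One))"

definition is_borel_set :: "tm \<Rightarrow> fm" where
  "is_borel_set E =
    (is_setR E \<^bold>\<and> all ty3 (\<lambda>S. sigma_algebra_of_opens S \<^bold>\<longrightarrow> S \<cdot> E \<^bold>= One))"

definition is_borel_function :: "tm \<Rightarrow> fm" where
  "is_borel_function \<Psi> = (\<^bold>\<forall>\<^sub>R a. \<^bold>\<exists>\<^sup>2 E. is_borel_set E \<^bold>\<and>
     (\<^bold>\<forall>\<^sub>R x. x \<^bold>\<in> E \<^bold>\<longleftrightarrow> in_unit x \<^bold>\<and> a <\<^sub>R \<Psi> \<cdot> x))"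

definition HBU_Borel :: fm where
  "HBU_Borel = all (ty1 \<rightarrow> ty1) (\<lambda>\<Psi>.
     gauge \<Psi> \<^bold>\<and> is_borel_function \<Psi> \<^bold>\<longrightarrow> has_finite_subcover \<Psi>)"

end

(*
  The three derivations are obtained from a completeness argument.  If one of them did not exist,
  a Henkin construction would give a complete theory with witnesses, hence an extensional model
  of the base theory with an injection Y from the unit interval to the numbers of the model in
  which the covering principle holds.  In the model, the gauge 4^(-Y x - 1) has no finite
  subcover: by injectivity there is at most one ball of radius 4^(-n-1) for each n, and nested
  quarter intervals avoid all of them.  This gauge is Borel, because {x. Y x = n} has at most one
  point and every set {x. Q (Y x)} is the countable union of such sets.  It is upper
  semi-continuous, because IND0, applied to the left cuts of reals, enumerates
  the points with Y x <= k in a finite sequence, so that those apart from x0 keep a positive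
  distance from it.
*)
theory Submission
  imports Defs "HOL-Library.Countable" "HOL-Computational_Algebra.Fraction_Field"
begin

text \<open>The numbers of the model may be nonstandard, so Isabelle's own arithmetic and reals do
  not describe it. Its number sort is made a type \<open>mnat\<close>, over which integers and an
  ordered field of fractions are built, so that algebra and linear arithmetic apply. A type cannot
  rest on a hypothesis; without a countermodel \<open>mnat\<close> is therefore a copy of
  \<open>nat\<close>. Induction reaches only predicates with an internal characteristic function,
  which is why internality (\<open>intl\<close>, \<open>intlc\<close>) accompanies every
  construction, and even the length of a finite sequence is not taken to be standard. The factor 4
  fits the quartering: an open ball of radius r has diameter 2r, the gap between the outer quarters
  of an interval of length 4r, so it misses one of them. The numbers of the centres of a subcover
  are bounded, so a finite stage suffices and no limit is taken. \<open>IND0\<close> asks for at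
  most one element of Cantor space per number, whereas a real has many representing sequences; its
  left cut is the same for all of them. A point enters the Borel sets as the complement of an open
  set.\<close>

instance ty :: countable by countable_datatype
instance tm :: countable by countable_datatype
instance fm :: countable by countable_datatype

section \<open>Simultaneous instantiation\<close>

text \<open>Terms have no binders, so local closure means that no index occurs at all; inserting
  such terms requires no shifting.\<close>

fun lc :: "tm \<Rightarrow> bool" where
  "lc (Bd i) = False"
| "lc (s \<cdot> t) = (lc s \<and> lc t)"
| "lc _ = True"

fun insts_tm :: "nat \<Rightarrow> tm list \<Rightarrow> tm \<Rightarrow> tm" where
  "insts_tm k ts (Bd i) = (if k \<le> i \<and> i - k < length ts then ts ! (i - k) else Bd i)"
| "insts_tm k ts (s \<cdot> t) = insts_tm k ts s \<cdot> insts_tm k ts t"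
| "insts_tm k ts t = t"

fun insts_fm :: "nat \<Rightarrow> tm list \<Rightarrow> fm \<Rightarrow> fm" where
  "insts_fm k ts (Eq s t) = Eq (insts_tm k ts s) (insts_tm k ts t)"
| "insts_fm k ts Fls = Fls"
| "insts_fm k ts (Imp \<phi> \<psi>) = Imp (insts_fm k ts \<phi>) (insts_fm k ts \<psi>)"
| "insts_fm k ts (All \<rho> \<phi>) = All \<rho> (insts_fm (Suc k) ts \<phi>)"

inductive_cases has_ty_BdE: "has_ty \<Delta> (Bd k) \<tau>"
inductive_cases has_ty_FrE: "has_ty \<Delta> (Fr n \<rho>) \<tau>"
inductive_cases has_ty_ZeroE: "has_ty \<Delta> Zero \<tau>"
inductive_cases has_ty_SuccE: "has_ty \<Delta> Succ \<tau>"
inductive_cases has_ty_PiE: "has_ty \<Delta> (Pi \<rho> \<sigma>) \<tau>"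
inductive_cases has_ty_SgE: "has_ty \<Delta> (Sg \<delta> \<rho> \<sigma>) \<tau>"
inductive_cases has_ty_RecE: "has_ty \<Delta> Rec \<tau>"
inductive_cases has_ty_AppE: "has_ty \<Delta> (s \<cdot> t) \<tau>"
lemmas has_ty_elims = has_ty_BdE has_ty_FrE has_ty_ZeroE has_ty_SuccE has_ty_PiE has_ty_SgE
  has_ty_RecE has_ty_AppE

lemma has_ty_weaken: "has_ty \<Delta> t \<tau> \<Longrightarrow> \<Delta> = [] \<Longrightarrow> has_ty \<Delta>' t \<tau>"
  by (induction rule: has_ty.induct) (simp_all, (rule has_ty.intros; assumption?)+)

lemma has_ty_lc: "has_ty \<Delta> t \<tau> \<Longrightarrow> \<Delta> = [] \<Longrightarrow> lc t"
  by (induction rule: has_ty.induct) auto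

lemma ty_of_has_ty: "has_ty \<Delta> t \<tau> \<Longrightarrow> \<Delta> = [] \<Longrightarrow> ty_of t = \<tau>"
  by (induction rule: has_ty.induct) auto

lemma insts_tm_lc [simp]: "lc t \<Longrightarrow> insts_tm k ts t = t"
  by (induction t) auto

lemma insts_tm_Nil [simp]: "insts_tm k [] t = t"
  by (induction t) auto

lemma insts_fm_Nil [simp]: "insts_fm k [] \<phi> = \<phi>"
  by (induction \<phi> arbitrary: k) auto

lemma inst_tm_lc [simp]: "lc t \<Longrightarrow> inst_tm k u t = t"
  by (induction t) auto

text \<open>The terms in \<open>ts\<close> contain no index, so a later substitution for
  \<open>k\<close> cannot reach inside them and merges with the earlier one.\<close>

lemma inst_insts_tm:
  "\<forall>s\<in>set ts. lc s \<Longrightarrow> lc t \<Longrightarrow> inst_tm k t (insts_tm (Suc k) ts u) = insts_tm k (t # ts) u"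
  by (induction u) (auto simp: nth_Cons' Suc_le_eq le_Suc_eq)

lemma inst_insts_fm:
  "\<forall>s\<in>set ts. lc s \<Longrightarrow> lc t \<Longrightarrow> inst_fm k t (insts_fm (Suc k) ts \<phi>) = insts_fm k (t # ts) \<phi>"
  by (induction \<phi> arbitrary: k) (auto simp: inst_insts_tm)

lemma inst_fm_conv_insts: "lc t \<Longrightarrow> inst_fm k t \<phi> = insts_fm k [t] \<phi>"
  using inst_insts_fm [of "[]"] by simp

lemma has_ty_insts:
  "has_ty \<Gamma> t \<tau> \<Longrightarrow> \<Gamma> = \<Delta>' @ \<Delta> \<Longrightarrow> list_all2 (has_ty []) ts \<Delta> \<Longrightarrow>
    has_ty \<Delta>' (insts_tm (length \<Delta>') ts t) \<tau>"
proof (induction rule: has_ty.induct)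
  case (1 k \<Gamma>)
  then show ?case
    by (auto simp: nth_append list_all2_conv_all_nth intro: has_ty.intros has_ty_weaken)
qed (auto intro: has_ty.intros)

lemma wf_fm_insts:
  "wf_fm (\<Delta>' @ \<Delta>) \<phi> \<Longrightarrow> list_all2 (has_ty []) ts \<Delta> \<Longrightarrow> wf_fm \<Delta>' (insts_fm (length \<Delta>') ts \<phi>)"
proof (induction \<phi> arbitrary: \<Delta>')
  case (All \<rho> \<phi>)
  then show ?case using All.IH [of "\<rho> # \<Delta>'"] by simp
qed (auto intro: has_ty_insts)

section \<open>Freshness and the abstraction of a variable\<close>

lemma fresh_tm_fv: "(n, \<rho>) \<in> fv_tm t \<Longrightarrow> n < fresh_tm t"
  by (induction t) auto

lemma fresh_fm_fv: "(n, \<rho>) \<in> fv_fm \<phi> \<Longrightarrow> n < fresh_fm \<phi>"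
  by (induction \<phi>) (auto dest: fresh_tm_fv)

lemma bind_tm_id [simp]: "(n, \<rho>) \<notin> fv_tm t \<Longrightarrow> bind_tm k n \<rho> t = t"
  by (induction t) auto

text \<open>\<open>Zero\<close> contributes no variables, so freshness for the instance at
  \<open>Zero\<close> says that the name occurs neither in \<open>t\<close> nor in the inserted
  parameters. Every occurrence in the other instance then stems from index \<open>k\<close>.\<close>

lemma bind_insts_tm:
  "(n, \<rho>) \<notin> fv_tm (insts_tm k (Zero # ts) t) \<Longrightarrow>
    bind_tm k n \<rho> (insts_tm k (Fr n \<rho> # ts) t) = insts_tm (Suc k) ts t"
  by (induction t) (auto simp: nth_Cons' Suc_le_eq le_Suc_eq split: if_splits)

lemma bind_insts_fm:
  "(n, \<rho>) \<notin> fv_fm (insts_fm k (Zero # ts) \<phi>) \<Longrightarrow>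
    bind_fm k n \<rho> (insts_fm k (Fr n \<rho> # ts) \<phi>) = insts_fm (Suc k) ts \<phi>"
  by (induction \<phi> arbitrary: k) (auto simp: bind_insts_tm)


section \<open>Uniform families of terms and formulas\<close>

text \<open>
  A body \<open>F :: tm \<Rightarrow> fm\<close> could inspect its argument.  The following predicates say that it does
  not: it is the instantiation of a fixed open formula.
\<close>

definition uniform_tm :: "ty list \<Rightarrow> (tm list \<Rightarrow> tm) \<Rightarrow> ty \<Rightarrow> bool" where
  "uniform_tm \<Delta> f \<tau> \<longleftrightarrow> (\<exists>t. has_ty \<Delta> t \<tau> \<and>
     (\<forall>ts. length ts = length \<Delta> \<and> (\<forall>s\<in>set ts. lc s) \<longrightarrow> f ts = insts_tm 0 ts t))"

definition uniform_fm :: "ty list \<Rightarrow> (tm list \<Rightarrow> fm) \<Rightarrow> bool" where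
  "uniform_fm \<Delta> F \<longleftrightarrow> (\<exists>\<phi>. wf_fm \<Delta> \<phi> \<and>
     (\<forall>ts. length ts = length \<Delta> \<and> (\<forall>s\<in>set ts. lc s) \<longrightarrow> F ts = insts_fm 0 ts \<phi>))"

lemma uniform_tm_const: "has_ty [] c \<tau> \<Longrightarrow> uniform_tm \<Delta> (\<lambda>_. c) \<tau>"
  unfolding uniform_tm_def by (metis has_ty_lc has_ty_weaken insts_tm_lc)

lemma uniform_tm_hd: "uniform_tm (\<rho> # \<Delta>) (\<lambda>ts. hd ts) \<rho>"
  unfolding uniform_tm_def
  by (rule exI [of _ "Bd 0"]) (auto simp: hd_conv_nth simp flip: length_greater_0_conv intro: has_ty.intros(1) [of 0 "\<rho> # \<Delta>", simplified])

lemma uniform_tm_app: "uniform_tm \<Delta> f (\<rho> \<rightarrow> \<tau>) \<Longrightarrow> uniform_tm \<Delta> g \<rho> \<Longrightarrow> uniform_tm \<Delta> (\<lambda>ts. f ts \<cdot> g ts) \<tau>"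
  unfolding uniform_tm_def by (metis has_ty.intros(8) insts_tm.simps(2))

fun up_tm :: "tm \<Rightarrow> tm" where
  "up_tm (Bd i) = Bd (Suc i)"
| "up_tm (s \<cdot> t) = up_tm s \<cdot> up_tm t"
| "up_tm t = t"

lemma has_ty_up: "has_ty \<Delta> t \<tau> \<Longrightarrow> has_ty (\<rho> # \<Delta>) (up_tm t) \<tau>"
proof (induction rule: has_ty.induct)
  case (1 k \<Delta>)
  then show ?case using has_ty.intros(1) [of "Suc k" "\<rho> # \<Delta>"] by simp
qed (auto intro: has_ty.intros)

lemma insts_up: "insts_tm 0 (s # ts) (up_tm t) = insts_tm 0 ts t" if "has_ty \<Delta> t \<tau>" "length ts = length \<Delta>"
  using that by (induction rule: has_ty.induct) auto

lemma uniform_tm_tl: "uniform_tm \<Delta> f \<tau> \<Longrightarrow> uniform_tm (\<rho> # \<Delta>) (\<lambda>ts. f (tl ts)) \<tau>"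
  unfolding uniform_tm_def
proof (elim exE conjE)
  fix t
  assume t: "has_ty \<Delta> t \<tau>"
    and f: "\<forall>ts. length ts = length \<Delta> \<and> (\<forall>s\<in>set ts. lc s) \<longrightarrow> f ts = insts_tm 0 ts t"
  have "f (tl ts) = insts_tm 0 ts (up_tm t)"
    if "length ts = length (\<rho> # \<Delta>) \<and> (\<forall>s\<in>set ts. lc s)" for ts
    using that f insts_up [OF t] by (cases ts) auto
  then show "\<exists>t. has_ty (\<rho> # \<Delta>) t \<tau> \<and>
      (\<forall>ts. length ts = length (\<rho> # \<Delta>) \<and> (\<forall>s\<in>set ts. lc s) \<longrightarrow> f (tl ts) = insts_tm 0 ts t)"
    using has_ty_up [OF t] by blast
qed

lemma uniform_fm_Eq: "uniform_tm \<Delta> f N \<Longrightarrow> uniform_tm \<Delta> g N \<Longrightarrow> uniform_fm \<Delta> (\<lambda>ts. Eq (f ts) (g ts))"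
  unfolding uniform_tm_def uniform_fm_def by (metis insts_fm.simps(1) wf_fm.simps(1))

lemma uniform_fm_Fls: "uniform_fm \<Delta> (\<lambda>ts. Fls)"
  unfolding uniform_fm_def by (metis insts_fm.simps(2) wf_fm.simps(2))

lemma uniform_fm_Imp: "uniform_fm \<Delta> F \<Longrightarrow> uniform_fm \<Delta> G \<Longrightarrow> uniform_fm \<Delta> (\<lambda>ts. Imp (F ts) (G ts))"
  unfolding uniform_fm_def by (metis insts_fm.simps(3) wf_fm.simps(3))

text \<open>The name picked by \<open>all\<close> leaves no trace: it is fresh for the parameters,
  so binding it restores the open formula.\<close>

lemma all_conv_All:
  assumes "\<And>x. lc x \<Longrightarrow> F x = insts_fm 0 (x # ts) \<phi>"
  shows "all \<rho> F = All \<rho> (insts_fm 1 ts \<phi>)"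
proof -
  have "(fresh_fm (F Zero), \<rho>) \<notin> fv_fm (insts_fm 0 (Zero # ts) \<phi>)"
    using assms [of Zero] fresh_fm_fv by fastforce
  from bind_insts_fm [OF this] show ?thesis
    by (simp add: all_def Let_def assms)
qed

text \<open>The bound variable is index 0 of the enlarged context, hence the head of the list of
  arguments; the parameters are the tail.\<close>

lemma uniform_fm_all:
  assumes "uniform_fm (\<rho> # \<Delta>) (\<lambda>ts. F (tl ts) (hd ts))"
  shows "uniform_fm \<Delta> (\<lambda>ts. all \<rho> (F ts))"
proof -
  obtain \<phi> where wf: "wf_fm (\<rho> # \<Delta>) \<phi>"
    and F: "\<And>ts. length ts = length (\<rho> # \<Delta>) \<Longrightarrow> \<forall>s\<in>set ts. lc s \<Longrightarrow> F (tl ts) (hd ts) = insts_fm 0 ts \<phi>"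
    using assms unfolding uniform_fm_def by blast
  have "all \<rho> (F ts) = insts_fm 0 ts (All \<rho> \<phi>)"
    if "length ts = length \<Delta> \<and> (\<forall>s\<in>set ts. lc s)" for ts
    using all_conv_All [of "F ts" ts \<phi>] F [of "_ # ts"] that by simp
  then show ?thesis unfolding uniform_fm_def using wf by (intro exI [of _ "All \<rho> \<phi>"]) auto
qed

lemma uniform_fm_Neg: "uniform_fm \<Delta> F \<Longrightarrow> uniform_fm \<Delta> (\<lambda>ts. \<^bold>\<not> F ts)"
  unfolding Neg_def by (intro uniform_fm_Imp uniform_fm_Fls)

lemma uniform_fm_Conj: "uniform_fm \<Delta> F \<Longrightarrow> uniform_fm \<Delta> G \<Longrightarrow> uniform_fm \<Delta> (\<lambda>ts. F ts \<^bold>\<and> G ts)"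
  unfolding Conj_def by (intro uniform_fm_Neg uniform_fm_Imp)

lemma uniform_fm_Iff: "uniform_fm \<Delta> F \<Longrightarrow> uniform_fm \<Delta> G \<Longrightarrow> uniform_fm \<Delta> (\<lambda>ts. F ts \<^bold>\<longleftrightarrow> G ts)"
  unfolding Iff_def by (intro uniform_fm_Conj uniform_fm_Imp)

lemma uniform_fm_ex: "uniform_fm (\<rho> # \<Delta>) (\<lambda>ts. F (tl ts) (hd ts)) \<Longrightarrow> uniform_fm \<Delta> (\<lambda>ts. ex \<rho> (F ts))"
  unfolding ex_def by (intro uniform_fm_Neg uniform_fm_all)

lemma uniform_fm_wf: "uniform_fm [] (\<lambda>_. \<phi>) \<Longrightarrow> wf_fm [] \<phi>"
  unfolding uniform_fm_def by auto

lemma uniform_fm_eq: "uniform_tm \<Delta> f \<rho> \<Longrightarrow> uniform_tm \<Delta> g \<rho> \<Longrightarrow> uniform_fm \<Delta> (\<lambda>ts. eq \<rho> (f ts) (g ts))"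
proof (induction \<rho> arbitrary: \<Delta> f g)
  case (Fn \<rho> \<tau>)
  show ?case
    unfolding eq.simps by (intro uniform_fm_all Fn.IH(2) uniform_tm_app [of _ _ \<rho>] uniform_tm_tl [of _ f] uniform_tm_tl [of _ g] uniform_tm_hd Fn.prems)
qed (simp add: uniform_fm_Eq)


section \<open>Complete theories with witnesses\<close>

text \<open>\<open>has_ty []\<close> excludes loose indices but not free variables
  \<open>Fr\<close>; these are the constants that serve as witnesses. Equality has no clause of its
  own, since its axioms enter as members of the set.\<close>

definition henkin :: "fm set \<Rightarrow> bool" where
  "henkin W \<longleftrightarrow> Fls \<notin> W \<and>
     (\<forall>\<phi> \<psi>. wf_fm [] \<phi> \<and> wf_fm [] \<psi> \<longrightarrow> (Imp \<phi> \<psi> \<in> W \<longleftrightarrow> (\<phi> \<in> W \<longrightarrow> \<psi> \<in> W))) \<and>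
     (\<forall>\<rho> \<phi>. wf_fm [\<rho>] \<phi> \<longrightarrow> (All \<rho> \<phi> \<in> W \<longleftrightarrow> (\<forall>t. has_ty [] t \<rho> \<longrightarrow> inst_fm 0 t \<phi> \<in> W)))"

definition list_fresh :: "fm list \<Rightarrow> nat" where
  "list_fresh \<Gamma> = Max (insert 0 (fresh_fm ` set \<Gamma>))"

lemma list_fresh_fv: "\<psi> \<in> set \<Gamma> \<Longrightarrow> (list_fresh \<Gamma>, \<rho>) \<notin> fv_fm \<psi>"
proof
  assume "\<psi> \<in> set \<Gamma>" "(list_fresh \<Gamma>, \<rho>) \<in> fv_fm \<psi>"
  moreover from this have "fresh_fm \<psi> \<le> list_fresh \<Gamma>" unfolding list_fresh_def by (intro Max_ge) auto
  ultimately show False using fresh_fm_fv by fastforce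
qed

context
  fixes T :: "fm set"
begin

text \<open>
  Rejected formulas enter the list negated.  This avoids weakening, which may fail for an
  arbitrary set of axioms because of the eigenvariable condition.
\<close>

fun witness :: "fm \<Rightarrow> fm list \<Rightarrow> fm list" where
  "witness (All \<rho> \<phi>) \<Gamma> =
     (let \<Gamma>' = Neg (All \<rho> \<phi>) # \<Gamma> in Neg (inst_fm 0 (Fr (list_fresh \<Gamma>') \<rho>) \<phi>) # \<Gamma>')"
| "witness \<phi> \<Gamma> = Neg \<phi> # \<Gamma>"

definition decide :: "fm \<Rightarrow> fm list \<Rightarrow> fm list" where
  "decide \<phi> \<Gamma> = (if \<not> wf_fm [] \<phi> then \<Gamma> else if derives T (\<phi> # \<Gamma>) Fls then witness \<phi> \<Gamma> else \<phi> # \<Gamma>)"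

primrec stage :: "fm \<Rightarrow> nat \<Rightarrow> fm list" where
  "stage \<phi> 0 = [Neg \<phi>]"
| "stage \<phi> (Suc k) = decide (from_nat k) (stage \<phi> k)"

lemma wf_fm_inst_Fr: "wf_fm [\<rho>] \<phi> \<Longrightarrow> has_ty [] t \<rho> \<Longrightarrow> wf_fm [] (inst_fm 0 t \<phi>)"
  using wf_fm_insts [of "[]" "[\<rho>]" \<phi> "[t]"] inst_fm_conv_insts [of t 0 \<phi>] has_ty_lc by simp

text \<open>Rejecting a formula is safe because its negation is already derivable. For a universal
  formula the negated instance at a fresh variable is safe too: otherwise that instance, and by
  generalization the universal formula, would follow.\<close>

lemma decide_consistent:
  assumes "\<not> derives T \<Gamma> Fls"
  shows "\<not> derives T (decide \<phi> \<Gamma>) Fls"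
proof (cases "wf_fm [] \<phi> \<and> derives T (\<phi> # \<Gamma>) Fls")
  case False
  then show ?thesis using assms by (auto simp: decide_def)
next
  case True
  then have neg: "derives T \<Gamma> (Neg \<phi>)" unfolding Neg_def by (auto intro: derives.ImpI)
  have 1: "\<not> derives T (Neg \<phi> # \<Gamma>) Fls"
  proof
    assume "derives T (Neg \<phi> # \<Gamma>) Fls"
    then have "derives T \<Gamma> (Imp (Neg \<phi>) Fls)" using True by (auto intro!: derives.ImpI simp: Neg_def)
    then show False using neg assms by (auto intro: derives.ImpE)
  qed
  show ?thesis
  proof (cases \<phi>)
    case (All \<rho> \<chi>)
    let ?\<Gamma> = "Neg \<phi> # \<Gamma>"
    let ?c = "list_fresh ?\<Gamma>"
    let ?\<psi> = "inst_fm 0 (Fr ?c \<rho>) \<chi>"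
    have "wf_fm [] ?\<psi>" using True All by (auto intro: wf_fm_inst_Fr has_ty.intros)
    have "(?c, \<rho>) \<notin> fv_fm \<chi>" using list_fresh_fv [of "Neg \<phi>" ?\<Gamma> \<rho>] All by (simp add: Neg_def)
    have "\<not> derives T (Neg ?\<psi> # ?\<Gamma>) Fls"
    proof
      assume "derives T (Neg ?\<psi> # ?\<Gamma>) Fls"
      then have "derives T ?\<Gamma> ?\<psi>" using \<open>wf_fm [] ?\<psi>\<close> by (auto simp: Neg_def intro: derives.Contr)
      then have "derives T ?\<Gamma> \<phi>" unfolding All
        using \<open>(?c, \<rho>) \<notin> fv_fm \<chi>\<close> list_fresh_fv All by (auto intro!: derives.AllI [where n = ?c])
      moreover have "derives T ?\<Gamma> (Imp \<phi> Fls)" by (rule derives.Assm) (simp add: Neg_def)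
      ultimately show False using 1 by (auto intro: derives.ImpE)
    qed
    then show ?thesis using True All by (simp add: decide_def Let_def)
  qed (use True 1 in \<open>auto simp: decide_def\<close>)
qed

lemma decide_subset: "set \<Gamma> \<subseteq> set (decide \<phi> \<Gamma>)"
  by (cases \<phi>) (auto simp: decide_def Let_def)

lemma stage_mono: "i \<le> j \<Longrightarrow> set (stage \<phi> i) \<subseteq> set (stage \<phi> j)"
  by (induction j) (auto simp: le_Suc_eq dest: subsetD [OF decide_subset])

theorem henkin_extension:
  assumes "\<not> (T \<turnstile> \<phi>)" "wf_fm [] \<phi>"
  shows "\<exists>W. henkin W \<and> (\<forall>\<psi>\<in>T. wf_fm [] \<psi> \<longrightarrow> \<psi> \<in> W) \<and> \<phi> \<notin> W"
proof -
  define W where "W = (\<Union>k. set (stage \<phi> k))"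
  have con: "\<not> derives T (stage \<phi> k) Fls" for k
  proof (induction k)
    case 0
    then show ?case using assms by (auto simp: proves_def Neg_def intro: derives.Contr)
  qed (auto simp: decide_consistent)
  \<comment> \<open>Inconsistency is demanded over every list that contains \<Gamma>, because a
    derivation from \<Gamma> alone could not be weakened to one from a stage.\<close>
  have incons: False
    if "set \<Gamma> \<subseteq> W" "\<And>\<Delta>. set \<Gamma> \<subseteq> set \<Delta> \<Longrightarrow> derives T \<Delta> Fls" for \<Gamma>
  proof -
    have "\<exists>k. set \<Gamma> \<subseteq> set (stage \<phi> k)" using that(1)
    proof (induction \<Gamma>)
      case (Cons \<psi> \<Gamma>)
      then obtain k l where "set \<Gamma> \<subseteq> set (stage \<phi> k)" "\<psi> \<in> set (stage \<phi> l)" unfolding W_def by auto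
      then show ?case using stage_mono [of k "max k l" \<phi>] stage_mono [of l "max k l" \<phi>]
        by (intro exI [of _ "max k l"]) auto
    qed auto
    then show False using that(2) con by blast
  qed
  \<comment> \<open>\<open>from_nat\<close> inverts \<open>to_nat\<close>, so each formula is put up
    for decision at the stage numbered by its code.\<close>
  have dec: "\<psi> \<in> W \<or> Neg \<psi> \<in> W" if "wf_fm [] \<psi>" for \<psi>
  proof -
    have "\<psi> \<in> set (stage \<phi> (Suc (to_nat \<psi>))) \<or> Neg \<psi> \<in> set (stage \<phi> (Suc (to_nat \<psi>)))"
      using that by (cases \<psi>) (auto simp: decide_def Let_def)
    then show ?thesis unfolding W_def by blast
  qed
  have A: "derives T \<Delta> \<psi>" if "\<psi> \<in> set \<Delta>" for \<psi> \<Delta> using that by (rule derives.Assm)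
  have notboth: "\<not> (\<psi> \<in> W \<and> Neg \<psi> \<in> W)" for \<psi>
    using incons [of "[\<psi>, Neg \<psi>]"] by (auto simp: Neg_def intro: derives.ImpE A)
  have Fls: "Fls \<notin> W" using incons [of "[Fls]"] by (auto intro: A)
  have 1: "\<psi>' \<in> W" if "Imp \<psi> \<psi>' \<in> W" "\<psi> \<in> W" "wf_fm [] \<psi>'" for \<psi> \<psi>'
  proof (rule ccontr)
    assume "\<psi>' \<notin> W"
    with dec that have "Neg \<psi>' \<in> W" by blast
    moreover have "derives T \<Delta> Fls" if "set [\<psi>, Imp \<psi> \<psi>', Neg \<psi>'] \<subseteq> set \<Delta>" for \<Delta>
      using that unfolding Neg_def by (intro derives.ImpE [of _ _ \<psi>' Fls] derives.ImpE [of _ _ \<psi> \<psi>'] A) auto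
    ultimately show False using that incons [of "[\<psi>, Imp \<psi> \<psi>', Neg \<psi>']"] by simp
  qed
  have 2: "Imp \<psi> \<psi>' \<in> W" if "\<psi> \<in> W \<longrightarrow> \<psi>' \<in> W" "wf_fm [] \<psi>" "wf_fm [] \<psi>'" for \<psi> \<psi>'
  proof (rule ccontr)
    assume "Imp \<psi> \<psi>' \<notin> W"
    with dec [of "Imp \<psi> \<psi>'"] that have n: "Neg (Imp \<psi> \<psi>') \<in> W" by simp
    show False
    proof (cases "\<psi>' \<in> W")
      case True
      moreover have "derives T \<Delta> Fls" if "set [\<psi>', Neg (Imp \<psi> \<psi>')] \<subseteq> set \<Delta>" for \<Delta>
        using that \<open>wf_fm [] \<psi>\<close> unfolding Neg_def
        by (intro derives.ImpE [OF A derives.ImpI [OF _ A]]) auto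
      ultimately show False using n incons [of "[\<psi>', Neg (Imp \<psi> \<psi>')]"] by simp
    next
      case False
      then have "Neg \<psi> \<in> W" using that dec by blast
      moreover have "derives T \<Delta> Fls" if "set [Neg \<psi>, Neg (Imp \<psi> \<psi>')] \<subseteq> set \<Delta>" for \<Delta>
      proof -
        have "derives T (\<psi> # \<Delta>) \<psi>'"
          by (rule derives.Contr [OF \<open>wf_fm [] \<psi>'\<close>], rule derives.ImpE [of _ _ \<psi>])
            (use that in \<open>auto simp: Neg_def intro: A\<close>)
        then have "derives T \<Delta> (Imp \<psi> \<psi>')" using \<open>wf_fm [] \<psi>\<close> by (auto intro: derives.ImpI)
        then show ?thesis by (rule derives.ImpE [rotated]) (use that in \<open>auto simp: Neg_def intro: A\<close>)
      qed
      ultimately show False using n incons [of "[Neg \<psi>, Neg (Imp \<psi> \<psi>')]"] by simp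
    qed
  qed
  have 3: "inst_fm 0 t \<chi> \<in> W" if "All \<rho> \<chi> \<in> W" "wf_fm [\<rho>] \<chi>" "has_ty [] t \<rho>" for \<rho> \<chi> t
  proof (rule ccontr)
    assume "inst_fm 0 t \<chi> \<notin> W"
    with dec that wf_fm_inst_Fr have "Neg (inst_fm 0 t \<chi>) \<in> W" by blast
    moreover have "derives T \<Delta> Fls" if "set [All \<rho> \<chi>, Neg (inst_fm 0 t \<chi>)] \<subseteq> set \<Delta>" for \<Delta>
      using that \<open>has_ty [] t \<rho>\<close> unfolding Neg_def
      by (intro derives.ImpE [of _ _ "inst_fm 0 t \<chi>" Fls] derives.AllE [of _ _ \<rho>] A) auto
    ultimately show False using that incons [of "[All \<rho> \<chi>, Neg (inst_fm 0 t \<chi>)]"] by simp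
  qed
  have 4: "All \<rho> \<chi> \<in> W"
    if "\<forall>t. has_ty [] t \<rho> \<longrightarrow> inst_fm 0 t \<chi> \<in> W" "wf_fm [\<rho>] \<chi>" for \<rho> \<chi>
  proof (rule ccontr)
    assume "All \<rho> \<chi> \<notin> W"
    let ?k = "to_nat (All \<rho> \<chi>)"
    have "All \<rho> \<chi> \<notin> set (stage \<phi> (Suc ?k))" using \<open>All \<rho> \<chi> \<notin> W\<close> unfolding W_def by blast
    \<comment> \<open>The universal formula was rejected when its turn came, and the stage then
      received its negated witness instance.\<close>
    then have "\<exists>c. Neg (inst_fm 0 (Fr c \<rho>) \<chi>) \<in> set (stage \<phi> (Suc ?k))"
      using that by (auto simp: decide_def Let_def split: if_splits)
    then obtain c where "Neg (inst_fm 0 (Fr c \<rho>) \<chi>) \<in> W" unfolding W_def by blast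
    moreover have "inst_fm 0 (Fr c \<rho>) \<chi> \<in> W" using that by (auto intro: has_ty.intros)
    ultimately show False using notboth by blast
  qed
  have 5: "\<psi> \<in> W" if "\<psi> \<in> T" "wf_fm [] \<psi>" for \<psi>
  proof (rule ccontr)
    assume "\<psi> \<notin> W"
    with dec that have "Neg \<psi> \<in> W" by blast
    moreover have "derives T \<Delta> Fls" if "set [Neg \<psi>] \<subseteq> set \<Delta>" for \<Delta>
      using that \<open>\<psi> \<in> T\<close> unfolding Neg_def by (intro derives.ImpE [of _ _ \<psi> Fls] A derives.Ax) auto
    ultimately show False using incons [of "[Neg \<psi>]"] by simp
  qed
  have "Neg \<phi> \<in> W" unfolding W_def by (auto intro!: exI [of _ 0])
  then have "\<phi> \<notin> W" using notboth by blast
  moreover have "henkin W" unfolding henkin_def using Fls 1 2 3 4 by blast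
  ultimately show ?thesis using 5 by blast
qed

end


section \<open>The countermodel\<close>

text \<open>A failure of any of the three derivations yields a set of this kind, so a single
  contradiction settles all of them.\<close>

definition countermodel :: "fm set \<Rightarrow> bool" where
  "countermodel W \<longleftrightarrow> henkin W \<and> (\<forall>\<phi>\<in>ACA0\<omega>. wf_fm [] \<phi> \<longrightarrow> \<phi> \<in> W) \<and> NIN \<notin> W \<and>
     (HBU_Borel \<in> W \<or> HBU_semi \<in> W \<and> IND0 \<in> W)"

definition W0 :: "fm set" where "W0 = (SOME W. countermodel W)"

text \<open>
  The number sort of the countermodel is to become a type, so everything below is relative to
  the assumption \<open>cm\<close> that there is a countermodel; otherwise the type is a copy of \<open>nat\<close>.
\<close>

definition cm :: bool where "cm \<longleftrightarrow> (\<exists>W. countermodel W)"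

lemma countermodel_W0: "cm \<Longrightarrow> countermodel W0"
  unfolding cm_def W0_def by (rule someI_ex)

text \<open>The bridge from syntax to HOL. Truth in the countermodel is membership in
  \<open>W0\<close>; well-formedness is carried along because the Henkin clauses require it.\<close>

definition means :: "fm \<Rightarrow> bool \<Rightarrow> bool" where
  "means \<phi> P \<longleftrightarrow> wf_fm [] \<phi> \<and> (\<phi> \<in> W0 \<longleftrightarrow> P)"

lemma means_axiom: "cm \<Longrightarrow> \<phi> \<in> ACA0\<omega> \<Longrightarrow> means \<phi> P \<Longrightarrow> P"
  using countermodel_W0 unfolding countermodel_def means_def by blast

lemma means_cong: "means \<phi> P \<Longrightarrow> P = Q \<Longrightarrow> means \<phi> Q"
  by simp

lemma means_Fls: "cm \<Longrightarrow> means Fls False"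
  using countermodel_W0 unfolding countermodel_def henkin_def means_def by auto

lemma means_Imp: "cm \<Longrightarrow> means \<phi> P \<Longrightarrow> means \<psi> Q \<Longrightarrow> means (Imp \<phi> \<psi>) (P \<longrightarrow> Q)"
  using countermodel_W0 unfolding countermodel_def henkin_def means_def by auto

lemma means_Neg: "cm \<Longrightarrow> means \<phi> P \<Longrightarrow> means (Neg \<phi>) (\<not> P)"
  unfolding Neg_def by (rule means_cong, rule means_Imp [OF _ _ means_Fls]) auto

lemma means_Conj: "cm \<Longrightarrow> means \<phi> P \<Longrightarrow> means \<psi> Q \<Longrightarrow> means (Conj \<phi> \<psi>) (P \<and> Q)"
  unfolding Conj_def by (rule means_cong, rule means_Neg [OF _ means_Imp [OF _ _ means_Neg]]) auto

lemma means_Iff: "cm \<Longrightarrow> means \<phi> P \<Longrightarrow> means \<psi> Q \<Longrightarrow> means (Iff \<phi> \<psi>) (P \<longleftrightarrow> Q)"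
  unfolding Iff_def by (rule means_cong, rule means_Conj [OF _ means_Imp means_Imp]) auto

lemma means_All:
  assumes "cm" "wf_fm [\<rho>] \<phi>" "\<And>t. has_ty [] t \<rho> \<Longrightarrow> means (inst_fm 0 t \<phi>) (P t)"
  shows "means (All \<rho> \<phi>) (\<forall>t. has_ty [] t \<rho> \<longrightarrow> P t)"
  using countermodel_W0 [OF \<open>cm\<close>] assms unfolding countermodel_def henkin_def means_def by simp

lemma means_all_tm:
  assumes "cm" "uniform_fm [\<rho>] (\<lambda>ts. F (hd ts))" "\<And>t. has_ty [] t \<rho> \<Longrightarrow> means (F t) (P t)"
  shows "means (all \<rho> F) (\<forall>t. has_ty [] t \<rho> \<longrightarrow> P t)"
proof -
  obtain \<phi> where wf: "wf_fm [\<rho>] \<phi>" and F: "\<And>t. lc t \<Longrightarrow> F t = insts_fm 0 [t] \<phi>"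
    using assms(2) unfolding uniform_fm_def
    by (metis One_nat_def length_Cons list.sel(1) list.set(1) list.set(2) list.size(3) singletonD)
  have "all \<rho> F = All \<rho> \<phi>" using all_conv_All [of F "[]" \<phi> \<rho>] F by simp
  then show ?thesis
    using wf assms F by (auto intro!: means_All simp: inst_fm_conv_insts has_ty_lc)
qed

text \<open>Only equations between numbers refer to \<open>W0\<close>; at higher types equality is
  extensional, as in the defined formula \<open>eq\<close>, with which \<open>means_eq\<close>
  identifies it.\<close>

primrec eqv :: "ty \<Rightarrow> tm \<Rightarrow> tm \<Rightarrow> bool" where
  "eqv N s t \<longleftrightarrow> Eq s t \<in> W0"
| "eqv (\<rho> \<rightarrow> \<tau>) s t \<longleftrightarrow> (\<forall>u. has_ty [] u \<rho> \<longrightarrow> eqv \<tau> (s \<cdot> u) (t \<cdot> u))"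

lemma means_Eq: "has_ty [] s N \<Longrightarrow> has_ty [] t N \<Longrightarrow> means (Eq s t) (eqv N s t)"
  unfolding means_def by simp

text \<open>Typing, uniformity and later meaning rules in one collection: repeated resolution with
  it evaluates a formula of the object language along its syntax.\<close>

named_theorems sem_intros

lemmas [sem_intros] = uniform_tm_const uniform_tm_hd uniform_tm_app uniform_tm_tl uniform_fm_Eq uniform_fm_Fls uniform_fm_Imp uniform_fm_all uniform_fm_Neg uniform_fm_Conj uniform_fm_Iff uniform_fm_ex uniform_fm_eq
lemmas [sem_intros] = has_ty.intros(2-8)

lemma means_eq: "cm \<Longrightarrow> has_ty [] s \<rho> \<Longrightarrow> has_ty [] t \<rho> \<Longrightarrow> means (eq \<rho> s t) (eqv \<rho> s t)"
proof (induction \<rho> arbitrary: s t)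
  case N
  then show ?case using means_Eq by simp
next
  case (Fn \<rho> \<tau>)
  have "uniform_tm [\<rho>] (\<lambda>ts. s) (\<rho> \<rightarrow> \<tau>)" "uniform_tm [\<rho>] (\<lambda>ts. t) (\<rho> \<rightarrow> \<tau>)" using Fn.prems by (auto intro: uniform_tm_const)
  then show ?case
    unfolding eq.simps eqv.simps using Fn
    by (intro means_all_tm) (assumption | rule Fn.IH sem_intros)+
qed

lemma in_ACA0: "\<phi> \<in> RCA0\<omega> \<Longrightarrow> \<phi> \<in> ACA0\<omega>"
  unfolding ACA0\<omega>_def by simp

context
  assumes cm: cm
begin

section \<open>Equality in the countermodel and combinatory completeness\<close>

lemma eqv_N_refl: "has_ty [] t N \<Longrightarrow> eqv N t t"
proof -
  have "means (\<^bold>\<forall>\<^sup>0 x. x \<^bold>= x) (\<forall>t. has_ty [] t N \<longrightarrow> eqv N t t)"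
    by (assumption | rule means_all_tm means_Imp cm means_eq means_Eq sem_intros)+
  from means_axiom [OF cm in_ACA0 this] show "has_ty [] t N \<Longrightarrow> eqv N t t"
    unfolding RCA0\<omega>_def equality_axioms_def by auto
qed

lemma eqv_N_sym: "has_ty [] s N \<Longrightarrow> has_ty [] t N \<Longrightarrow> eqv N s t \<Longrightarrow> eqv N t s"
proof -
  have "means (\<^bold>\<forall>\<^sup>0 x. \<^bold>\<forall>\<^sup>0 y. x \<^bold>= y \<^bold>\<longrightarrow> y \<^bold>= x)
    (\<forall>s. has_ty [] s N \<longrightarrow> (\<forall>t. has_ty [] t N \<longrightarrow> eqv N s t \<longrightarrow> eqv N t s))"
    by (assumption | rule means_all_tm means_Imp cm means_eq means_Eq sem_intros)+
  from means_axiom [OF cm in_ACA0 this]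
  show "has_ty [] s N \<Longrightarrow> has_ty [] t N \<Longrightarrow> eqv N s t \<Longrightarrow> eqv N t s"
    unfolding RCA0\<omega>_def equality_axioms_def by auto
qed

lemma eqv_N_trans:
  assumes "has_ty [] s N" "has_ty [] t N" "has_ty [] u N" "eqv N s t" "eqv N t u"
  shows "eqv N s u"
proof -
  have "means (\<^bold>\<forall>\<^sup>0 x. \<^bold>\<forall>\<^sup>0 y. \<^bold>\<forall>\<^sup>0 z. x \<^bold>= y \<^bold>\<longrightarrow> y \<^bold>= z \<^bold>\<longrightarrow> x \<^bold>= z)
    (\<forall>s. has_ty [] s N \<longrightarrow> (\<forall>t. has_ty [] t N \<longrightarrow> (\<forall>u. has_ty [] u N \<longrightarrow>
       eqv N s t \<longrightarrow> eqv N t u \<longrightarrow> eqv N s u)))"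
    by (assumption | rule means_all_tm means_Imp cm means_eq means_Eq sem_intros)+
  from means_axiom [OF cm in_ACA0 this] show ?thesis
    using assms unfolding RCA0\<omega>_def equality_axioms_def by blast
qed

lemma eqv_refl: "has_ty [] t \<rho> \<Longrightarrow> eqv \<rho> t t"
  by (induction \<rho> arbitrary: t) (auto simp del: eqv.simps(1) intro: eqv_N_refl has_ty.intros)

lemma eqv_sym: "has_ty [] s \<rho> \<Longrightarrow> has_ty [] t \<rho> \<Longrightarrow> eqv \<rho> s t \<Longrightarrow> eqv \<rho> t s"
proof (induction \<rho> arbitrary: s t)
  case N then show ?case by (rule eqv_N_sym)
next
  case (Fn \<rho> \<tau>) then show ?case unfolding eqv.simps by (metis has_ty.intros(8))
qed

lemma eqv_trans:
  "has_ty [] s \<rho> \<Longrightarrow> has_ty [] t \<rho> \<Longrightarrow> has_ty [] u \<rho> \<Longrightarrow> eqv \<rho> s t \<Longrightarrow> eqv \<rho> t u \<Longrightarrow> eqv \<rho> s u"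
proof (induction \<rho> arbitrary: s t u)
  case N then show ?case by (rule eqv_N_trans)
next
  case (Fn \<rho> \<tau>)
  show ?case
    unfolding eqv.simps
  proof (intro allI impI)
    fix v assume "has_ty [] v \<rho>"
    with Fn.prems show "eqv \<tau> (s \<cdot> v) (u \<cdot> v)"
      by (intro Fn.IH(2) [of "s \<cdot> v" "t \<cdot> v" "u \<cdot> v"]) (auto intro: has_ty.intros(8))
  qed
qed

lemma eqv_ext:
  assumes "has_ty [] x \<rho>" "has_ty [] y \<rho>" "has_ty [] z (\<rho> \<rightarrow> \<tau>)" "eqv \<rho> x y"
  shows "eqv \<tau> (z \<cdot> x) (z \<cdot> y)"
proof -
  let ?\<phi> = "all \<rho> (\<lambda>x. all \<rho> (\<lambda>y. all (\<rho> \<rightarrow> \<tau>) (\<lambda>z. eq \<rho> x y \<^bold>\<longrightarrow> eq \<tau> (z \<cdot> x) (z \<cdot> y))))"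
  have "means ?\<phi> (\<forall>x. has_ty [] x \<rho> \<longrightarrow> (\<forall>y. has_ty [] y \<rho> \<longrightarrow> (\<forall>z. has_ty [] z (\<rho> \<rightarrow> \<tau>) \<longrightarrow>
       eqv \<rho> x y \<longrightarrow> eqv \<tau> (z \<cdot> x) (z \<cdot> y))))"
    by (assumption | rule means_all_tm means_Imp cm means_eq means_Eq sem_intros)+
  from means_axiom [OF cm in_ACA0 this] show ?thesis
    using assms unfolding RCA0\<omega>_def extensionality_axioms_def by blast
qed

lemma eqv_app:
  assumes "has_ty [] f (\<rho> \<rightarrow> \<tau>)" "has_ty [] g (\<rho> \<rightarrow> \<tau>)" "has_ty [] s \<rho>" "has_ty [] t \<rho>"
    "eqv (\<rho> \<rightarrow> \<tau>) f g" "eqv \<rho> s t"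
  shows "eqv \<tau> (f \<cdot> s) (g \<cdot> t)"
proof -
  have "eqv \<tau> (f \<cdot> s) (f \<cdot> t)" using assms by (intro eqv_ext)
  moreover have "eqv \<tau> (f \<cdot> t) (g \<cdot> t)" using assms by auto
  ultimately show ?thesis using assms by (auto intro: eqv_trans [of _ _ "f \<cdot> t"] has_ty.intros(8))
qed

lemma eqv_Pi:
  assumes "has_ty [] x \<rho>" "has_ty [] y \<tau>"
  shows "eqv \<rho> (Pi \<rho> \<tau> \<cdot> x \<cdot> y) x"
proof -
  let ?\<phi> = "all \<rho> (\<lambda>x. all \<tau> (\<lambda>y. eq \<rho> (Pi \<rho> \<tau> \<cdot> x \<cdot> y) x))"
  have "means ?\<phi> (\<forall>x. has_ty [] x \<rho> \<longrightarrow> (\<forall>y. has_ty [] y \<tau> \<longrightarrow> eqv \<rho> (Pi \<rho> \<tau> \<cdot> x \<cdot> y) x))"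
    by (assumption | rule means_all_tm means_Imp cm means_eq means_Eq sem_intros)+
  from means_axiom [OF cm in_ACA0 this] show ?thesis
    using assms unfolding RCA0\<omega>_def combinator_axioms_def by blast
qed

lemma eqv_Sg:
  assumes "has_ty [] x (\<delta> \<rightarrow> \<rho> \<rightarrow> \<tau>)" "has_ty [] y (\<delta> \<rightarrow> \<rho>)" "has_ty [] z \<delta>"
  shows "eqv \<tau> (Sg \<delta> \<rho> \<tau> \<cdot> x \<cdot> y \<cdot> z) (x \<cdot> z \<cdot> (y \<cdot> z))"
proof -
  let ?\<phi> = "all (\<delta> \<rightarrow> \<rho> \<rightarrow> \<tau>) (\<lambda>x. all (\<delta> \<rightarrow> \<rho>) (\<lambda>y. all \<delta> (\<lambda>z.
       eq \<tau> (Sg \<delta> \<rho> \<tau> \<cdot> x \<cdot> y \<cdot> z) (x \<cdot> z \<cdot> (y \<cdot> z)))))"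
  have "means ?\<phi> (\<forall>x. has_ty [] x (\<delta> \<rightarrow> \<rho> \<rightarrow> \<tau>) \<longrightarrow> (\<forall>y. has_ty [] y (\<delta> \<rightarrow> \<rho>) \<longrightarrow>
      (\<forall>z. has_ty [] z \<delta> \<longrightarrow> eqv \<tau> (Sg \<delta> \<rho> \<tau> \<cdot> x \<cdot> y \<cdot> z) (x \<cdot> z \<cdot> (y \<cdot> z)))))"
    by (assumption | rule means_all_tm means_Imp cm means_eq means_Eq sem_intros)+
  from means_axiom [OF cm in_ACA0 this] show ?thesis
    using assms unfolding RCA0\<omega>_def combinator_axioms_def by blast
qed

text \<open>Abstraction of index 0 by the usual combinators: K where the index is absent, S at
  applications, SKK for the index itself. The equation holds up to \<open>eqv\<close>, since the
  combinator axioms are equations of the theory.\<close>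

lemma combinatory_completeness:
  assumes "has_ty (\<rho> # \<Delta>) t \<tau>"
  shows "\<exists>u. has_ty \<Delta> u (\<rho> \<rightarrow> \<tau>) \<and> (\<forall>ts s. list_all2 (has_ty []) ts \<Delta> \<longrightarrow> has_ty [] s \<rho> \<longrightarrow>
     eqv \<tau> (insts_tm 0 ts u \<cdot> s) (insts_tm 0 (s # ts) t))"
proof -
  \<comment> \<open>\<open>c\<close> is \<open>t\<close> with its indices lowered by one, a term
    over the context without the abstracted variable.\<close>
  have K: "\<exists>u. has_ty \<Delta> u (\<rho> \<rightarrow> \<tau>) \<and> (\<forall>ts s. list_all2 (has_ty []) ts \<Delta> \<longrightarrow> has_ty [] s \<rho> \<longrightarrow>
      eqv \<tau> (insts_tm 0 ts u \<cdot> s) (insts_tm 0 (s # ts) t))"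
    if "has_ty \<Delta> c \<tau>" "\<And>s ts. length ts = length \<Delta> \<Longrightarrow> insts_tm 0 (s # ts) t = insts_tm 0 ts c" for t c \<tau>
  proof (intro exI conjI allI impI)
    show "has_ty \<Delta> (Pi \<tau> \<rho> \<cdot> c) (\<rho> \<rightarrow> \<tau>)" using that by (auto intro: has_ty.intros)
    fix ts s
    assume ts: "list_all2 (has_ty []) ts \<Delta>" and s: "has_ty [] s \<rho>"
    then show "eqv \<tau> (insts_tm 0 ts (Pi \<tau> \<rho> \<cdot> c) \<cdot> s) (insts_tm 0 (s # ts) t)"
      using that has_ty_insts [of \<Delta> c \<tau> "[]" \<Delta> ts] by (simp add: eqv_Pi list_all2_lengthD)
  qed
  have "\<exists>u. has_ty \<Delta> u (\<rho> \<rightarrow> \<tau>) \<and> (\<forall>ts s. list_all2 (has_ty []) ts \<Delta> \<longrightarrow> has_ty [] s \<rho> \<longrightarrow>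
      eqv \<tau> (insts_tm 0 ts u \<cdot> s) (insts_tm 0 (s # ts) t))" if "has_ty \<Gamma> t \<tau>" "\<Gamma> = \<rho> # \<Delta>" for \<Gamma>
    using that
  proof (induction rule: has_ty.induct)
    case (1 k \<Gamma>)
    show ?case
    proof (cases k)
      case 0
      let ?I = "Sg \<rho> (\<rho> \<rightarrow> \<rho>) \<rho> \<cdot> Pi \<rho> (\<rho> \<rightarrow> \<rho>) \<cdot> Pi \<rho> \<rho>"
      have I: "has_ty [] ?I (\<rho> \<rightarrow> \<rho>)" by (rule sem_intros)+
      have "eqv \<rho> (?I \<cdot> s) s" if "has_ty [] s \<rho>" for s
      proof (rule eqv_trans)
        show "eqv \<rho> (?I \<cdot> s) (Pi \<rho> (\<rho> \<rightarrow> \<rho>) \<cdot> s \<cdot> (Pi \<rho> \<rho> \<cdot> s))"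
          by (insert that) (assumption | rule eqv_Sg sem_intros)+
        show "eqv \<rho> (Pi \<rho> (\<rho> \<rightarrow> \<rho>) \<cdot> s \<cdot> (Pi \<rho> \<rho> \<cdot> s)) s"
          by (insert that) (assumption | rule eqv_Pi sem_intros)+
      qed (insert that, (assumption | rule sem_intros)+)
      then show ?thesis using 0 1 has_ty_weaken [OF I refl]
        by (intro exI [of _ ?I]) auto
    next
      case (Suc i)
      then show ?thesis using 1 by (intro K [of "Bd i"]) (auto intro: has_ty.intros)
    qed
  next
    case (8 \<Gamma> f \<sigma> \<tau> a)
    then obtain u v where u: "has_ty \<Delta> u (\<rho> \<rightarrow> \<sigma> \<rightarrow> \<tau>)" "\<And>ts s. list_all2 (has_ty []) ts \<Delta> \<Longrightarrow>
        has_ty [] s \<rho> \<Longrightarrow> eqv (\<sigma> \<rightarrow> \<tau>) (insts_tm 0 ts u \<cdot> s) (insts_tm 0 (s # ts) f)"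
      and v: "has_ty \<Delta> v (\<rho> \<rightarrow> \<sigma>)" "\<And>ts s. list_all2 (has_ty []) ts \<Delta> \<Longrightarrow>
        has_ty [] s \<rho> \<Longrightarrow> eqv \<sigma> (insts_tm 0 ts v \<cdot> s) (insts_tm 0 (s # ts) a)" by metis
    let ?S = "Sg \<rho> \<sigma> \<tau> \<cdot> u \<cdot> v"
    show ?case
    proof (intro exI conjI allI impI)
      show "has_ty \<Delta> ?S (\<rho> \<rightarrow> \<tau>)" using u v by (auto intro: has_ty.intros)
      fix ts s
      assume ts: "list_all2 (has_ty []) ts \<Delta>" and s: "has_ty [] s \<rho>"
      let ?u = "insts_tm 0 ts u" and ?v = "insts_tm 0 ts v"
      have t: "has_ty [] ?u (\<rho> \<rightarrow> \<sigma> \<rightarrow> \<tau>)" "has_ty [] ?v (\<rho> \<rightarrow> \<sigma>)"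
        "has_ty [] (insts_tm 0 (s # ts) f) (\<sigma> \<rightarrow> \<tau>)" "has_ty [] (insts_tm 0 (s # ts) a) \<sigma>"
        using ts s u(1) v(1) 8 has_ty_insts [of _ _ _ "[]"] by auto
      have "eqv \<tau> (Sg \<rho> \<sigma> \<tau> \<cdot> ?u \<cdot> ?v \<cdot> s) (?u \<cdot> s \<cdot> (?v \<cdot> s))"
        using t s by (intro eqv_Sg)
      moreover have "eqv \<tau> (?u \<cdot> s \<cdot> (?v \<cdot> s)) (insts_tm 0 (s # ts) f \<cdot> insts_tm 0 (s # ts) a)"
        using t s by (intro eqv_app [of _ \<sigma>] u v ts) (auto intro: has_ty.intros(8))
      ultimately show "eqv \<tau> (insts_tm 0 ts ?S \<cdot> s) (insts_tm 0 (s # ts) (f \<cdot> a))"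
        unfolding insts_tm.simps
        by (rule eqv_trans [rotated 3]) (insert t s, (assumption | rule sem_intros)+)
    qed
  next
    case 2 show ?case by (rule K [OF has_ty.intros(2)]) simp
  next
    case 3 show ?case by (rule K [OF has_ty.intros(3)]) simp
  next
    case 4 show ?case by (rule K [OF has_ty.intros(4)]) simp
  next
    case 5 show ?case by (rule K [OF has_ty.intros(5)]) simp
  next
    case 6 show ?case by (rule K [OF has_ty.intros(6)]) simp
  next
    case 7 show ?case by (rule K [OF has_ty.intros(7)]) simp
  qed
  then show ?thesis using assms by blast
qed

end


section \<open>The number sort as a type\<close>

definition num_class :: "tm \<Rightarrow> tm set" where
  "num_class t = {s. has_ty [] s N \<and> eqv N t s}"

typedef mnat = "{X :: tm set + nat. if cm then \<exists>t. has_ty [] t N \<and> X = Inl (num_class t) else \<exists>n. X = Inr n}"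
  using has_ty.intros(3) by (cases cm) auto

definition num :: "tm \<Rightarrow> mnat" where "num t = Abs_mnat (Inl (num_class t))"
definition std :: "nat \<Rightarrow> mnat" where "std n = Abs_mnat (Inr n)"
definition unstd :: "mnat \<Rightarrow> nat" where "unstd x = (case Rep_mnat x of Inr n \<Rightarrow> n | _ \<Rightarrow> 0)"

lemma num_eq_iff:
  assumes "cm" "has_ty [] s N" "has_ty [] t N"
  shows "num s = num t \<longleftrightarrow> eqv N s t"
proof -
  have "num s = num t \<longleftrightarrow> num_class s = num_class t"
    unfolding num_def using assms by (subst Abs_mnat_inject) auto
  also have "\<dots> \<longleftrightarrow> eqv N s t"
    unfolding num_class_def using assms
    by (auto simp del: eqv.simps intro: eqv_N_sym eqv_N_trans eqv_N_refl)
  finally show ?thesis .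
qed

lemma num_surj: "cm \<Longrightarrow> \<exists>t. has_ty [] t N \<and> num t = x"
  using Rep_mnat [of x] Rep_mnat_inverse [of x] unfolding num_def by auto

lemma std_unstd: "\<not> cm \<Longrightarrow> std (unstd x) = x"
  using Rep_mnat [of x] Rep_mnat_inverse [of x] unfolding std_def unstd_def by auto

lemma unstd_std: "\<not> cm \<Longrightarrow> unstd (std n) = n"
  unfolding std_def unstd_def by (simp add: Abs_mnat_inverse)


section \<open>Elements of the countermodel as functions\<close>

text \<open>
  The relation \<open>rel t x\<close>: the closed term \<open>t\<close> denotes \<open>x\<close>.  Only the values of a
  function at denoted arguments matter.
\<close>

class mtype =
  fixes tyc :: "'a itself \<Rightarrow> ty" and rel :: "tm \<Rightarrow> 'a \<Rightarrow> bool"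
  assumes rel_ty: "rel t x \<Longrightarrow> has_ty [] t (tyc TYPE('a))"
    and rel_total: "cm \<Longrightarrow> has_ty [] t (tyc TYPE('a)) \<Longrightarrow> \<exists>x. rel t x"
    and rel_eqv: "cm \<Longrightarrow> rel t x \<Longrightarrow> rel s x \<Longrightarrow> eqv (tyc TYPE('a)) t s"
    and rel_resp: "cm \<Longrightarrow> rel t x \<Longrightarrow> has_ty [] s (tyc TYPE('a)) \<Longrightarrow> eqv (tyc TYPE('a)) t s \<Longrightarrow> rel s x"

instantiation mnat :: mtype
begin

definition tyc_mnat :: "mnat itself \<Rightarrow> ty" where "tyc_mnat _ = N"
definition rel_mnat :: "tm \<Rightarrow> mnat \<Rightarrow> bool" where "rel_mnat t x \<longleftrightarrow> has_ty [] t N \<and> num t = x"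

instance
  by standard (auto simp: tyc_mnat_def rel_mnat_def num_eq_iff simp del: eqv.simps(1) intro: eqv_N_sym)

end

instantiation "fun" :: (mtype, mtype) mtype
begin

definition tyc_fun :: "('a \<Rightarrow> 'b) itself \<Rightarrow> ty" where
  "tyc_fun _ = (tyc TYPE('a) \<rightarrow> tyc TYPE('b))"

definition rel_fun :: "tm \<Rightarrow> ('a \<Rightarrow> 'b) \<Rightarrow> bool" where
  "rel_fun t f \<longleftrightarrow> has_ty [] t (tyc TYPE('a \<Rightarrow> 'b)) \<and> (\<forall>s x. rel s x \<longrightarrow> rel (t \<cdot> s) (f x))"

instance
proof
  fix t s :: tm and f :: "'a \<Rightarrow> 'b"
  let ?a = "tyc TYPE('a)" and ?b = "tyc TYPE('b)"
  show "rel t f \<Longrightarrow> has_ty [] t (tyc TYPE('a \<Rightarrow> 'b))" by (simp add: rel_fun_def)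
  show "\<exists>f :: 'a \<Rightarrow> 'b. rel t f" if cm: cm and t: "has_ty [] t (tyc TYPE('a \<Rightarrow> 'b))"
  proof -
    \<comment> \<open>The value is read off at some representative of \<open>x\<close>;
      extensionality then shows that every representative gives it. At arguments that no term
      denotes, the value is arbitrary.\<close>
    define f :: "'a \<Rightarrow> 'b" where "f x = (SOME y. \<exists>s. rel s x \<and> rel (t \<cdot> s) y)" for x
    have t': "has_ty [] t (?a \<rightarrow> ?b)" using t by (simp add: tyc_fun_def)
    have "rel (t \<cdot> s) (f x)" if s: "rel s x" for s x
    proof -
      have ty: "has_ty [] (t \<cdot> u) ?b" if "rel u x" for u
        using rel_ty [OF that] t' by (auto intro: has_ty.intros(8))
      obtain y :: 'b where "rel (t \<cdot> s) y" using rel_total [OF cm ty [OF s]] by auto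
      then have "\<exists>u. rel u x \<and> rel (t \<cdot> u) (f x)"
        unfolding f_def by (intro someI_ex [of "\<lambda>y. \<exists>s. rel s x \<and> rel (t \<cdot> s) y"]) (use s in blast)
      then obtain u where u: "rel u x" "rel (t \<cdot> u) (f x)" by blast
      have "eqv ?b (t \<cdot> u) (t \<cdot> s)"
        using rel_eqv [OF cm u(1) s] rel_ty [OF u(1)] rel_ty [OF s] t' by (rule_tac eqv_ext [OF cm])
      then show ?thesis using rel_resp [OF cm u(2)] ty [OF s] by blast
    qed
    then show ?thesis using t unfolding rel_fun_def by blast
  qed
  show "eqv (tyc TYPE('a \<Rightarrow> 'b)) t s" if cm: cm and "rel t f" "rel s f"
    unfolding tyc_fun_def eqv.simps
  proof (intro allI impI)
    fix u assume "has_ty [] u ?a"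
    then obtain x where "rel u (x :: 'a)" using rel_total [OF cm] by blast
    then show "eqv ?b (t \<cdot> u) (s \<cdot> u)" using that rel_eqv [OF cm, of _ "f x"] unfolding rel_fun_def by blast
  qed
  show "rel s f" if cm: cm and t: "rel t f" and s: "has_ty [] s (tyc TYPE('a \<Rightarrow> 'b))"
    and e: "eqv (tyc TYPE('a \<Rightarrow> 'b)) t s"
    unfolding rel_fun_def
  proof (intro conjI s allI impI)
    fix u and x :: 'a assume u: "rel u x"
    from rel_ty [OF u] s e have "eqv ?b (t \<cdot> u) (s \<cdot> u)" "has_ty [] (s \<cdot> u) ?b"
      by (auto simp: tyc_fun_def intro: has_ty.intros(8))
    then show "rel (s \<cdot> u) (f x)" using t u rel_resp [OF cm, of "t \<cdot> u"] unfolding rel_fun_def by blast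
  qed
qed

end

lemma rel_app: "rel t f \<Longrightarrow> rel s x \<Longrightarrow> rel (t \<cdot> s) (f x)"
  by (simp add: rel_fun_def)

lemma rel_fun_eqI:
  assumes "has_ty [] t (tyc TYPE('a::mtype) \<rightarrow> tyc TYPE('b::mtype))" "\<And>s x. rel s x \<Longrightarrow> rel (t \<cdot> s) (f x)"
  shows "rel t (f :: 'a \<Rightarrow> 'b)"
  using assms unfolding rel_fun_def tyc_fun_def by simp

text \<open>Without a countermodel everything counts as internal. The laws of \<open>mnat\<close>
  can thus be proved without assuming \<open>cm\<close>, as type class instances require.\<close>

definition intl :: "'a::mtype \<Rightarrow> bool" where
  "intl x \<longleftrightarrow> (cm \<longrightarrow> (\<exists>t. rel t x))"

lemma intl_mnat: "intl (x :: mnat)"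
  unfolding intl_def rel_mnat_def using num_surj by blast

text \<open>Contexts are right-nested tuples closed by the unit type, so that the k-th component
  belongs to de Bruijn index k.\<close>

class mctx =
  fixes ctys :: "'a itself \<Rightarrow> ty list" and crel :: "tm list \<Rightarrow> 'a \<Rightarrow> bool"
  assumes crel_ty: "crel ts c \<Longrightarrow> list_all2 (has_ty []) ts (ctys TYPE('a))"

instantiation unit :: mctx
begin
definition ctys_unit :: "unit itself \<Rightarrow> ty list" where "ctys_unit _ = []"
definition crel_unit :: "tm list \<Rightarrow> unit \<Rightarrow> bool" where "crel_unit ts _ \<longleftrightarrow> ts = []"
instance by standard (auto simp: ctys_unit_def crel_unit_def)
end

instantiation prod :: (mtype, mctx) mctx
begin
definition ctys_prod :: "('a \<times> 'b) itself \<Rightarrow> ty list" where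
  "ctys_prod _ = tyc TYPE('a) # ctys TYPE('b)"
definition crel_prod :: "tm list \<Rightarrow> 'a \<times> 'b \<Rightarrow> bool" where
  "crel_prod ts p \<longleftrightarrow> (\<exists>s us. ts = s # us \<and> rel s (fst p) \<and> crel us (snd p))"
instance by standard (auto simp: ctys_prod_def crel_prod_def rel_ty crel_ty)
end

text \<open>A context is a tuple of variables; \<open>intlc\<close> is \<open>intl\<close> for functions of several variables.\<close>

definition intlc :: "('c::mctx \<Rightarrow> 'a::mtype) \<Rightarrow> bool" where
  "intlc f \<longleftrightarrow> (cm \<longrightarrow> (\<exists>t. has_ty (ctys TYPE('c)) t (tyc TYPE('a)) \<and>
     (\<forall>ts c. crel ts c \<longrightarrow> rel (insts_tm 0 ts t) (f c))))"

lemma intlc_const: "intl x \<Longrightarrow> intlc (\<lambda>c. x)"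
  unfolding intl_def intlc_def by (metis has_ty_lc has_ty_weaken insts_tm_lc rel_ty)

lemma intlc_fst: "intlc (\<lambda>c. fst c)"
  unfolding intlc_def
  by (intro impI exI [of _ "Bd 0"])
    (auto simp: ctys_prod_def crel_prod_def intro: has_ty.intros(1) [of 0 "_ # _", simplified])

lemma intlc_snd:
  fixes f :: "'c::mctx \<Rightarrow> 'a::mtype"
  assumes "intlc f" shows "intlc (\<lambda>c :: 'b::mtype \<times> 'c. f (snd c))"
  unfolding intlc_def
proof
  assume cm
  with assms obtain t where t: "has_ty (ctys TYPE('c)) t (tyc TYPE('a))"
    "\<And>ts c. crel ts c \<Longrightarrow> rel (insts_tm 0 ts t) (f c)" unfolding intlc_def by blast
  have "rel (insts_tm 0 ts (up_tm t)) (f (snd c))" if c: "crel ts c" for ts and c :: "'b \<times> 'c"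
  proof -
    obtain s us where ts: "ts = s # us" "crel us (snd c)" using c by (auto simp: crel_prod_def)
    then show ?thesis using t insts_up [OF t(1)] crel_ty list_all2_lengthD by metis
  qed
  then show "\<exists>t. has_ty (ctys TYPE('b \<times> 'c)) t (tyc TYPE('a)) \<and>
     (\<forall>ts c. crel ts (c :: 'b \<times> 'c) \<longrightarrow> rel (insts_tm 0 ts t) (f (snd c)))"
    using has_ty_up [OF t(1)] by (intro exI [of _ "up_tm t"]) (simp add: ctys_prod_def)
qed

lemma intlc_app:
  fixes f :: "'c::mctx \<Rightarrow> 'a::mtype \<Rightarrow> 'b::mtype"
  assumes "intlc f" "intlc g" shows "intlc (\<lambda>c. f c (g c))"
  unfolding intlc_def
proof
  assume cm
  with assms obtain t u where "has_ty (ctys TYPE('c)) t (tyc TYPE('a \<Rightarrow> 'b))"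
    "\<And>ts c. crel ts c \<Longrightarrow> rel (insts_tm 0 ts t) (f c)"
    "has_ty (ctys TYPE('c)) u (tyc TYPE('a))" "\<And>ts c. crel ts c \<Longrightarrow> rel (insts_tm 0 ts u) (g c)"
    unfolding intlc_def by blast
  then show "\<exists>t. has_ty (ctys TYPE('c)) t (tyc TYPE('b)) \<and>
     (\<forall>ts c. crel ts c \<longrightarrow> rel (insts_tm 0 ts t) (f c (g c)))"
    by (intro exI [of _ "t \<cdot> u"]) (auto simp: tyc_fun_def rel_app intro: has_ty.intros(8))
qed

text \<open>The term comes from combinatory completeness; it agrees with the body only up to
  \<open>eqv\<close>, which \<open>rel_resp\<close> absorbs.\<close>

lemma intlc_lam:
  fixes f :: "'c::mctx \<Rightarrow> 'a::mtype \<Rightarrow> 'b::mtype"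
  assumes "intlc (\<lambda>d. f (snd d) (fst d))" shows "intlc f"
  unfolding intlc_def
proof
  assume cm: cm
  let ?a = "tyc TYPE('a)" and ?b = "tyc TYPE('b)"
  from cm assms obtain t where t: "has_ty (?a # ctys TYPE('c)) t ?b"
    "\<And>ts d. crel ts d \<Longrightarrow> rel (insts_tm 0 ts t) (f (snd d) (fst d))"
    unfolding intlc_def ctys_prod_def by blast
  from combinatory_completeness [OF cm t(1)] obtain u where u: "has_ty (ctys TYPE('c)) u (?a \<rightarrow> ?b)"
    "\<And>ts s. list_all2 (has_ty []) ts (ctys TYPE('c)) \<Longrightarrow> has_ty [] s ?a \<Longrightarrow>
      eqv ?b (insts_tm 0 ts u \<cdot> s) (insts_tm 0 (s # ts) t)" by blast
  have "rel (insts_tm 0 ts u) (f c)" if c: "crel ts c" for ts c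
  proof (rule rel_fun_eqI)
    show ty: "has_ty [] (insts_tm 0 ts u) (?a \<rightarrow> ?b)"
      using has_ty_insts [OF u(1), of "[]"] crel_ty [OF c] by simp
    fix s and x :: 'a assume s: "rel s x"
    have 1: "rel (insts_tm 0 (s # ts) t) (f c x)"
      using t(2) [of "s # ts" "(x, c)"] s c by (simp add: crel_prod_def)
    have 2: "has_ty [] (insts_tm 0 ts u \<cdot> s) ?b" using ty rel_ty [OF s] by (rule has_ty.intros(8))
    show "rel (insts_tm 0 ts u \<cdot> s) (f c x)"
      using rel_resp [OF cm 1 2] eqv_sym [OF cm 2 rel_ty [OF 1]] u(2) [OF crel_ty [OF c] rel_ty [OF s]] by blast
  qed
  then show "\<exists>t. has_ty (ctys TYPE('c)) t (tyc TYPE('a \<Rightarrow> 'b)) \<and> (\<forall>ts c. crel ts c \<longrightarrow> rel (insts_tm 0 ts t) (f c))"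
    using u(1) by (auto simp: tyc_fun_def)
qed

lemma intlc_closed: "intlc (\<lambda>_ :: unit. x) \<Longrightarrow> intl x"
  unfolding intlc_def intl_def using crel_unit_def by blast

lemma intlc_comp: "intl h \<Longrightarrow> intlc f \<Longrightarrow> intlc (\<lambda>c. h (f c))"
  by (rule intlc_app [OF intlc_const])

lemma intlc_comp2: "intl h \<Longrightarrow> intlc f \<Longrightarrow> intlc g \<Longrightarrow> intlc (\<lambda>c. h (f c) (g c))"
  by (rule intlc_app [OF intlc_comp])

lemma intlc_comp3: "intl h \<Longrightarrow> intlc f \<Longrightarrow> intlc g \<Longrightarrow> intlc k \<Longrightarrow> intlc (\<lambda>c. h (f c) (g c) (k c))"
  by (rule intlc_app [OF intlc_comp2])

lemma intl_funI: "intlc (\<lambda>d :: 'a::mtype \<times> unit. f (fst d)) \<Longrightarrow> intl (f :: 'a \<Rightarrow> 'b::mtype)"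
  by (rule intlc_closed, rule intlc_lam) simp

lemma intl_fun2I: "intlc (\<lambda>d :: 'a::mtype \<times> 'b::mtype \<times> unit. f (fst (snd d)) (fst d)) \<Longrightarrow>
    intl (f :: 'b \<Rightarrow> 'a \<Rightarrow> 'c::mtype)"
  by (rule intl_funI, rule intlc_lam) simp

lemma intl_app: "intl f \<Longrightarrow> intl x \<Longrightarrow> intl (f x)"
  unfolding intl_def using rel_app by blast


section \<open>Successor, recursion and induction\<close>

definition zeroM :: mnat where "zeroM = (if cm then num Zero else std 0)"

text \<open>Both alternatives for the number sort are served, by a chosen representing term or by
  \<open>nat\<close>, so that the laws can be stated without \<open>cm\<close>.\<close>

definition sucM :: "mnat \<Rightarrow> mnat" where
  "sucM x = (if cm then num (Succ \<cdot> (SOME t. rel t x)) else std (Suc (unstd x)))"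

definition recM :: "mnat \<Rightarrow> mnat \<Rightarrow> (mnat \<Rightarrow> mnat \<Rightarrow> mnat) \<Rightarrow> mnat" where
  "recM x y g = (if cm then num (Rec \<cdot> (SOME t. rel t x) \<cdot> (SOME t. rel t y) \<cdot> (SOME t. rel t g))
     else rec_nat y (\<lambda>m v. g v (std m)) (unstd x))"

lemma tyc_simps [simp]: "tyc TYPE(mnat) = N" "tyc TYPE('a::mtype \<Rightarrow> 'b::mtype) = (tyc TYPE('a) \<rightarrow> tyc TYPE('b))"
  by (simp_all add: tyc_mnat_def tyc_fun_def)

lemma rel_some: "rel t x \<Longrightarrow> rel (SOME t. rel t x) x"
  by (rule someI)

lemma rel_Zero: "cm \<Longrightarrow> rel Zero zeroM"
  by (auto simp: rel_mnat_def zeroM_def intro: has_ty.intros)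

lemma rel_numI: "cm \<Longrightarrow> has_ty [] t N \<Longrightarrow> eqv N s t \<Longrightarrow> has_ty [] s N \<Longrightarrow> rel t (num s)"
  by (simp add: rel_mnat_def num_eq_iff eqv_N_sym del: eqv.simps)

lemma rel_Succ:
  assumes cm: cm shows "rel Succ sucM"
proof (rule rel_fun_eqI)
  show "has_ty [] Succ (tyc TYPE(mnat) \<rightarrow> tyc TYPE(mnat))" by (simp add: has_ty.intros)
  fix t and x :: mnat assume t: "rel t x"
  let ?s = "SOME t. rel t x"
  have s: "rel ?s x" using t by (rule rel_some)
  have "eqv N (Succ \<cdot> ?s) (Succ \<cdot> t)"
    using rel_eqv [OF cm s t] rel_ty [OF s] rel_ty [OF t] by (intro eqv_ext [OF cm]) (auto intro: has_ty.intros)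
  then show "rel (Succ \<cdot> t) (sucM x)"
    unfolding sucM_def using cm rel_ty [OF s] rel_ty [OF t]
    by (auto intro!: rel_numI has_ty.intros(8) [of _ _ N] has_ty.intros(4) simp del: eqv.simps)
qed

text \<open>The representatives chosen by \<open>recM\<close> are equal in the model to the given
  terms; congruence of application, used for each argument, carries the value over.\<close>

lemma rel_Rec_app:
  assumes cm: cm and t: "rel t x" "rel u y" "rel v g"
  shows "rel (Rec \<cdot> t \<cdot> u \<cdot> v) (recM x y g)"
proof -
  let ?t = "SOME t. rel t x" and ?u = "SOME t. rel t y" and ?v = "SOME t. rel t g"
  have s: "rel ?t x" "rel ?u y" "rel ?v g" using t by (auto intro: rel_some)
  have ty: "has_ty [] t N" "has_ty [] u N" "has_ty [] v (N \<rightarrow> N \<rightarrow> N)"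
    "has_ty [] ?t N" "has_ty [] ?u N" "has_ty [] ?v (N \<rightarrow> N \<rightarrow> N)"
    using s t by (auto dest: rel_ty)
  have e: "eqv N ?t t" "eqv N ?u u" "eqv (N \<rightarrow> N \<rightarrow> N) ?v v"
    using rel_eqv [OF cm s(1) t(1)] rel_eqv [OF cm s(2) t(2)] rel_eqv [OF cm s(3) t(3)] by simp_all
  have r: "eqv (N \<rightarrow> N \<rightarrow> (N \<rightarrow> N \<rightarrow> N) \<rightarrow> N) Rec Rec" by (rule eqv_refl [OF cm has_ty.intros(7)])
  have "eqv N (Rec \<cdot> ?t \<cdot> ?u \<cdot> ?v) (Rec \<cdot> t \<cdot> u \<cdot> v)"
    by (rule eqv_app [OF cm _ _ _ _ _ e(3)], rule_tac [5] eqv_app [OF cm _ _ _ _ _ e(2)],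
        rule_tac [9] eqv_app [OF cm _ _ _ _ r e(1)])
      (insert ty, (assumption | rule sem_intros)+)
  then show ?thesis
    unfolding recM_def using cm
    by (simp del: eqv.simps) (rule rel_numI, insert ty, (assumption | rule sem_intros)+)
qed

lemma rel_Rec: "cm \<Longrightarrow> rel Rec recM"
  by (rule rel_fun_eqI, simp add: has_ty.intros, rule rel_fun_eqI, insert rel_ty, fastforce intro: has_ty.intros,
    rule rel_fun_eqI, fastforce intro: has_ty.intros, rule rel_Rec_app)

lemma rel_app2: "rel t f \<Longrightarrow> rel s x \<Longrightarrow> rel u y \<Longrightarrow> rel (t \<cdot> s \<cdot> u) (f x y)"
  by (intro rel_app)

lemma rel_ty0: "rel t (x :: mnat) \<Longrightarrow> has_ty [] t N"
  and rel_ty1: "rel t (f :: mnat \<Rightarrow> mnat) \<Longrightarrow> has_ty [] t (N \<rightarrow> N)"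
  and rel_ty011: "rel t (g :: mnat \<Rightarrow> mnat \<Rightarrow> mnat) \<Longrightarrow> has_ty [] t (N \<rightarrow> N \<rightarrow> N)"
  by (drule rel_ty; simp)+

lemma intl_sucM: "intl sucM" unfolding intl_def using rel_Succ by blast
lemma intl_recM: "intl recM" unfolding intl_def using rel_Rec by blast

text \<open>Passes from quantification over closed terms to quantification over denoted elements:
  each closed term denotes something, and each internal element has a term.\<close>

lemma means_all:
  assumes "cm" "uniform_fm [tyc TYPE('a::mtype)] (\<lambda>ts. F (hd ts))" "\<And>t x. rel t (x :: 'a) \<Longrightarrow> means (F t) (P x)"
  shows "means (all (tyc TYPE('a)) F) (\<forall>x :: 'a. intl x \<longrightarrow> P x)"
proof (rule means_cong)
  \<comment> \<open>\<open>Q\<close> is the truth value of the term itself; a term may denote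
    several functions, and \<open>P\<close> speaks of one of them.\<close>
  define Q where "Q t \<longleftrightarrow> F t \<in> W0" for t
  have Q: "means (F t) (Q t)" if t: "has_ty [] t (tyc TYPE('a))" for t
    using assms(3) rel_total [OF assms(1) t] unfolding means_def Q_def by blast
  then show "means (all (tyc TYPE('a)) F) (\<forall>t. has_ty [] t (tyc TYPE('a)) \<longrightarrow> Q t)"
    by (rule means_all_tm [OF assms(1,2)])
  show "(\<forall>t. has_ty [] t (tyc TYPE('a)) \<longrightarrow> Q t) \<longleftrightarrow> (\<forall>x :: 'a. intl x \<longrightarrow> P x)"
    using assms(1,3) rel_total [OF assms(1)] rel_ty unfolding intl_def Q_def means_def by metis
qed

lemma means_all0:
  assumes "cm" "uniform_fm [N] (\<lambda>ts. F (hd ts))" "\<And>t x. rel t x \<Longrightarrow> means (F t) (P x)"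
  shows "means (all N F) (\<forall>x :: mnat. P x)"
  using means_all [where 'a = mnat, of F P] assms by (simp add: intl_mnat)

lemma means_eq0: "cm \<Longrightarrow> rel s (x :: mnat) \<Longrightarrow> rel t y \<Longrightarrow> means (Eq s t) (x = y)"
  using means_Eq [of s t] num_eq_iff [of s t] by (simp add: rel_mnat_def del: eqv.simps)

lemma sucM_neq_zeroM: "sucM x \<noteq> zeroM"
proof (cases cm)
  case True
  have "means (\<^bold>\<forall>\<^sup>0 x. \<^bold>\<not> Succ \<cdot> x \<^bold>= Zero) (\<forall>x. sucM x \<noteq> zeroM)"
    by (assumption | erule rel_ty0 rel_ty011 | rule means_all0 means_Neg means_eq0 True rel_app [OF rel_Succ] rel_Zero sem_intros)+
  from means_axiom [OF True in_ACA0 this] show ?thesis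
    unfolding RCA0\<omega>_def successor_axioms_def by blast
qed (simp add: sucM_def zeroM_def, metis nat.distinct(1) unstd_std)

lemma sucM_inject: "sucM x = sucM y \<longleftrightarrow> x = y"
proof (cases cm)
  case True
  have "means (\<^bold>\<forall>\<^sup>0 x. \<^bold>\<forall>\<^sup>0 y. Succ \<cdot> x \<^bold>= Succ \<cdot> y \<^bold>\<longrightarrow> x \<^bold>= y) (\<forall>x y. sucM x = sucM y \<longrightarrow> x = y)"
    by (assumption | erule rel_ty0 rel_ty011 | rule means_all0 means_Imp means_eq0 True rel_app [OF rel_Succ] rel_Zero sem_intros)+
  from means_axiom [OF True in_ACA0 this] show ?thesis
    unfolding RCA0\<omega>_def successor_axioms_def by blast
qed (simp add: sucM_def, metis nat.inject unstd_std std_unstd)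

lemma means_all011:
  assumes "cm" "uniform_fm [N \<rightarrow> N \<rightarrow> N] (\<lambda>ts. F (hd ts))" "\<And>t x. rel t x \<Longrightarrow> means (F t) (P x)"
  shows "means (all (N \<rightarrow> N \<rightarrow> N) F) (\<forall>x :: mnat \<Rightarrow> mnat \<Rightarrow> mnat. intl x \<longrightarrow> P x)"
  using means_all [where 'a = "mnat \<Rightarrow> mnat \<Rightarrow> mnat", of F P] assms by simp

lemma recM_zero: "intl g \<Longrightarrow> recM zeroM y g = y"
proof (cases cm)
  case True
  have "means (\<^bold>\<forall>\<^sup>0 y. all (N \<rightarrow> N \<rightarrow> N) (\<lambda>z. Rec \<cdot> Zero \<cdot> y \<cdot> z \<^bold>= y)) (\<forall>y g. intl g \<longrightarrow> recM zeroM y g = y)"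
    by (assumption | erule rel_ty0 rel_ty011 | rule means_all0 means_all011 means_eq0 True rel_Rec_app rel_Zero sem_intros)+
  from means_axiom [OF True in_ACA0 this] show "intl g \<Longrightarrow> recM zeroM y g = y"
    unfolding RCA0\<omega>_def recursor_axioms_def by blast
qed (simp add: recM_def zeroM_def unstd_std)

lemma recM_suc: "intl g \<Longrightarrow> recM (sucM x) y g = g (recM x y g) x"
proof (cases cm)
  case True
  have "means (\<^bold>\<forall>\<^sup>0 x. \<^bold>\<forall>\<^sup>0 y. all (N \<rightarrow> N \<rightarrow> N) (\<lambda>z.
       Rec \<cdot> (Succ \<cdot> x) \<cdot> y \<cdot> z \<^bold>= z \<cdot> (Rec \<cdot> x \<cdot> y \<cdot> z) \<cdot> x))
     (\<forall>x y g. intl g \<longrightarrow> recM (sucM x) y g = g (recM x y g) x)"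
    by (assumption | erule rel_ty0 rel_ty011 | rule means_all0 means_all011 means_eq0 True rel_Rec_app rel_app [OF rel_Succ] rel_Zero sem_intros
        | (rule rel_app2, assumption))+
  from means_axiom [OF True in_ACA0 this] show "intl g \<Longrightarrow> recM (sucM x) y g = g (recM x y g) x"
    unfolding RCA0\<omega>_def recursor_axioms_def by blast
qed (simp add: recM_def sucM_def unstd_std std_unstd)

text \<open>Mirrors the quantifier-free formulas in one number variable, with internal functions in
  place of terms with parameters. Other connectives have to be expressed by implication and
  falsity.\<close>

inductive qfp :: "(mnat \<Rightarrow> bool) \<Rightarrow> bool" where
  qfp_eq: "intl (f :: mnat \<Rightarrow> mnat) \<Longrightarrow> intl g \<Longrightarrow> qfp (\<lambda>n. f n = g n)"
| qfp_False: "qfp (\<lambda>n. False)"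
| qfp_imp: "qfp P \<Longrightarrow> qfp Q \<Longrightarrow> qfp (\<lambda>n. P n \<longrightarrow> Q n)"

text \<open>The last conjunct records that the formula depends uniformly on the inserted term, which
  is needed to place it under the quantifiers of the induction axiom.\<close>

lemma qfp_formula:
  assumes cm: cm and P: "qfp P"
  shows "\<exists>\<phi>. qf \<phi> \<and> wf_fm [N] \<phi> \<and> (\<forall>t n. rel t n \<longrightarrow> means (inst_fm 0 t \<phi>) (P n)) \<and>
    (\<forall>\<Delta> f. uniform_tm \<Delta> f N \<longrightarrow> uniform_fm \<Delta> (\<lambda>ts. inst_fm 0 (f ts) \<phi>))"
  using P
proof induction
  case (qfp_eq f g)
  then obtain F G where F: "rel F f" and G: "rel G g" using cm unfolding intl_def by blast
  note ty = rel_ty1 [OF F] rel_ty1 [OF G]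
  have lc: "lc F" "lc G" using ty by (auto simp: has_ty_lc)
  show ?case
  proof (intro exI [of _ "Eq (F \<cdot> Bd 0) (G \<cdot> Bd 0)"] conjI allI impI)
    have "has_ty [N] (Bd 0) N" using has_ty.intros(1) [of 0 "[N]"] by simp
    then show "wf_fm [N] (Eq (F \<cdot> Bd 0) (G \<cdot> Bd 0))"
      using has_ty_weaken [OF ty(1) refl] has_ty_weaken [OF ty(2) refl] by (simp add: has_ty.intros(8) [of _ _ N])
    show "means (inst_fm 0 t (Eq (F \<cdot> Bd 0) (G \<cdot> Bd 0))) (f n = g n)" if "rel t n" for t n
      using lc means_eq0 [OF cm rel_app [OF F that] rel_app [OF G that]] by simp
    show "uniform_fm \<Delta> (\<lambda>ts. inst_fm 0 (h ts) (Eq (F \<cdot> Bd 0) (G \<cdot> Bd 0)))" if "uniform_tm \<Delta> h N" for \<Delta> h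
      using lc uniform_fm_Eq [OF uniform_tm_app [OF uniform_tm_const [OF ty(1)] that] uniform_tm_app [OF uniform_tm_const [OF ty(2)] that]] by simp
  qed auto
next
  case qfp_False
  show ?case by (rule exI [of _ Fls]) (auto intro: means_Fls cm uniform_fm_Fls)
next
  case (qfp_imp P Q)
  then obtain \<phi> \<psi> where "qf \<phi>" "wf_fm [N] \<phi>" "\<And>t n. rel t n \<Longrightarrow> means (inst_fm 0 t \<phi>) (P n)"
      "\<And>\<Delta> f. uniform_tm \<Delta> f N \<Longrightarrow> uniform_fm \<Delta> (\<lambda>ts. inst_fm 0 (f ts) \<phi>)"
      "qf \<psi>" "wf_fm [N] \<psi>" "\<And>t n. rel t n \<Longrightarrow> means (inst_fm 0 t \<psi>) (Q n)"
      "\<And>\<Delta> f. uniform_tm \<Delta> f N \<Longrightarrow> uniform_fm \<Delta> (\<lambda>ts. inst_fm 0 (f ts) \<psi>)" by blast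
  then show ?case by (intro exI [of _ "Imp \<phi> \<psi>"]) (auto intro: means_Imp cm uniform_fm_Imp)
qed

text \<open>In the countermodel this is the induction axiom for the formula found above; otherwise
  \<open>mnat\<close> is a copy of \<open>nat\<close> and ordinary induction applies.\<close>

theorem qfp_induct:
  assumes P: "qfp P" and 0: "P zeroM" and S: "\<And>n. P n \<Longrightarrow> P (sucM n)"
  shows "P n"
proof (cases cm)
  case True
  from qfp_formula [OF this P] obtain \<phi> where \<phi>: "qf \<phi> \<and> wf_fm [N] \<phi>"
    and means: "\<And>t n. rel t n \<Longrightarrow> means (inst_fm 0 t \<phi>) (P n)"
    and uniform_fm: "\<And>\<Delta> f. uniform_tm \<Delta> f N \<Longrightarrow> uniform_fm \<Delta> (\<lambda>ts. inst_fm 0 (f ts) \<phi>)" by blast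
  let ?\<psi> = "inst_fm 0 Zero \<phi> \<^bold>\<and> (\<^bold>\<forall>\<^sup>0 n. inst_fm 0 n \<phi> \<^bold>\<longrightarrow> inst_fm 0 (Succ \<cdot> n) \<phi>)
       \<^bold>\<longrightarrow> (\<^bold>\<forall>\<^sup>0 n. inst_fm 0 n \<phi>)"
  have "?\<psi> \<in> qf_induction" using \<phi> unfolding qf_induction_def by blast
  then have "?\<psi> \<in> ACA0\<omega>" unfolding ACA0\<omega>_def RCA0\<omega>_def by simp
  moreover have "means ?\<psi> (P zeroM \<and> (\<forall>n. P n \<longrightarrow> P (sucM n)) \<longrightarrow> (\<forall>n. P n))"
    by (assumption | rule means_all0 means_Conj means_Imp means True rel_app [OF rel_Succ] rel_Zero uniform_fm sem_intros)+
  ultimately have "P zeroM \<and> (\<forall>n. P n \<longrightarrow> P (sucM n)) \<longrightarrow> (\<forall>n. P n)"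
    by (rule means_axiom [OF True])
  then show ?thesis using 0 S by blast
next
  case False
  have "P (std k)" for k
  proof (induction k)
    case (Suc k)
    then show ?case using S [of "std k"] False by (simp add: sucM_def unstd_std)
  qed (use 0 False in \<open>simp add: zeroM_def\<close>)
  then show ?thesis using std_unstd [OF False, of n] by metis
qed


section \<open>Arithmetic of the countermodel\<close>

text \<open>Closure rules that certify a HOL expression as internal from its syntax; they discharge
  the side conditions of the inductions below.\<close>

named_theorems intlc_intros

lemma intlc_const0: "intlc (\<lambda>c. x :: mnat)"
  by (rule intlc_const) (rule intl_mnat)

lemma intlc_var1_app: "intlc g \<Longrightarrow> intlc (\<lambda>c. fst (snd c) (g c))"
  by (rule intlc_app [OF intlc_snd [OF intlc_fst]])

lemma intlc_rec:
  "intlc f \<Longrightarrow> intlc g \<Longrightarrow> intlc (\<lambda>d. h (snd (snd d)) (fst (snd d)) (fst d)) \<Longrightarrow>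
    intlc (\<lambda>c. recM (f c) (g c) (h c))"
  by (rule intlc_comp3 [OF intl_recM], assumption+, rule intlc_lam, rule intlc_lam)

lemmas [intlc_intros] = intlc_const0 intlc_fst intlc_snd intlc_comp [OF intl_sucM] intlc_rec intlc_var1_app

section \<open>The ordered semiring of the model's numbers\<close>

instantiation mnat :: "{zero, one, plus, times, minus}"
begin

definition zero_mnat :: mnat where "0 = zeroM"
definition one_mnat :: mnat where "1 = sucM 0"
definition plus_mnat :: "mnat \<Rightarrow> mnat \<Rightarrow> mnat" where "a + b = recM b a (\<lambda>v m. sucM v)"
definition times_mnat :: "mnat \<Rightarrow> mnat \<Rightarrow> mnat" where "a * b = recM b 0 (\<lambda>v m. v + a)"
definition minus_mnat :: "mnat \<Rightarrow> mnat \<Rightarrow> mnat" where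
  "a - b = recM b a (\<lambda>v m. recM v 0 (\<lambda>w i. i))"
instance ..

end

instantiation mnat :: ord
begin

text \<open>Defined through truncated subtraction, as in the object language, so that the meaning of
  order formulas is immediate; the order laws have to be proved instead.\<close>

definition less_eq_mnat :: "mnat \<Rightarrow> mnat \<Rightarrow> bool" where "a \<le> b \<longleftrightarrow> a - b = (0 :: mnat)"
definition less_mnat :: "mnat \<Rightarrow> mnat \<Rightarrow> bool" where "a < b \<longleftrightarrow> sucM a - b = 0"

instance ..

end

definition predM :: "mnat \<Rightarrow> mnat" where "predM a = recM a 0 (\<lambda>v m. m)"

lemma intlc_plus [intlc_intros]: "intlc f \<Longrightarrow> intlc g \<Longrightarrow> intlc (\<lambda>c. f c + g c :: mnat)"
  unfolding plus_mnat_def by (intro intlc_intros)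

lemma intlc_times [intlc_intros]: "intlc f \<Longrightarrow> intlc g \<Longrightarrow> intlc (\<lambda>c. f c * g c :: mnat)"
  unfolding times_mnat_def by (intro intlc_intros)

lemma intlc_pred [intlc_intros]: "intlc f \<Longrightarrow> intlc (\<lambda>c. predM (f c))"
  unfolding predM_def by (intro intlc_intros)

lemma intlc_minus [intlc_intros]: "intlc f \<Longrightarrow> intlc g \<Longrightarrow> intlc (\<lambda>c. f c - g c :: mnat)"
  unfolding minus_mnat_def predM_def [symmetric] by (intro intlc_intros)

lemma add_zeroM [simp]: "a + 0 = (a :: mnat)"
  unfolding plus_mnat_def zero_mnat_def by (intro recM_zero intl_fun2I intlc_intros)

lemma recM_Suc: "intlc (\<lambda>d :: mnat \<times> mnat \<times> unit. g (fst (snd d)) (fst d)) \<Longrightarrow> recM (sucM x) y g = g (recM x y g) x"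
  by (rule recM_suc) (rule intl_fun2I)

lemma add_sucM [simp]: "a + sucM b = sucM (a + b)"
  unfolding plus_mnat_def by (rule recM_Suc) (intro intlc_intros)

lemma mult_zeroM [simp]: "a * 0 = (0 :: mnat)"
  unfolding times_mnat_def by (unfold zero_mnat_def, intro recM_zero intl_fun2I intlc_intros)

lemma mult_sucM [simp]: "a * sucM b = a * b + a"
  unfolding times_mnat_def by (subst recM_suc) (intro intl_fun2I intlc_intros refl)+

lemma pred_zeroM [simp]: "predM 0 = 0"
  unfolding predM_def by (unfold zero_mnat_def, intro recM_zero intl_fun2I intlc_intros)

lemma pred_sucM [simp]: "predM (sucM a) = a"
  unfolding predM_def by (subst recM_suc) (intro intl_fun2I intlc_intros refl)+

lemma minus_zeroM [simp]: "a - 0 = (a :: mnat)"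
  unfolding minus_mnat_def predM_def [symmetric]
  by (unfold zero_mnat_def, intro recM_zero intl_fun2I intlc_intros)

lemma minus_sucM: "a - sucM b = predM (a - b)"
  unfolding minus_mnat_def predM_def [symmetric]
  by (subst recM_Suc) (intro intlc_intros, rule refl)

lemma sucM_neq_0 [simp]: "sucM a \<noteq> 0" "0 \<noteq> sucM a"
  using sucM_neq_zeroM unfolding zero_mnat_def by metis+

lemma sucM_eq [simp]: "sucM a = sucM b \<longleftrightarrow> a = b"
  by (rule sucM_inject)

lemma eq_induct:
  assumes "intlc (\<lambda>c :: mnat \<times> unit. f (fst c))" "intlc (\<lambda>c :: mnat \<times> unit. g (fst c))"
    and "f 0 = g 0" "\<And>n. f n = g n \<Longrightarrow> f (sucM n) = g (sucM n)"
  shows "f n = (g n :: mnat)"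
  by (rule qfp_induct [where P = "\<lambda>n. f n = g n"], rule qfp_eq,
      rule intl_funI, rule assms, rule intl_funI, rule assms, rule assms(3) [unfolded zero_mnat_def], erule assms(4))

text \<open>The numbers are not generated by \<open>sucM\<close> from outside, so the case
  distinction needs internal induction. The disjunction is coded by implication and falsity to fit
  \<open>qfp\<close>.\<close>

lemma mnat_cases: obtains "a = 0" | b where "a = sucM b"
proof -
  have "qfp (\<lambda>n. (n = 0 \<longrightarrow> False) \<longrightarrow> n = sucM (predM n))"
    by (intro qfp_imp qfp_eq qfp_False intl_funI intlc_intros)
  then have "(a = 0 \<longrightarrow> False) \<longrightarrow> a = sucM (predM a)"
    by (rule qfp_induct) (auto simp: zero_mnat_def)
  then show thesis using that by metis
qed

lemma zeroM_add [simp]: "0 + a = (a :: mnat)"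
  by (rule eq_induct [where f = "\<lambda>a. 0 + a"]) (auto intro!: intlc_intros)

lemma sucM_add [simp]: "sucM a + b = sucM (a + b)"
  by (rule eq_induct [where f = "\<lambda>b. sucM a + b"]) (auto intro!: intlc_intros)

lemma add_commuteM: "a + b = b + (a :: mnat)"
  by (rule eq_induct [where f = "\<lambda>b. a + b"]) (auto intro!: intlc_intros)

lemma add_assocM: "a + b + c = a + (b + c :: mnat)"
  by (rule eq_induct [where f = "\<lambda>c. a + b + c"]) (auto intro!: intlc_intros)

lemma zeroM_mult [simp]: "0 * a = (0 :: mnat)"
  by (rule eq_induct [where f = "\<lambda>a. 0 * a"]) (auto intro!: intlc_intros)

lemma sucM_mult [simp]: "sucM a * b = a * b + b"
  by (rule eq_induct [where f = "\<lambda>b. sucM a * b"])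
    (auto intro!: intlc_intros simp: add_assocM, metis add_assocM add_commuteM)

lemma mult_commuteM: "a * b = b * (a :: mnat)"
  by (rule eq_induct [where f = "\<lambda>b. a * b"]) (auto intro!: intlc_intros)

lemma distribM: "(a + b) * c = a * c + b * (c :: mnat)"
  by (rule eq_induct [where f = "\<lambda>c. (a + b) * c"])
    (auto intro!: intlc_intros, metis add_assocM add_commuteM)

lemma mult_assocM: "a * b * c = a * (b * c :: mnat)"
  by (rule eq_induct [where f = "\<lambda>a. a * b * c"]) (auto intro!: intlc_intros simp: distribM)

lemma sucM_minus_sucM [simp]: "sucM a - sucM b = a - b"
  by (rule eq_induct [where f = "\<lambda>b. sucM a - sucM b"])
    (auto intro!: intlc_intros simp: minus_sucM)

lemma zeroM_minus [simp]: "0 - a = (0 :: mnat)"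
  by (rule eq_induct [where f = "\<lambda>b. 0 - b"]) (auto intro!: intlc_intros simp: minus_sucM)

lemma add_minus_cancelM [simp]: "a + b - a = (b :: mnat)"
  by (rule eq_induct [where f = "\<lambda>a. a + b - a"]) (auto intro!: intlc_intros)

lemma minus_minusM: "a - b - c = a - (b + c :: mnat)"
  by (rule eq_induct [where f = "\<lambda>c. a - b - c"]) (auto intro!: intlc_intros simp: minus_sucM)

text \<open>Totality of the order in quantifier-free form: the truncated differences are explicit
  witnesses, so the available induction applies.\<close>

lemma mnat_linear_aux: "b = a + (b - a) \<or> a = b + (a - b :: mnat)"
proof -
  have "qfp (\<lambda>a. (b = a + (b - a) \<longrightarrow> False) \<longrightarrow> a = b + (a - b))"
    by (intro qfp_imp qfp_eq qfp_False intl_funI intlc_intros)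
  then have "(b = a + (b - a) \<longrightarrow> False) \<longrightarrow> a = b + (a - b)"
  proof (rule qfp_induct)
    fix a assume IH: "(b = a + (b - a) \<longrightarrow> False) \<longrightarrow> a = b + (a - b)"
    show "(b = sucM a + (b - sucM a) \<longrightarrow> False) \<longrightarrow> sucM a = b + (sucM a - b)"
    proof (cases "b = a + (b - a)")
      case True
      show ?thesis
      proof (cases "b - a" rule: mnat_cases)
        case 1
        with True have "b = a" by simp
        then show ?thesis using add_minus_cancelM [of a "sucM 0"] by simp
      next
        case (2 k)
        with True show ?thesis by (simp add: minus_sucM)
      qed
    next
      case False
      with IH have "a = b + (a - b)" by blast
      then have "sucM a = b + sucM (a - b)" by simp
      then show ?thesis by (metis add_minus_cancelM)
    qed
  qed (simp add: zero_mnat_def [symmetric])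
  then show ?thesis by blast
qed

lemma le_iff_addM: "a \<le> b \<longleftrightarrow> (\<exists>c. b = a + c)" for a b :: mnat
proof
  assume "a \<le> b"
  then have "a - b = 0" by (simp add: less_eq_mnat_def)
  with mnat_linear_aux [of b a] show "\<exists>c. b = a + c" by (metis add_zeroM)
next
  assume "\<exists>c. b = a + c"
  then obtain c where "b = a + c" by blast
  then have "a - b = a - a - c" by (simp add: minus_minusM)
  then show "a \<le> b" unfolding less_eq_mnat_def by (metis add_minus_cancelM add_zeroM zeroM_minus)
qed

lemma less_iff_leM: "a < b \<longleftrightarrow> sucM a \<le> b"
  by (simp add: less_mnat_def less_eq_mnat_def)

lemma add_cancelM: "a + b = a + c \<longleftrightarrow> b = (c :: mnat)"
  by (metis add_minus_cancelM)

lemma add_eq_0M: "a + b = 0 \<longleftrightarrow> a = 0 \<and> b = (0 :: mnat)"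
  by (cases b rule: mnat_cases) auto

lemma mnat_linear: "a \<le> b \<or> b \<le> (a :: mnat)"
  using mnat_linear_aux [of a b] unfolding le_iff_addM by blast

lemma mnat_antisym: "a \<le> b \<Longrightarrow> b \<le> a \<Longrightarrow> a = (b :: mnat)"
  unfolding le_iff_addM
proof (elim exE)
  fix c d assume *: "b = a + c" "a = b + d"
  then have "a + (c + d) = a + 0" by (metis add_assocM add_zeroM)
  then have "c = 0" unfolding add_cancelM add_eq_0M by simp
  with * show "a = b" by simp
qed

text \<open>Opens Isabelle's algebra for the model's numbers: cancellation, distributivity and the
  order laws become library facts.\<close>

instance mnat :: linordered_semidom
proof
  fix a b c :: mnat
  show "a + b + c = a + (b + c)" by (rule add_assocM)
  show "a + b = b + a" by (rule add_commuteM)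
  show "0 + a = a" by simp
  show "a * b * c = a * (b * c)" by (rule mult_assocM)
  show "a * b = b * a" by (rule mult_commuteM)
  show "1 * a = a" by (simp add: one_mnat_def)
  show "(a + b) * c = a * c + b * c" by (rule distribM)
  show "a * (b + c) = a * b + a * c" by (metis distribM mult_commuteM)
  show "0 * a = 0" by simp
  show "a * 0 = 0" by simp
  show "(0::mnat) \<noteq> 1" by (simp add: one_mnat_def)
  show "a + b - a = b" by simp
  show "a - b - c = a - (b + c)" by (rule minus_minusM)
  show le_diff: "a * (b - c) = a * b - a * c" for a b c :: mnat
  proof (cases "b \<le> c")
    case True
    then obtain d where "c = b + d" by (auto simp: le_iff_addM)
    then have "a * c = a * b + a * d" by (metis distribM mult_commuteM)
    then have "a * b \<le> a * c" by (auto simp: le_iff_addM)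
    then show ?thesis using True by (simp add: less_eq_mnat_def)
  next
    case False
    then obtain d where "b = c + d" using mnat_linear le_iff_addM by blast
    then have "a * b = a * c + a * d" "b - c = d" by (metis distribM mult_commuteM, simp)
    then show ?thesis by simp
  qed
  show "a \<noteq> 0 \<Longrightarrow> b \<noteq> 0 \<Longrightarrow> a * b \<noteq> 0"
    by (cases a rule: mnat_cases; cases b rule: mnat_cases) auto
  show le_refl: "a \<le> a" for a :: mnat unfolding le_iff_addM by (metis add_zeroM)
  show le_trans: "a \<le> b \<Longrightarrow> b \<le> c \<Longrightarrow> a \<le> c" for a b c :: mnat unfolding le_iff_addM by (metis add_assocM)
  show "a \<le> b \<Longrightarrow> b \<le> a \<Longrightarrow> a = b" by (rule mnat_antisym)
  show "a \<le> b \<or> b \<le> a" by (rule mnat_linear)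
  have suc_le: "\<not> sucM a \<le> a" for a :: mnat
    unfolding le_iff_addM using add_cancelM [of a 0] by (metis add_sucM add_zeroM sucM_add sucM_neq_0(2))
  have le_suc: "a \<le> sucM a" for a :: mnat unfolding le_iff_addM by (metis add_sucM add_zeroM)
  have less: "a < b \<longleftrightarrow> a \<le> b \<and> \<not> b \<le> a" for a b :: mnat
    unfolding less_iff_leM
  proof
    assume *: "sucM a \<le> b"
    then show "a \<le> b \<and> \<not> b \<le> a" using le_trans [of a "sucM a" b] le_trans [of "sucM a" b a] suc_le le_suc by blast
  next
    assume *: "a \<le> b \<and> \<not> b \<le> a"
    then obtain d where d: "b = a + d" by (auto simp: le_iff_addM)
    show "sucM a \<le> b"
    proof (cases d rule: mnat_cases)
      case 1
      then show ?thesis using * d le_refl by simp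
    next
      case (2 e)
      then show ?thesis using d by (auto simp: le_iff_addM)
    qed
  qed
  show "a < b \<longleftrightarrow> a \<le> b \<and> \<not> b \<le> a" by (rule less)
  show "a \<le> b \<Longrightarrow> c + a \<le> c + b" unfolding le_iff_addM by (metis add_assocM)
  show "a < b \<Longrightarrow> 0 < c \<Longrightarrow> c * a < c * b"
  proof -
    assume "a < b" "0 < c"
    then obtain d e where "b = sucM a + d" "c = sucM 0 + e" unfolding less_iff_leM le_iff_addM by blast
    then have "b = a + sucM d" "c = sucM e" by simp_all
    then have "c * b = c * a + c * sucM d" by (metis distribM mult_commuteM)
    then have "c * b = sucM (c * a) + (c * d + e)" using \<open>c = sucM e\<close> by simp
    then show "c * a < c * b" unfolding less_iff_leM le_iff_addM by blast
  qed
  show "(0::mnat) < 1" unfolding less_iff_leM le_iff_addM one_mnat_def by (metis add_zeroM)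
  show "b \<le> a \<Longrightarrow> a - b + b = a" unfolding le_iff_addM by (metis add_minus_cancelM add_commuteM)
qed

lemma sucM_conv: "sucM a = a + 1"
  by (simp add: one_mnat_def)

lemma mnat_le_iff: "a \<le> b \<longleftrightarrow> a - b = (0 :: mnat)"
  by (rule less_eq_mnat_def)

lemma mnat_less_iff: "a < b \<longleftrightarrow> a + 1 \<le> (b :: mnat)"
  by (simp add: less_iff_leM sucM_conv)

lemma mnat_ge_0 [simp]: "0 \<le> (a :: mnat)"
  by (simp add: less_eq_mnat_def)

lemma recM_0: "intl g \<Longrightarrow> recM 0 y g = y"
  unfolding zero_mnat_def by (rule recM_zero)


subsection \<open>Decidable predicates\<close>

text \<open>Truth is coded by \<open>0\<close>, whereas the sets of reals of the object theory use \<open>1\<close>.\<close>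

definition chi :: "bool \<Rightarrow> mnat" where "chi P = (if P then 0 else 1)"

lemma chi_simps [simp]: "chi P = 0 \<longleftrightarrow> P" "chi P = 1 \<longleftrightarrow> \<not> P" "chi P = chi Q \<longleftrightarrow> (P \<longleftrightarrow> Q)" "chi P \<le> 1"
  by (auto simp: chi_def)

lemma monus_sgn: "1 - (1 - a) = (if a = 0 then 0 else 1 :: mnat)"
proof (cases a rule: mnat_cases)
  case 1 then show ?thesis by (simp add: one_mnat_def)
next
  case (2 b) then show ?thesis by (simp add: one_mnat_def)
qed

lemma intlc_le [intlc_intros]: "intlc f \<Longrightarrow> intlc g \<Longrightarrow> intlc (\<lambda>c. chi (f c \<le> (g c :: mnat)))"
proof -
  have *: "chi (x \<le> y) = 1 - (1 - (x - y))" for x y :: mnat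
    unfolding monus_sgn by (simp add: chi_def less_eq_mnat_def)
  show "intlc f \<Longrightarrow> intlc g \<Longrightarrow> ?thesis" unfolding * by (intro intlc_intros)
qed

lemma intlc_Not [intlc_intros]: "intlc (\<lambda>c. chi (P c)) \<Longrightarrow> intlc (\<lambda>c. chi (\<not> P c))"
proof -
  have *: "chi (\<not> P) = 1 - chi P" for P by (simp add: chi_def)
  show "intlc (\<lambda>c. chi (P c)) \<Longrightarrow> ?thesis" unfolding * by (intro intlc_intros)
qed

lemma intlc_conj [intlc_intros]:
  "intlc (\<lambda>c. chi (P c)) \<Longrightarrow> intlc (\<lambda>c. chi (Q c)) \<Longrightarrow> intlc (\<lambda>c. chi (P c \<and> Q c))"
proof -
  have *: "chi (P \<and> Q) = 1 - (1 - (chi P + chi Q))" for P Q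
    unfolding monus_sgn by (auto simp: chi_def)
  show "intlc (\<lambda>c. chi (P c)) \<Longrightarrow> intlc (\<lambda>c. chi (Q c)) \<Longrightarrow> ?thesis" unfolding * by (intro intlc_intros)
qed

lemma intlc_disj [intlc_intros]:
  "intlc (\<lambda>c. chi (P c)) \<Longrightarrow> intlc (\<lambda>c. chi (Q c)) \<Longrightarrow> intlc (\<lambda>c. chi (P c \<or> Q c))"
proof -
  have *: "chi (P \<or> Q) = chi (\<not> (\<not> P \<and> \<not> Q))" for P Q by simp
  show "intlc (\<lambda>c. chi (P c)) \<Longrightarrow> intlc (\<lambda>c. chi (Q c)) \<Longrightarrow> ?thesis" unfolding * by (intro intlc_intros)
qed

lemma intlc_imp [intlc_intros]:
  "intlc (\<lambda>c. chi (P c)) \<Longrightarrow> intlc (\<lambda>c. chi (Q c)) \<Longrightarrow> intlc (\<lambda>c. chi (P c \<longrightarrow> Q c))"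
proof -
  have *: "chi (P \<longrightarrow> Q) = chi (\<not> P \<or> Q)" for P Q by simp
  show "intlc (\<lambda>c. chi (P c)) \<Longrightarrow> intlc (\<lambda>c. chi (Q c)) \<Longrightarrow> ?thesis" unfolding * by (intro intlc_intros)
qed

lemma intlc_eq [intlc_intros]: "intlc f \<Longrightarrow> intlc g \<Longrightarrow> intlc (\<lambda>c. chi (f c = (g c :: mnat)))"
proof -
  have *: "chi (x = y) = chi (x \<le> y \<and> y \<le> x)" for x y :: mnat by auto
  show "intlc f \<Longrightarrow> intlc g \<Longrightarrow> ?thesis" unfolding * by (intro intlc_intros)
qed

lemma intlc_less [intlc_intros]: "intlc f \<Longrightarrow> intlc g \<Longrightarrow> intlc (\<lambda>c. chi (f c < (g c :: mnat)))"
proof -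
  have *: "chi (x < y) = chi (x + 1 \<le> y)" for x y :: mnat by (simp add: mnat_less_iff)
  show "intlc f \<Longrightarrow> intlc g \<Longrightarrow> ?thesis" unfolding * by (intro intlc_intros)
qed

text \<open>Definition by cases is recursion on the truth value, with a step that ignores the
  previous value.\<close>

lemma intlc_If [intlc_intros]:
  "intlc (\<lambda>c. chi (P c)) \<Longrightarrow> intlc f \<Longrightarrow> intlc g \<Longrightarrow> intlc (\<lambda>c. if P c then f c else (g c :: mnat))"
proof -
  have *: "(if P then a else b) = recM (chi P) a (\<lambda>v m. b)" for P and a b :: mnat
  proof -
    have "intl (\<lambda>(v :: mnat) (m :: mnat). b)" by (intro intl_fun2I intlc_intros)
    then show ?thesis using recM_suc [of "\<lambda>v m. b" 0 a] recM_0 [of "\<lambda>v m. b" a]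
      by (simp add: chi_def one_mnat_def)
  qed
  show "intlc (\<lambda>c. chi (P c)) \<Longrightarrow> intlc f \<Longrightarrow> intlc g \<Longrightarrow> ?thesis" unfolding * by (intro intlc_intros)
qed

text \<open>Equational induction applied to the characteristic function. Once number quantifiers are
  known to be internal, this covers arithmetical predicates.\<close>

theorem internal_induct [case_names intl 0 Suc]:
  assumes P: "intlc (\<lambda>c :: mnat \<times> unit. chi (P (fst c)))"
    and 0: "P 0" and S: "\<And>n. P n \<Longrightarrow> P (n + 1)"
  shows "P n"
proof -
  have "chi (P n) = 0"
    by (rule eq_induct [where f = "\<lambda>n. chi (P n)"])
      (use 0 S P in \<open>auto intro!: intlc_intros simp: sucM_conv\<close>)
  then show ?thesis by simp
qed


section \<open>Integers and rationals of the countermodel\<close>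

fun mint_rel :: "mnat \<times> mnat \<Rightarrow> mnat \<times> mnat \<Rightarrow> bool" where
  "mint_rel (a, b) (c, d) \<longleftrightarrow> a + d = c + b"

quotient_type mint = "mnat \<times> mnat" / mint_rel
proof (intro equivpI reflpI sympI transpI)
  fix p q r assume "mint_rel p q" "mint_rel q r"
  then obtain a b c d e f where *: "p = (a, b)" "q = (c, d)" "r = (e, f)" "a + d = c + b" "c + f = e + d"
    by (metis mint_rel.simps surj_pair)
  \<comment> \<open>Transitivity of the relation: the two equations are added and
    \<open>c + d\<close> is cancelled.\<close>
  then have "(a + f) + (c + d) = (e + b) + (c + d)" by (metis add.assoc add.commute)
  then show "mint_rel p r" using * by simp
qed (auto simp: ac_simps)

instantiation mint :: linordered_idom
begin

lift_definition zero_mint :: mint is "(0, 0)" .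
lift_definition one_mint :: mint is "(1, 0)" .
lift_definition plus_mint :: "mint \<Rightarrow> mint \<Rightarrow> mint" is "\<lambda>(a, b) (c, d). (a + c, b + d)"
  by (auto, metis add.assoc add.commute)
lift_definition uminus_mint :: "mint \<Rightarrow> mint" is "\<lambda>(a, b). (b, a)" by (auto simp: ac_simps)
lift_definition minus_mint :: "mint \<Rightarrow> mint \<Rightarrow> mint" is "\<lambda>(a, b) (c, d). (a + d, b + c)"
  by (auto, metis add.assoc add.commute)
lift_definition times_mint :: "mint \<Rightarrow> mint \<Rightarrow> mint"
  is "\<lambda>(a, b) (c, d). (a * c + b * d, a * d + b * c)"
proof -
  fix p q r s assume "mint_rel p q" "mint_rel r s"
  then obtain a b c d e f g h where *: "p = (a, b)" "q = (c, d)" "r = (e, f)" "s = (g, h)"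
    "a + d = c + b" "e + h = g + f"
    by (metis mint_rel.simps surj_pair)
  have "a * e + d * e = c * e + b * e" "c * f + b * f = a * f + d * f"
    "c * e + c * h = c * g + c * f" "d * g + d * f = d * e + d * h"
    using * by (metis distrib_left distrib_right)+
  \<comment> \<open>Both sides are padded with the same cross terms so that the four equations above
    apply; cancellation finishes.\<close>
  then have "(a * e + b * f + (c * h + d * g)) + (d * e + c * f + c * e + d * f) =
      (c * g + d * h + (a * f + b * e)) + (d * e + c * f + c * e + d * f)"
    by (smt (verit, ccfv_SIG) add.assoc add.commute)
  then show "mint_rel ((\<lambda>(a, b) (c, d). (a * c + b * d, a * d + b * c)) p r)
      ((\<lambda>(a, b) (c, d). (a * c + b * d, a * d + b * c)) q s)"
    using * by simp
qed
lift_definition less_eq_mint :: "mint \<Rightarrow> mint \<Rightarrow> bool" is "\<lambda>(a, b) (c, d). a + d \<le> c + b"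
proof -
  fix p q r s assume "mint_rel p q" "mint_rel r s"
  then obtain a b c d e f g h where *: "p = (a, b)" "q = (c, d)" "r = (e, f)" "s = (g, h)"
    "a + d = c + b" "e + h = g + f"
    by (metis mint_rel.simps surj_pair)
  have "a + f \<le> e + b \<longleftrightarrow> (a + d) + (f + h) \<le> (e + h) + (b + d)"
    using add_le_cancel_right [of "a + f" "d + h" "e + b"] by (simp add: ac_simps)
  also have "\<dots> \<longleftrightarrow> (c + b) + (f + h) \<le> (g + f) + (b + d)" using * by simp
  also have "\<dots> \<longleftrightarrow> c + h \<le> g + d"
    using add_le_cancel_right [of "c + h" "b + f" "g + d"] by (simp add: ac_simps)
  finally show "(case p of (a, b) \<Rightarrow> \<lambda>(c, d). a + d \<le> c + b) r = (case q of (a, b) \<Rightarrow> \<lambda>(c, d). a + d \<le> c + b) s"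
    using * by simp
qed
definition less_mint :: "mint \<Rightarrow> mint \<Rightarrow> bool" where "x < y \<longleftrightarrow> \<not> y \<le> (x :: mint)"
definition abs_mint :: "mint \<Rightarrow> mint" where mint_abs: "\<bar>x\<bar> = (if x < 0 then - x else (x :: mint))"
definition sgn_mint :: "mint \<Rightarrow> mint" where "sgn x = (if x = 0 then 0 else if 0 < x then 1 else - 1 :: mint)"

instance
proof
  fix x y z :: mint
  show "x + y + z = x + (y + z)" by transfer (auto simp: ac_simps)
  show "x + y = y + x" by transfer (auto simp: ac_simps)
  show "0 + x = x" by transfer auto
  show "- x + x = 0" by transfer (auto simp: ac_simps)
  show "x - y = x + - y" by transfer auto
  show "x * y * z = x * (y * z)" by transfer (auto simp: algebra_simps)
  show "x * y = y * x" by transfer (auto simp: algebra_simps)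
  show "1 * x = x" by transfer auto
  show "(x + y) * z = x * z + y * z" by transfer (auto simp: algebra_simps)
  show "(0 :: mint) \<noteq> 1" by transfer auto
  show "x + y - x = y" by transfer (auto simp: ac_simps)
  show "x - y - z = x - (y + z)" by transfer (auto simp: ac_simps)
  show "0 * x = 0" "x * 0 = 0" by (transfer; auto)+
  show "x \<le> x" by transfer auto
  show anti: "x \<le> y \<Longrightarrow> y \<le> x \<Longrightarrow> x = y" for x y :: mint by transfer auto
  show tot: "x \<le> y \<or> y \<le> x" for x y :: mint by transfer auto
  show "x \<le> y \<Longrightarrow> y \<le> z \<Longrightarrow> x \<le> z"
  proof transfer
    fix p q r :: "mnat \<times> mnat"
    obtain a b c d e f where *: "p = (a, b)" "q = (c, d)" "r = (e, f)" by (metis surj_pair)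
    assume "(case p of (a, b) \<Rightarrow> \<lambda>(c, d). a + d \<le> c + b) q" "(case q of (a, b) \<Rightarrow> \<lambda>(c, d). a + d \<le> c + b) r"
    then have "a + d + (c + f) \<le> c + b + (e + d)" using * by (metis add_mono case_prod_conv)
    moreover have "a + d + (c + f) = (a + f) + (c + d)" "c + b + (e + d) = (e + b) + (c + d)"
      by (simp_all add: ac_simps)
    ultimately show "(case p of (a, b) \<Rightarrow> \<lambda>(c, d). a + d \<le> c + b) r" using * by simp
  qed
  show "x < y \<longleftrightarrow> x \<le> y \<and> \<not> y \<le> x" unfolding less_mint_def using tot by blast
  show "x \<le> y \<Longrightarrow> z + x \<le> z + y"
  proof transfer
    fix p q r :: "mnat \<times> mnat"
    obtain a b c d e f where *: "p = (a, b)" "q = (c, d)" "r = (e, f)" by (metis surj_pair)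
    assume "(case p of (a, b) \<Rightarrow> \<lambda>(c, d). a + d \<le> c + b) q"
    then have "(a + d) + (e + f) \<le> (c + b) + (e + f)" using * by simp
    moreover have "(e + a) + (f + d) = (a + d) + (e + f)" "(e + c) + (f + b) = (c + b) + (e + f)"
      by (simp_all add: ac_simps)
    ultimately show "(case (case r of (a, b) \<Rightarrow> \<lambda>(c, d). (a + c, b + d)) p of (a, b) \<Rightarrow> \<lambda>(c, d). a + d \<le> c + b)
        ((case r of (a, b) \<Rightarrow> \<lambda>(c, d). (a + c, b + d)) q)"
      using * by (simp del: add_le_cancel_right add_le_cancel_left)
  qed
  show "x < y \<Longrightarrow> 0 < z \<Longrightarrow> z * x < z * y"
    unfolding less_mint_def
  proof transfer
    fix p q r :: "mnat \<times> mnat"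
    obtain a b c d e f where *: "p = (a, b)" "q = (c, d)" "r = (e, f)" by (metis surj_pair)
    assume "\<not> (case q of (a, b) \<Rightarrow> \<lambda>(c, d). a + d \<le> c + b) p"
      "\<not> (case r of (a, b) \<Rightarrow> \<lambda>(c, d). a + d \<le> c + b) (0, 0)"
    then have 1: "a + d < c + b" "f < e" using * by auto
    \<comment> \<open>Multiplication by the class of \<open>(e, f)\<close> is multiplication by this
      positive difference.\<close>
    define k where "k = e - f"
    have k: "e = f + k" using 1 unfolding k_def by (simp add: add.commute)
    then have k': "0 < k" using 1 mnat_ge_0 [of k] by (metis add.right_neutral less_irrefl order_le_less)
    have "k * (a + d) < k * (c + b)" using 1 k' by (intro mult_strict_left_mono)
    then show "\<not> (case (case r of (a, b) \<Rightarrow> \<lambda>(c, d). (a * c + b * d, a * d + b * c)) q of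
            (a, b) \<Rightarrow> \<lambda>(c, d). a + d \<le> c + b)
          ((case r of (a, b) \<Rightarrow> \<lambda>(c, d). (a * c + b * d, a * d + b * c)) p)"
      using * k add_strict_left_mono [of "a * k + d * k" "b * k + c * k" "b * f + c * f + d * f + a * f"]
      by (simp add: algebra_simps not_le)
  qed
  show "\<bar>x\<bar> = (if x < 0 then - x else x)" by (rule mint_abs)
  show "sgn x = (if x = 0 then 0 else if 0 < x then 1 else - 1)" by (rule sgn_mint_def)
qed

end

section \<open>Fractions and the Archimedean property relative to the model's numbers\<close>

type_synonym mrat = "mint fract"

lift_definition mint_of :: "mnat \<Rightarrow> mint" is "\<lambda>n. (n, 0)" .

definition emb :: "mnat \<Rightarrow> mrat" where "emb n = Fract (mint_of n) 1"

lemma emb_simps [simp]: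
  "emb 0 = 0" "emb 1 = 1" "emb (a + b) = emb a + emb b" "emb (a * b) = emb a * emb b"
  "emb a \<le> emb b \<longleftrightarrow> a \<le> b" "emb a < emb b \<longleftrightarrow> a < b" "emb a = emb b \<longleftrightarrow> a = b"
  "emb (sucM a) = emb a + 1"
proof -
  have [simp]: "mint_of 0 = 0" "mint_of 1 = 1" "mint_of (a + b) = mint_of a + mint_of b"
    "mint_of (a * b) = mint_of a * mint_of b" "mint_of a \<le> mint_of b \<longleftrightarrow> a \<le> b"
    "mint_of a = mint_of b \<longleftrightarrow> a = b" for a b
    by (transfer; simp)+
  have le: "emb a \<le> emb b \<longleftrightarrow> a \<le> b" for a b
    by (simp add: emb_def)
  show "emb 0 = 0" by (simp add: emb_def Zero_fract_def)
  show e1: "emb 1 = 1" by (simp add: emb_def One_fract_def)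
  show add: "emb (a + b) = emb a + emb b" for a b by (simp add: emb_def)
  show "emb (a * b) = emb a * emb b" by (simp add: emb_def)
  show "emb a \<le> emb b \<longleftrightarrow> a \<le> b" by (rule le)
  show "emb a < emb b \<longleftrightarrow> a < b" using le by (metis not_le)
  show "emb a = emb b \<longleftrightarrow> a = b" by (simp add: emb_def eq_fract)
  show "emb (sucM a) = emb a + 1" by (simp add: sucM_conv add e1)
qed

lemma emb_ge_0 [simp]: "0 \<le> emb a"
  using emb_simps(5) [of 0 a] by simp

lemma emb_gt_0 [simp]: "0 < emb a \<longleftrightarrow> a \<noteq> 0"
  using emb_simps(6) [of 0 a] by (simp add: order.strict_iff_order)

lemma emb_diff: "b \<le> a \<Longrightarrow> emb (a - b) = emb a - emb b"
  by (metis add_diff_cancel_right' emb_simps(3) le_add_diff_inverse2)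

lemma mint_discrete: "0 < x \<Longrightarrow> 1 \<le> (x :: mint)"
  unfolding less_mint_def by transfer (auto simp: not_le mnat_less_iff add.commute)

lemma mint_bounded: "\<exists>n. x \<le> mint_of n"
  by transfer (auto simp: le_iff_addM)

text \<open>Write x as a / b with b positive. By discreteness a is at least 1, and b is at most some
  number n of the model, so x is at least 1 / n. This n may be nonstandard.\<close>

lemma mrat_archimedean:
  assumes "0 < (x :: mrat)" shows "\<exists>n. n \<noteq> 0 \<and> 1 / emb n \<le> x"
proof -
  obtain a b where x: "x = Fract a b" "0 < b"
  proof (cases x)
    case (Fract a b)
    show thesis
    proof (cases "0 < b")
      case True
      with Fract show thesis by (intro that)
    next
      case False
      with Fract have "x = Fract (- a) (- b)" "0 < - b" by (simp_all add: eq_fract)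
      then show thesis by (rule that)
    qed
  qed
  then have "1 \<le> a" using assms by (intro mint_discrete) (simp add: zero_less_Fract_iff)
  obtain n where n: "b \<le> mint_of n" using mint_bounded by blast
  then have "0 < mint_of n" using x by simp
  have "mint_of 0 = 0" by transfer simp
  with \<open>0 < mint_of n\<close> have "n \<noteq> 0" by auto
  have "1 / emb n = Fract 1 (mint_of n)" by (simp add: emb_def One_fract_def)
  also have "b * 1 \<le> mint_of n * a" using \<open>1 \<le> a\<close> n x by (intro mult_mono) auto
  then have "Fract 1 (mint_of n) \<le> Fract a b"
    using x \<open>0 < mint_of n\<close> mult_right_mono [of "b" "mint_of n * a" "mint_of n * b"] by (simp add: ac_simps)
  finally show ?thesis using x \<open>n \<noteq> 0\<close> by metis
qed


subsection \<open>Powers of two and pairing\<close>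

definition pow2 :: "mnat \<Rightarrow> mnat" where "pow2 t = recM t 1 (\<lambda>v m. v + v)"

lemma intlc_pow2 [intlc_intros]: "intlc f \<Longrightarrow> intlc (\<lambda>c. pow2 (f c))"
  unfolding pow2_def by (intro intlc_intros)

lemma pow2_0 [simp]: "pow2 0 = 1"
  unfolding pow2_def by (intro recM_0 intl_fun2I intlc_intros)

lemma pow2_suc [simp]: "pow2 (n + 1) = pow2 n + pow2 n"
  unfolding pow2_def sucM_conv [symmetric] by (subst recM_Suc) (intro intlc_intros, rule refl)

lemma less_pow2: "n < pow2 n"
proof (induction n rule: internal_induct)
  case (Suc n)
  then have "n + 1 \<le> pow2 n" "1 \<le> pow2 n" by (simp_all add: mnat_less_iff add_increasing order_trans [of 1 "n + 1"])
  then show ?case unfolding pow2_suc mnat_less_iff [of "n + 1"] by (rule add_mono)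
qed (intro intlc_intros, simp)

lemma pow2_neq_0 [simp]: "pow2 n \<noteq> 0"
  using less_pow2 [of n] mnat_ge_0 [of n] by (metis leD)

lemma pow2_add: "pow2 (a + b) = pow2 a * pow2 b"
proof (induction b rule: internal_induct)
  case (Suc b)
  then show ?case using pow2_suc [of "a + b"] by (simp add: add.assoc [symmetric] distrib_left)
qed (intro intlc_intros, simp)

lemma pow2_mono: "a \<le> b \<Longrightarrow> pow2 a \<le> pow2 b"
proof -
  assume "a \<le> b"
  then obtain c where c: "b = a + c" by (auto simp: le_iff_addM)
  have "1 \<le> pow2 c" using less_pow2 [of c] by (simp add: mnat_less_iff order_trans [of 1 "c + 1"])
  then have "pow2 a * 1 \<le> pow2 a * pow2 c" by (intro mult_left_mono) auto
  then show ?thesis by (simp add: c pow2_add)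
qed

definition eps :: "mnat \<Rightarrow> mrat" where "eps n = 1 / emb (pow2 n)"

lemma eps_gt_0 [simp]: "0 < eps n" and eps_ge_0 [simp]: "0 \<le> eps n"
  by (simp_all add: eps_def)

lemma eps_0 [simp]: "eps 0 = 1"
  by (simp add: eps_def)

lemma eps_suc: "eps (n + 1) = eps n / 2"
proof -
  have "emb (pow2 (n + 1)) = 2 * emb (pow2 n)" by simp
  then show ?thesis unfolding eps_def by (metis divide_divide_eq_left' mult.commute)
qed

lemma eps_antimono: "a \<le> b \<Longrightarrow> eps b \<le> eps a"
  unfolding eps_def using pow2_mono [of a b] by (intro divide_left_mono mult_pos_pos) auto

lemma eps_archimedean: "0 < x \<Longrightarrow> \<exists>n. eps n < x"
proof -
  assume "0 < x"
  then obtain n where n: "n \<noteq> 0" "1 / emb n \<le> x" using mrat_archimedean by blast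
  have "1 / emb (pow2 n) < 1 / emb n" using n less_pow2 [of n] by (intro divide_strict_left_mono mult_pos_pos) auto
  then show ?thesis using n unfolding eps_def by (metis less_le_trans)
qed

section \<open>Cantor's pairing and its projections\<close>

definition tri :: "mnat \<Rightarrow> mnat" where "tri t = recM t 0 (\<lambda>v m. v + sucM m)"
definition pair :: "mnat \<Rightarrow> mnat \<Rightarrow> mnat" where "pair s t = tri (s + t) + t"
definition tri_root :: "mnat \<Rightarrow> mnat" where
  "tri_root t = recM t 0 (\<lambda>v m. v + (1 - (tri (sucM v) - sucM m)))"
definition proj2 :: "mnat \<Rightarrow> mnat" where "proj2 t = t - tri (tri_root t)"
definition proj1 :: "mnat \<Rightarrow> mnat" where "proj1 t = tri_root t - proj2 t"

lemma intlc_tri [intlc_intros]: "intlc f \<Longrightarrow> intlc (\<lambda>c. tri (f c))"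
  unfolding tri_def by (intro intlc_intros)
lemma intlc_pair [intlc_intros]: "intlc f \<Longrightarrow> intlc g \<Longrightarrow> intlc (\<lambda>c. pair (f c) (g c))"
  unfolding pair_def by (intro intlc_intros)
lemma intlc_tri_root [intlc_intros]: "intlc f \<Longrightarrow> intlc (\<lambda>c. tri_root (f c))"
  unfolding tri_root_def by (intro intlc_intros)
lemma intlc_proj2 [intlc_intros]: "intlc f \<Longrightarrow> intlc (\<lambda>c. proj2 (f c))"
  unfolding proj2_def by (intro intlc_intros)
lemma intlc_proj1 [intlc_intros]: "intlc f \<Longrightarrow> intlc (\<lambda>c. proj1 (f c))"
  unfolding proj1_def by (intro intlc_intros)

lemma tri_0 [simp]: "tri 0 = 0"
  unfolding tri_def by (intro recM_0 intl_fun2I intlc_intros)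

lemma tri_suc: "tri (n + 1) = tri n + (n + 1)"
  unfolding tri_def sucM_conv [symmetric] by (subst recM_Suc) (intro intlc_intros, rule refl)

lemma tri_root_0 [simp]: "tri_root 0 = 0"
  unfolding tri_root_def by (intro recM_0 intl_fun2I intlc_intros)

lemma tri_root_suc: "tri_root (n + 1) = tri_root n + (1 - (tri (tri_root n + 1) - (n + 1)))"
  unfolding tri_root_def sucM_conv [symmetric] by (subst recM_Suc) (intro intlc_intros, rule refl)

lemma tri_mono: "a \<le> b \<Longrightarrow> tri a \<le> tri b"
proof -
  assume "a \<le> b"
  then obtain c where c: "b = a + c" by (auto simp: le_iff_addM)
  have "tri a \<le> tri (a + c)"
  proof (induction c rule: internal_induct)
    case (Suc c)
    then show ?case using tri_suc [of "a + c"] by (simp add: add.assoc [symmetric] add_increasing2)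
  qed (intro intlc_intros, simp)
  then show ?thesis by (simp add: c)
qed

text \<open>The invariant of the recursion: the root grows by one exactly when the argument reaches
  the next triangular number, and one such step restores the upper bound.\<close>

lemma tri_root_bounds: "tri (tri_root t) \<le> t \<and> t < tri (tri_root t + 1)"
proof (induction t rule: internal_induct)
  case 0 then show ?case using tri_suc [of 0] by simp
next
  case (Suc t)
  let ?w = "tri_root t"
  from Suc have le: "tri ?w \<le> t" "t + 1 \<le> tri (?w + 1)" by (auto simp: mnat_less_iff)
  show ?case
  proof (cases "tri (?w + 1) = t + 1")
    case True
    then have "tri_root (t + 1) = ?w + 1" by (simp add: tri_root_suc)
    then show ?thesis using True tri_suc [of "?w + 1"]
      by (simp add: mnat_less_iff add_increasing add.assoc del: one_add_one)
  next
    case False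
    with le have less: "t + 1 < tri (?w + 1)" by simp
    then have "tri (?w + 1) - (t + 1) \<noteq> 0" by (simp add: mnat_le_iff [symmetric] not_le)
    then have "1 - (tri (?w + 1) - (t + 1)) = 0"
      by (cases "tri (?w + 1) - (t + 1)" rule: mnat_cases) (simp_all add: one_mnat_def)
    then have "tri_root (t + 1) = ?w" by (simp add: tri_root_suc)
    then show ?thesis using less le by (simp add: add_increasing2)
  qed
qed (intro intlc_intros)

lemma tri_root_unique: "tri w \<le> t \<Longrightarrow> t < tri (w + 1) \<Longrightarrow> tri_root t = w"
proof (rule ccontr)
  assume *: "tri w \<le> t" "t < tri (w + 1)" "tri_root t \<noteq> w"
  then have "tri_root t + 1 \<le> w \<or> w + 1 \<le> tri_root t" by (metis mnat_less_iff neqE)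
  then show False using * tri_root_bounds [of t] tri_mono [of "tri_root t + 1" w] tri_mono [of "w + 1" "tri_root t"]
    by auto
qed

text \<open>The summand \<open>t\<close> is too small to reach the next triangular number after
  \<open>tri (s + t)\<close>, so the root recovers \<open>s + t\<close>.\<close>

lemma tri_root_pair: "tri_root (pair s t) = s + t"
proof (rule tri_root_unique)
  show "tri (s + t) \<le> pair s t" by (simp add: pair_def add_increasing2)
  have "t < s + t + 1" using mnat_less_iff [of t "s + t + 1"] by (simp add: add_increasing)
  then show "pair s t < tri (s + t + 1)" by (simp add: pair_def tri_suc)
qed

lemma proj2_pair [simp]: "proj2 (pair s t) = t"
  unfolding proj2_def tri_root_pair by (simp add: pair_def)

lemma proj1_pair [simp]: "proj1 (pair s t) = s"
  unfolding proj1_def tri_root_pair by simp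


subsection \<open>Codes of rationals\<close>

definition ratM :: "mnat \<Rightarrow> mnat \<Rightarrow> mnat \<Rightarrow> mnat" where "ratM a b d = pair a (pair b (predM d))"
definition negM :: "mnat \<Rightarrow> mnat" where "negM q = proj1 (proj2 q)"
definition denM :: "mnat \<Rightarrow> mnat" where "denM q = sucM (proj2 (proj2 q))"
definition addq :: "mnat \<Rightarrow> mnat \<Rightarrow> mnat" where
  "addq q r = ratM (proj1 q * denM r + proj1 r * denM q) (negM q * denM r + negM r * denM q) (denM q * denM r)"
definition uminusq :: "mnat \<Rightarrow> mnat" where "uminusq q = ratM (negM q) (proj1 q) (denM q)"
definition absq :: "mnat \<Rightarrow> mnat" where
  "absq q = ratM ((proj1 q - negM q) + (negM q - proj1 q)) 0 (denM q)"
definition inv_pow2 :: "mnat \<Rightarrow> mnat" where "inv_pow2 n = ratM 1 0 (pow2 n)"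

text \<open>A fraction has many codes. Estimates are carried out on values, internal constructions
  on codes.\<close>

definition qv :: "mnat \<Rightarrow> mrat" where "qv q = (emb (proj1 q) - emb (negM q)) / emb (denM q)"

definition leq :: "mnat \<Rightarrow> mnat \<Rightarrow> bool" where
  "leq q r \<longleftrightarrow> proj1 q * denM r + negM r * denM q \<le> proj1 r * denM q + negM q * denM r"
definition lessq :: "mnat \<Rightarrow> mnat \<Rightarrow> bool" where
  "lessq q r \<longleftrightarrow> proj1 q * denM r + negM r * denM q < proj1 r * denM q + negM q * denM r"

lemma intlc_ratM [intlc_intros]:
  "intlc f \<Longrightarrow> intlc g \<Longrightarrow> intlc h \<Longrightarrow> intlc (\<lambda>c. ratM (f c) (g c) (h c))"
  unfolding ratM_def by (intro intlc_intros)
lemma intlc_negM [intlc_intros]: "intlc f \<Longrightarrow> intlc (\<lambda>c. negM (f c))"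
  unfolding negM_def by (intro intlc_intros)
lemma intlc_denM [intlc_intros]: "intlc f \<Longrightarrow> intlc (\<lambda>c. denM (f c))"
  unfolding denM_def by (intro intlc_intros)
lemma intlc_addq [intlc_intros]: "intlc f \<Longrightarrow> intlc g \<Longrightarrow> intlc (\<lambda>c. addq (f c) (g c))"
  unfolding addq_def by (intro intlc_intros)
lemma intlc_uminusq [intlc_intros]: "intlc f \<Longrightarrow> intlc (\<lambda>c. uminusq (f c))"
  unfolding uminusq_def by (intro intlc_intros)
lemma intlc_absq [intlc_intros]: "intlc f \<Longrightarrow> intlc (\<lambda>c. absq (f c))"
  unfolding absq_def by (intro intlc_intros)
lemma intlc_inv_pow2 [intlc_intros]: "intlc f \<Longrightarrow> intlc (\<lambda>c. inv_pow2 (f c))"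
  unfolding inv_pow2_def by (intro intlc_intros)

lemma denM_neq_0 [simp]: "denM q \<noteq> 0" by (simp add: denM_def)

lemma emb_denM_gt_0 [simp]: "0 < emb (denM q)" by simp

lemma emb_denM_neq_0 [simp]: "emb (denM q) \<noteq> 0"
  using emb_denM_gt_0 [of q] by (metis less_irrefl)

lemma ratM_proj: "proj1 (ratM a b d) = a" "negM (ratM a b d) = b" "d \<noteq> 0 \<Longrightarrow> denM (ratM a b d) = d"
  by (simp_all add: ratM_def negM_def denM_def) (cases d rule: mnat_cases; simp)

lemma qv_ratM: "d \<noteq> 0 \<Longrightarrow> qv (ratM a b d) = (emb a - emb b) / emb d"
  by (simp add: qv_def ratM_proj)

lemma qv_addq [simp]: "qv (addq q r) = qv q + qv r"
  by (simp add: addq_def qv_ratM) (simp add: qv_def divide_simps, simp add: algebra_simps)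

lemma qv_uminusq [simp]: "qv (uminusq q) = - qv q"
  by (simp add: uminusq_def qv_ratM) (simp add: qv_def divide_simps)

lemma qv_absq [simp]: "qv (absq q) = \<bar>qv q\<bar>"
proof -
  let ?a = "proj1 q" and ?b = "negM q"
  have "emb ((?a - ?b) + (?b - ?a)) = \<bar>emb ?a - emb ?b\<bar>"
  proof (cases "?a \<le> ?b")
    case True
    then have "?a - ?b = 0" by (simp add: mnat_le_iff)
    then show ?thesis using True by (simp add: emb_diff)
  next
    case False
    then have "?b - ?a = 0" by (metis linear mnat_le_iff)
    then show ?thesis using False by (simp add: emb_diff)
  qed
  then show ?thesis unfolding absq_def qv_ratM [OF denM_neq_0] by (simp add: qv_def abs_divide)
qed

lemma qv_inv_pow2 [simp]: "qv (inv_pow2 n) = eps n"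
  by (simp add: inv_pow2_def qv_ratM eps_def)

lemma leq_iff: "leq q r \<longleftrightarrow> qv q \<le> qv r"
proof -
  have "qv q \<le> qv r \<longleftrightarrow> (emb (proj1 q) - emb (negM q)) * emb (denM r) \<le> (emb (proj1 r) - emb (negM r)) * emb (denM q)"
    unfolding qv_def by (simp add: divide_le_eq le_divide_eq)
  also have "\<dots> \<longleftrightarrow> emb (proj1 q * denM r + negM r * denM q) \<le> emb (proj1 r * denM q + negM q * denM r)"
    by (simp add: algebra_simps del: emb_simps(5,6))
  finally show ?thesis unfolding leq_def emb_simps(5) by simp
qed

lemma lessq_iff: "lessq q r \<longleftrightarrow> qv q < qv r"
  using leq_iff [of r q] unfolding leq_def lessq_def by (metis add.commute not_le)

text \<open>\<open>qv\<close> takes values outside the finite types, so a comparison of values is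
  shown internal through the cross-multiplied inequality of codes. Later predicates are rewritten
  into codes for this reason.\<close>

lemma intlc_leq [intlc_intros]: "intlc f \<Longrightarrow> intlc g \<Longrightarrow> intlc (\<lambda>c. chi (qv (f c) \<le> qv (g c)))"
  unfolding leq_iff [symmetric] leq_def by (intro intlc_intros)

lemma intlc_lessq [intlc_intros]: "intlc f \<Longrightarrow> intlc g \<Longrightarrow> intlc (\<lambda>c. chi (qv (f c) < qv (g c)))"
  unfolding lessq_iff [symmetric] lessq_def by (intro intlc_intros)


section \<open>Denotations of the arithmetical terms\<close>

text \<open>
  Nested abstractions are evaluated under a simultaneous substitution, as instantiating them one
  by one could capture the free variables of the arguments.
\<close>

fun sub :: "(nat \<Rightarrow> ty \<Rightarrow> tm) \<Rightarrow> tm \<Rightarrow> tm" where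
  "sub \<theta> (Fr n \<rho>) = \<theta> n \<rho>"
| "sub \<theta> (s \<cdot> t) = sub \<theta> s \<cdot> sub \<theta> t"
| "sub \<theta> t = t"

definition upd :: "(nat \<Rightarrow> ty \<Rightarrow> tm) \<Rightarrow> nat \<Rightarrow> ty \<Rightarrow> tm \<Rightarrow> nat \<Rightarrow> ty \<Rightarrow> tm" where
  "upd \<theta> n \<rho> s m \<sigma> = (if m = n \<and> \<sigma> = \<rho> then s else \<theta> m \<sigma>)"

definition wts :: "(nat \<Rightarrow> ty \<Rightarrow> tm) \<Rightarrow> bool" where
  "wts \<theta> \<longleftrightarrow> (\<forall>n \<rho>. has_ty [] (\<theta> n \<rho>) \<rho>)"

text \<open>Variables in \<open>A\<close> are abstracted away and do not influence the name chosen
  by an enclosing \<open>lam\<close>; this makes the names in nested abstractions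
  computable.\<close>

fun fresh_except :: "(nat \<times> ty) set \<Rightarrow> tm \<Rightarrow> nat" where
  "fresh_except A (Fr n \<rho>) = (if (n, \<rho>) \<in> A then 0 else Suc n)"
| "fresh_except A (s \<cdot> t) = max (fresh_except A s) (fresh_except A t)"
| "fresh_except A t = 0"

declare bracket.simps [simp del]

lemma upd_simps [simp]:
  "upd \<theta> n \<rho> s n \<rho> = s" "m \<noteq> n \<Longrightarrow> upd \<theta> n \<rho> s m \<sigma> = \<theta> m \<sigma>" "\<sigma> \<noteq> \<rho> \<Longrightarrow> upd \<theta> n \<rho> s m \<sigma> = \<theta> m \<sigma>"
  by (auto simp: upd_def)

lemma sub_Fr: "sub Fr t = t"
  by (induction t) auto

lemma sub_cong: "(\<And>n \<rho>. (n, \<rho>) \<in> fv_tm t \<Longrightarrow> \<theta> n \<rho> = \<theta>' n \<rho>) \<Longrightarrow> sub \<theta> t = sub \<theta>' t"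
  by (induction t) auto

lemma sub_closed: "fv_tm t = {} \<Longrightarrow> sub \<theta> t = t"
  using sub_cong [of t \<theta> Fr] by (simp add: sub_Fr)

lemma fresh_except_empty: "fresh_except {} t = fresh_tm t"
  by (induction t) auto

lemma fv_bracket [simp]: "fv_tm (bracket n \<rho> t) = fv_tm t - {(n, \<rho>)}"
  by (induction t) (auto simp: bracket.simps split: if_splits)

lemma fresh_except_closed: "fv_tm t \<subseteq> A \<Longrightarrow> fresh_except A t = 0"
  by (induction t) auto

lemma fresh_except_bracket [simp]: "fresh_except A (bracket n \<rho> t) = fresh_except (insert (n, \<rho>) A) t"
proof (induction t)
  case (App s t)
  show ?case
  proof (cases "(n, \<rho>) \<in> fv_tm (s \<cdot> t)")
    case False
    have "fresh_except A u = fresh_except (insert (n, \<rho>) A) u" if "(n, \<rho>) \<notin> fv_tm u" for u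
      using that by (induction u) auto
    then show ?thesis using False by (simp add: bracket.simps)
  qed (use App in \<open>auto simp: bracket.simps\<close>)
qed (auto simp: bracket.simps)

lemma fresh_bracket [simp]: "fresh_tm (bracket n \<rho> t) = fresh_except {(n, \<rho>)} t"
  using fresh_except_bracket [of "{}" n \<rho> t] unfolding fresh_except_empty .

lemma has_ty_bracket: "has_ty [] t \<tau> \<Longrightarrow> has_ty [] (bracket n \<rho> t) (\<rho> \<rightarrow> \<tau>)"
proof (induction t arbitrary: \<tau>)
  case (App s t)
  then obtain \<sigma> where st: "has_ty [] s (\<sigma> \<rightarrow> \<tau>)" "has_ty [] t \<sigma>" by (auto elim: has_ty_AppE)
  then have "ty_of t = \<sigma>" "ty_of (s \<cdot> t) = \<tau>" using App.prems by (auto dest: ty_of_has_ty)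
  then show ?case
    using App.IH(1) [OF st(1)] App.IH(2) [OF st(2)] App.prems by (auto simp: bracket.simps simp del: ty_of.simps intro!: has_ty.intros(5,6) intro: has_ty.intros(8))
qed (auto simp: bracket.simps elim!: has_ty_elims intro!: has_ty.intros(2-7) intro: has_ty.intros(8))

lemma has_ty_sub: "wts \<theta> \<Longrightarrow> has_ty [] t \<tau> \<Longrightarrow> has_ty [] (sub \<theta> t) \<tau>"
  by (induction t arbitrary: \<tau>) (auto simp: wts_def elim!: has_ty_elims intro: has_ty.intros)

lemma wts_Fr: "wts Fr"
  by (simp add: wts_def has_ty.intros)

lemma wts_upd: "wts \<theta> \<Longrightarrow> has_ty [] s \<rho> \<Longrightarrow> wts (upd \<theta> n \<rho> s)"
  by (simp add: wts_def upd_def)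

text \<open>Beta reduction for \<open>bracket\<close>, by the same three cases as combinatory
  completeness. The argument is recorded in the substitution instead of being inserted into the
  term.\<close>

lemma eqv_bracket:
  assumes cm: cm and \<theta>: "wts \<theta>" and s: "has_ty [] s \<rho>"
  shows "has_ty [] t \<tau> \<Longrightarrow> eqv \<tau> (sub \<theta> (bracket n \<rho> t) \<cdot> s) (sub (upd \<theta> n \<rho> s) t)"
proof (induction t arbitrary: \<tau>)
  case (App f a)
  have ty: "has_ty [] (sub \<theta> (f \<cdot> a)) \<tau>" by (rule has_ty_sub [OF \<theta> App.prems])
  from App obtain \<sigma> where fa: "has_ty [] f (\<sigma> \<rightarrow> \<tau>)" "has_ty [] a \<sigma>" by (auto elim: has_ty_AppE)
  have tyof: "ty_of a = \<sigma>" "ty_of (f \<cdot> a) = \<tau>" using fa App.prems by (auto dest: ty_of_has_ty)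
  show ?case
  proof (cases "(n, \<rho>) \<in> fv_tm (f \<cdot> a)")
    case False
    then have "sub (upd \<theta> n \<rho> s) (f \<cdot> a) = sub \<theta> (f \<cdot> a)" by (intro sub_cong) (auto simp: upd_def)
    then show ?thesis using False eqv_Pi [OF cm ty s] tyof by (simp add: bracket.simps del: ty_of.simps)
  next
    case True
    let ?\<theta> = "upd \<theta> n \<rho> s" and ?f = "sub \<theta> (bracket n \<rho> f)" and ?a = "sub \<theta> (bracket n \<rho> a)"
    have t: "has_ty [] ?f (\<rho> \<rightarrow> \<sigma> \<rightarrow> \<tau>)" "has_ty [] ?a (\<rho> \<rightarrow> \<sigma>)"
      "has_ty [] (sub ?\<theta> f) (\<sigma> \<rightarrow> \<tau>)" "has_ty [] (sub ?\<theta> a) \<sigma>"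
      using fa \<theta> s by (auto intro!: has_ty_sub has_ty_bracket wts_upd)
    have "eqv \<tau> (Sg \<rho> \<sigma> \<tau> \<cdot> ?f \<cdot> ?a \<cdot> s) (sub ?\<theta> f \<cdot> sub ?\<theta> a)"
    proof (rule eqv_trans [OF cm])
      show "eqv \<tau> (Sg \<rho> \<sigma> \<tau> \<cdot> ?f \<cdot> ?a \<cdot> s) (?f \<cdot> s \<cdot> (?a \<cdot> s))" using t s by (intro eqv_Sg cm)
      show "eqv \<tau> (?f \<cdot> s \<cdot> (?a \<cdot> s)) (sub ?\<theta> f \<cdot> sub ?\<theta> a)"
        using t s App.IH(1) [OF fa(1)] App.IH(2) [OF fa(2)]
        by (intro eqv_app [OF cm, of _ \<sigma>]) (auto intro: has_ty.intros(8))
    qed (insert t s, (assumption | rule sem_intros)+)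
    then show ?thesis using True tyof by (simp add: bracket.simps del: ty_of.simps)
  qed
next
  case (Fr m \<sigma>)
  then have \<sigma>: "\<sigma> = \<tau>" by (auto elim: has_ty_FrE)
  show ?case
  proof (cases "m = n \<and> \<sigma> = \<rho>")
    case True
    have "eqv \<rho> (Sg \<rho> (\<rho> \<rightarrow> \<rho>) \<rho> \<cdot> Pi \<rho> (\<rho> \<rightarrow> \<rho>) \<cdot> Pi \<rho> \<rho> \<cdot> s) s"
    proof (rule eqv_trans [OF cm])
      show "eqv \<rho> (Sg \<rho> (\<rho> \<rightarrow> \<rho>) \<rho> \<cdot> Pi \<rho> (\<rho> \<rightarrow> \<rho>) \<cdot> Pi \<rho> \<rho> \<cdot> s) (Pi \<rho> (\<rho> \<rightarrow> \<rho>) \<cdot> s \<cdot> (Pi \<rho> \<rho> \<cdot> s))"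
        by (insert s) (assumption | rule eqv_Sg [OF cm] sem_intros)+
      show "eqv \<rho> (Pi \<rho> (\<rho> \<rightarrow> \<rho>) \<cdot> s \<cdot> (Pi \<rho> \<rho> \<cdot> s)) s"
        by (insert s) (assumption | rule eqv_Pi [OF cm] sem_intros)+
    qed (insert s, (assumption | rule sem_intros)+)
    then show ?thesis using True \<sigma> by (simp add: bracket.simps upd_def)
  next
    case False
    then show ?thesis using \<sigma> \<theta> s by (auto simp: bracket.simps upd_def wts_def intro: eqv_Pi cm)
  qed
qed (auto simp: bracket.simps elim!: has_ty_elims intro!: eqv_Pi cm s has_ty.intros simp del: eqv.simps)

text \<open>Reduces the denotation of an abstraction to that of its body; repeated use evaluates
  nested abstractions down to arithmetic.\<close>

lemma rel_bracket:
  assumes cm: cm and \<theta>: "wts \<theta>" and t: "has_ty [] t \<tau>"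
    and ty: "\<rho> = tyc TYPE('a::mtype)" "\<tau> = tyc TYPE('b::mtype)"
    and rel: "\<And>s x. rel s (x :: 'a) \<Longrightarrow> wts (upd \<theta> n \<rho> s) \<Longrightarrow> rel (sub (upd \<theta> n \<rho> s) t) (f x :: 'b)"
  shows "rel (sub \<theta> (bracket n \<rho> t)) f"
proof (rule rel_fun_eqI)
  show t': "has_ty [] (sub \<theta> (bracket n \<rho> t)) (tyc TYPE('a) \<rightarrow> tyc TYPE('b))"
    using has_ty_sub [OF \<theta> has_ty_bracket [OF t]] ty by simp
  fix s and x :: 'a assume s: "rel s x"
  have s': "has_ty [] s \<rho>" using rel_ty [OF s] ty by simp
  have r: "rel (sub (upd \<theta> n \<rho> s) t) (f x)" by (rule rel [OF s wts_upd [OF \<theta> s']])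
  have t'': "has_ty [] (sub \<theta> (bracket n \<rho> t) \<cdot> s) (tyc TYPE('b))"
    using t' s' ty by (auto intro: has_ty.intros(8))
  show "rel (sub \<theta> (bracket n \<rho> t) \<cdot> s) (f x)"
    using rel_resp [OF cm r t''] eqv_sym [OF cm t'' rel_ty [OF r]] eqv_bracket [OF cm \<theta> s' t] ty by simp
qed

lemma rel_closed: "rel (sub Fr t) x \<Longrightarrow> rel t x"
  by (simp add: sub_Fr)

lemmas [sem_intros] = has_ty_bracket

named_theorems rel_intros

lemma rel_Zero' [rel_intros]: "cm \<Longrightarrow> rel Zero (0 :: mnat)"
  unfolding zero_mnat_def by (rule rel_Zero)

lemma rel_Succ' [rel_intros]: "cm \<Longrightarrow> rel s x \<Longrightarrow> rel (Succ \<cdot> s) (sucM x)"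
  using rel_app [OF rel_Succ] .

lemma rel_One [rel_intros]: "cm \<Longrightarrow> rel One (1 :: mnat)"
  unfolding one_mnat_def by (rule rel_Succ' rel_Zero' | assumption)+

lemmas [rel_intros] = rel_Rec_app

named_theorems sub_simps

lemmas [sub_simps] = tyc_simps sub.simps upd_simps nat.distinct nat.inject ty.distinct ty.inject
  not_False_eq_True not_True_eq_False

lemma closed_simps:
  assumes "fv_tm c = {}"
  shows "fresh_tm c = 0" "fresh_except A c = 0" "sub \<theta> c = c"
  using assms fresh_except_closed [of c "{}"] fresh_except_closed [of c A]
  by (simp_all add: fresh_except_empty sub_closed)

lemmas lam_simps = lam_def Let_def rec0_def

section \<open>Denotations of the closed terms for arithmetic, rationals and reals\<close>

definition of_rat :: "mnat \<Rightarrow> mnat \<Rightarrow> mnat" where "of_rat q = (\<lambda>n. q)"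
definition addr :: "(mnat \<Rightarrow> mnat) \<Rightarrow> (mnat \<Rightarrow> mnat) \<Rightarrow> mnat \<Rightarrow> mnat" where
  "addr x y = (\<lambda>n. addq (x (sucM n)) (y (sucM n)))"
definition uminusr :: "(mnat \<Rightarrow> mnat) \<Rightarrow> mnat \<Rightarrow> mnat" where "uminusr x = (\<lambda>n. uminusq (x n))"
definition absr :: "(mnat \<Rightarrow> mnat) \<Rightarrow> mnat \<Rightarrow> mnat" where "absr x = (\<lambda>n. absq (x n))"
definition distr :: "(mnat \<Rightarrow> mnat) \<Rightarrow> (mnat \<Rightarrow> mnat) \<Rightarrow> mnat \<Rightarrow> mnat" where
  "distr x y = absr (addr x (uminusr y))"

lemma minus_rec: "x - y = recM y x (\<lambda>v m. predM v)"
  unfolding minus_mnat_def predM_def ..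

text \<open>The pattern for the closed terms that follow: without variables, a term is ignored by
  substitutions and by the choice of names around it; its denotation is read off the definition and
  then turned into a rule for its applications.\<close>

lemma Add_fv [simp]: "fv_tm Add = {}"
  by (auto simp: Add_def lam_simps)
lemmas [simp, sub_simps] = closed_simps [OF Add_fv]
lemma Add_ty [sem_intros]: "has_ty [] Add (N \<rightarrow> N \<rightarrow> N)"
  unfolding Add_def lam_simps Pos_def by (rule sem_intros)+
lemma rel_Add: "cm \<Longrightarrow> rel Add (\<lambda>s t. recM t s (\<lambda>v m. sucM v))"
  unfolding Add_def [unfolded lam_simps, simplified]
  by (rule rel_closed)
    (assumption | rule rel_bracket wts_Fr rel_intros sem_intros | simp only: sub_simps | (rule rel_app, assumption))+
lemma rel_Add_app [rel_intros]: "cm \<Longrightarrow> rel s x \<Longrightarrow> rel t y \<Longrightarrow> rel (Add \<cdot> s \<cdot> t) (x + y :: mnat)"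
  unfolding plus_mnat_def by (rule rel_app2 [OF rel_Add])

lemma Mul_fv [simp]: "fv_tm Mul = {}"
  by (auto simp: Mul_def lam_simps)
lemmas [simp, sub_simps] = closed_simps [OF Mul_fv]
lemma Mul_ty [sem_intros]: "has_ty [] Mul (N \<rightarrow> N \<rightarrow> N)"
  unfolding Mul_def lam_simps Pos_def by (rule sem_intros)+
lemma rel_Mul: "cm \<Longrightarrow> rel Mul (\<lambda>s t. recM t 0 (\<lambda>v m. v + s))"
  unfolding Mul_def [unfolded lam_simps, simplified]
  by (rule rel_closed)
    (assumption | rule rel_bracket wts_Fr rel_intros sem_intros | simp only: sub_simps | (rule rel_app, assumption))+
lemma rel_Mul_app [rel_intros]: "cm \<Longrightarrow> rel s x \<Longrightarrow> rel t y \<Longrightarrow> rel (Mul \<cdot> s \<cdot> t) (x * y :: mnat)"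
  unfolding times_mnat_def by (rule rel_app2 [OF rel_Mul])

lemma Pred_fv [simp]: "fv_tm Pred = {}"
  by (auto simp: Pred_def lam_simps)
lemmas [simp, sub_simps] = closed_simps [OF Pred_fv]
lemma Pred_ty [sem_intros]: "has_ty [] Pred (N \<rightarrow> N)"
  unfolding Pred_def lam_simps Pos_def by (rule sem_intros)+
lemma rel_Pred: "cm \<Longrightarrow> rel Pred (\<lambda>t. recM t 0 (\<lambda>v m. m))"
  unfolding Pred_def [unfolded lam_simps, simplified]
  by (rule rel_closed)
    (assumption | rule rel_bracket wts_Fr rel_intros sem_intros | simp only: sub_simps | (rule rel_app, assumption))+
lemma rel_Pred_app [rel_intros]: "cm \<Longrightarrow> rel s x \<Longrightarrow> rel (Pred \<cdot> s) (predM x)"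
  unfolding predM_def by (rule rel_app [OF rel_Pred])

lemma Monus_fv [simp]: "fv_tm Monus = {}"
  by (auto simp: Monus_def lam_simps)
lemmas [simp, sub_simps] = closed_simps [OF Monus_fv]
lemma Monus_ty [sem_intros]: "has_ty [] Monus (N \<rightarrow> N \<rightarrow> N)"
  unfolding Monus_def lam_simps Pos_def by (rule sem_intros)+
lemma rel_Monus: "cm \<Longrightarrow> rel Monus (\<lambda>s t. recM t s (\<lambda>v m. predM v))"
  unfolding Monus_def [unfolded lam_simps, simplified]
  by (rule rel_closed)
    (assumption | rule rel_bracket wts_Fr rel_intros sem_intros | simp only: sub_simps | (rule rel_app, assumption))+
lemma rel_Monus_app [rel_intros]: "cm \<Longrightarrow> rel s x \<Longrightarrow> rel t y \<Longrightarrow> rel (Monus \<cdot> s \<cdot> t) (x - y :: mnat)"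
  unfolding minus_rec by (rule rel_app2 [OF rel_Monus])

lemma Pow2_fv [simp]: "fv_tm Pow2 = {}"
  by (auto simp: Pow2_def lam_simps)
lemmas [simp, sub_simps] = closed_simps [OF Pow2_fv]
lemma Pow2_ty [sem_intros]: "has_ty [] Pow2 (N \<rightarrow> N)"
  unfolding Pow2_def lam_simps Pos_def by (rule sem_intros)+
lemma rel_Pow2: "cm \<Longrightarrow> rel Pow2 (\<lambda>t. recM t 1 (\<lambda>v m. v + v))"
  unfolding Pow2_def [unfolded lam_simps, simplified]
  by (rule rel_closed)
    (assumption | rule rel_bracket wts_Fr rel_intros sem_intros | simp only: sub_simps | (rule rel_app, assumption))+
lemma rel_Pow2_app [rel_intros]: "cm \<Longrightarrow> rel s x \<Longrightarrow> rel (Pow2 \<cdot> s) (pow2 x)"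
  unfolding pow2_def by (rule rel_app [OF rel_Pow2])

lemma Tri_fv [simp]: "fv_tm Tri = {}"
  by (auto simp: Tri_def lam_simps)
lemmas [simp, sub_simps] = closed_simps [OF Tri_fv]
lemma Tri_ty [sem_intros]: "has_ty [] Tri (N \<rightarrow> N)"
  unfolding Tri_def lam_simps Pos_def by (rule sem_intros)+
lemma rel_Tri: "cm \<Longrightarrow> rel Tri (\<lambda>t. recM t 0 (\<lambda>v m. v + sucM m))"
  unfolding Tri_def [unfolded lam_simps, simplified]
  by (rule rel_closed)
    (assumption | rule rel_bracket wts_Fr rel_intros sem_intros | simp only: sub_simps | (rule rel_app, assumption))+
lemma rel_Tri_app [rel_intros]: "cm \<Longrightarrow> rel s x \<Longrightarrow> rel (Tri \<cdot> s) (tri x)"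
  unfolding tri_def by (rule rel_app [OF rel_Tri])

lemma Pair_fv [simp]: "fv_tm Pair = {}"
  by (auto simp: Pair_def lam_simps)
lemmas [simp, sub_simps] = closed_simps [OF Pair_fv]
lemma Pair_ty [sem_intros]: "has_ty [] Pair (N \<rightarrow> N \<rightarrow> N)"
  unfolding Pair_def lam_simps Pos_def by (rule sem_intros)+
lemma rel_Pair: "cm \<Longrightarrow> rel Pair (\<lambda>s t. tri (s + t) + t)"
  unfolding Pair_def [unfolded lam_simps, simplified]
  by (rule rel_closed)
    (assumption | rule rel_bracket wts_Fr rel_intros sem_intros | simp only: sub_simps | (rule rel_app, assumption))+
lemma rel_Pair_app [rel_intros]: "cm \<Longrightarrow> rel s x \<Longrightarrow> rel t y \<Longrightarrow> rel (Pair \<cdot> s \<cdot> t) (pair x y)"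
  unfolding pair_def by (rule rel_app2 [OF rel_Pair])

lemma Tri_Root_fv [simp]: "fv_tm Tri_Root = {}"
  by (auto simp: Tri_Root_def lam_simps)
lemmas [simp, sub_simps] = closed_simps [OF Tri_Root_fv]
lemma Tri_Root_ty [sem_intros]: "has_ty [] Tri_Root (N \<rightarrow> N)"
  unfolding Tri_Root_def lam_simps Pos_def by (rule sem_intros)+
lemma rel_Tri_Root: "cm \<Longrightarrow> rel Tri_Root (\<lambda>t. recM t 0 (\<lambda>v m. v + (1 - (tri (sucM v) - sucM m))))"
  unfolding Tri_Root_def [unfolded lam_simps, simplified]
  by (rule rel_closed)
    (assumption | rule rel_bracket wts_Fr rel_intros sem_intros | simp only: sub_simps | (rule rel_app, assumption))+
lemma rel_Tri_Root_app [rel_intros]: "cm \<Longrightarrow> rel s x \<Longrightarrow> rel (Tri_Root \<cdot> s) (tri_root x)"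
  unfolding tri_root_def by (rule rel_app [OF rel_Tri_Root])

lemma Proj2_fv [simp]: "fv_tm Proj2 = {}"
  by (auto simp: Proj2_def lam_simps)
lemmas [simp, sub_simps] = closed_simps [OF Proj2_fv]
lemma Proj2_ty [sem_intros]: "has_ty [] Proj2 (N \<rightarrow> N)"
  unfolding Proj2_def lam_simps Pos_def by (rule sem_intros)+
lemma rel_Proj2: "cm \<Longrightarrow> rel Proj2 (\<lambda>t. t - tri (tri_root t))"
  unfolding Proj2_def [unfolded lam_simps, simplified]
  by (rule rel_closed)
    (assumption | rule rel_bracket wts_Fr rel_intros sem_intros | simp only: sub_simps | (rule rel_app, assumption))+
lemma rel_Proj2_app [rel_intros]: "cm \<Longrightarrow> rel s x \<Longrightarrow> rel (Proj2 \<cdot> s) (proj2 x)"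
  unfolding proj2_def by (rule rel_app [OF rel_Proj2])

lemma Proj1_fv [simp]: "fv_tm Proj1 = {}"
  by (auto simp: Proj1_def lam_simps)
lemmas [simp, sub_simps] = closed_simps [OF Proj1_fv]
lemma Proj1_ty [sem_intros]: "has_ty [] Proj1 (N \<rightarrow> N)"
  unfolding Proj1_def lam_simps Pos_def by (rule sem_intros)+
lemma rel_Proj1: "cm \<Longrightarrow> rel Proj1 (\<lambda>t. tri_root t - proj2 t)"
  unfolding Proj1_def [unfolded lam_simps, simplified]
  by (rule rel_closed)
    (assumption | rule rel_bracket wts_Fr rel_intros sem_intros | simp only: sub_simps | (rule rel_app, assumption))+
lemma rel_Proj1_app [rel_intros]: "cm \<Longrightarrow> rel s x \<Longrightarrow> rel (Proj1 \<cdot> s) (proj1 x)"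
  unfolding proj1_def by (rule rel_app [OF rel_Proj1])

lemma rel_app3: "rel t f \<Longrightarrow> rel s x \<Longrightarrow> rel u y \<Longrightarrow> rel v z \<Longrightarrow> rel (t \<cdot> s \<cdot> u \<cdot> v) (f x y z)"
  by (intro rel_app)

lemma Rat_fv [simp]: "fv_tm Rat = {}"
  by (auto simp: Rat_def lam_simps)
lemmas [simp, sub_simps] = closed_simps [OF Rat_fv]
lemma Rat_ty [sem_intros]: "has_ty [] Rat (N \<rightarrow> N \<rightarrow> N \<rightarrow> N)"
  unfolding Rat_def lam_simps Pos_def by (rule sem_intros)+
lemma rel_Rat: "cm \<Longrightarrow> rel Rat (\<lambda>a b d. pair a (pair b (predM d)))"
  unfolding Rat_def [unfolded lam_simps, simplified]
  by (rule rel_closed)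
    (assumption | rule rel_bracket wts_Fr rel_intros sem_intros | simp only: sub_simps | (rule rel_app, assumption))+
lemma rel_Rat_app [rel_intros]: "cm \<Longrightarrow> rel s x \<Longrightarrow> rel t y \<Longrightarrow> rel u z \<Longrightarrow> rel (Rat \<cdot> s \<cdot> t \<cdot> u) (ratM x y z)"
  unfolding ratM_def by (rule rel_app3 [OF rel_Rat])

lemmas [simp, sub_simps] = Pos_def

lemma Neg_Part_fv [simp]: "fv_tm Neg_Part = {}"
  by (auto simp: Neg_Part_def lam_simps)
lemmas [simp, sub_simps] = closed_simps [OF Neg_Part_fv]
lemma Neg_Part_ty [sem_intros]: "has_ty [] Neg_Part (N \<rightarrow> N)"
  unfolding Neg_Part_def lam_simps Pos_def by (rule sem_intros)+
lemma rel_Neg_Part: "cm \<Longrightarrow> rel Neg_Part (\<lambda>q. proj1 (proj2 q))"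
  unfolding Neg_Part_def [unfolded lam_simps, simplified]
  by (rule rel_closed)
    (assumption | rule rel_bracket wts_Fr rel_intros sem_intros | simp only: sub_simps | (rule rel_app, assumption))+
lemma rel_Neg_Part_app [rel_intros]: "cm \<Longrightarrow> rel s x \<Longrightarrow> rel (Neg_Part \<cdot> s) (negM x)"
  unfolding negM_def by (rule rel_app [OF rel_Neg_Part])

lemma Den_fv [simp]: "fv_tm Den = {}"
  by (auto simp: Den_def lam_simps)
lemmas [simp, sub_simps] = closed_simps [OF Den_fv]
lemma Den_ty [sem_intros]: "has_ty [] Den (N \<rightarrow> N)"
  unfolding Den_def lam_simps Pos_def by (rule sem_intros)+
lemma rel_Den: "cm \<Longrightarrow> rel Den (\<lambda>q. sucM (proj2 (proj2 q)))"
  unfolding Den_def [unfolded lam_simps, simplified]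
  by (rule rel_closed)
    (assumption | rule rel_bracket wts_Fr rel_intros sem_intros | simp only: sub_simps | (rule rel_app, assumption))+
lemma rel_Den_app [rel_intros]: "cm \<Longrightarrow> rel s x \<Longrightarrow> rel (Den \<cdot> s) (denM x)"
  unfolding denM_def by (rule rel_app [OF rel_Den])

lemma AddQ_fv [simp]: "fv_tm AddQ = {}"
  by (auto simp: AddQ_def lam_simps)
lemmas [simp, sub_simps] = closed_simps [OF AddQ_fv]
lemma AddQ_ty [sem_intros]: "has_ty [] AddQ (N \<rightarrow> N \<rightarrow> N)"
  unfolding AddQ_def lam_simps Pos_def by (rule sem_intros)+
lemma rel_AddQ: "cm \<Longrightarrow> rel AddQ (\<lambda>q r. ratM (proj1 q * denM r + proj1 r * denM q) (negM q * denM r + negM r * denM q) (denM q * denM r))"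
  unfolding AddQ_def [unfolded lam_simps, simplified]
  by (rule rel_closed)
    (assumption | rule rel_bracket wts_Fr rel_intros sem_intros | simp only: sub_simps | (rule rel_app, assumption))+
lemma rel_AddQ_app [rel_intros]: "cm \<Longrightarrow> rel s x \<Longrightarrow> rel t y \<Longrightarrow> rel (AddQ \<cdot> s \<cdot> t) (addq x y)"
  unfolding addq_def by (rule rel_app2 [OF rel_AddQ])

lemma UminusQ_fv [simp]: "fv_tm UminusQ = {}"
  by (auto simp: UminusQ_def lam_simps)
lemmas [simp, sub_simps] = closed_simps [OF UminusQ_fv]
lemma UminusQ_ty [sem_intros]: "has_ty [] UminusQ (N \<rightarrow> N)"
  unfolding UminusQ_def lam_simps Pos_def by (rule sem_intros)+
lemma rel_UminusQ: "cm \<Longrightarrow> rel UminusQ (\<lambda>q. ratM (negM q) (proj1 q) (denM q))"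
  unfolding UminusQ_def [unfolded lam_simps, simplified]
  by (rule rel_closed)
    (assumption | rule rel_bracket wts_Fr rel_intros sem_intros | simp only: sub_simps | (rule rel_app, assumption))+
lemma rel_UminusQ_app [rel_intros]: "cm \<Longrightarrow> rel s x \<Longrightarrow> rel (UminusQ \<cdot> s) (uminusq x)"
  unfolding uminusq_def by (rule rel_app [OF rel_UminusQ])

lemma AbsQ_fv [simp]: "fv_tm AbsQ = {}"
  by (auto simp: AbsQ_def lam_simps)
lemmas [simp, sub_simps] = closed_simps [OF AbsQ_fv]
lemma AbsQ_ty [sem_intros]: "has_ty [] AbsQ (N \<rightarrow> N)"
  unfolding AbsQ_def lam_simps Pos_def by (rule sem_intros)+
lemma rel_AbsQ: "cm \<Longrightarrow> rel AbsQ (\<lambda>q. ratM ((proj1 q - negM q) + (negM q - proj1 q)) 0 (denM q))"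
  unfolding AbsQ_def [unfolded lam_simps, simplified]
  by (rule rel_closed)
    (assumption | rule rel_bracket wts_Fr rel_intros sem_intros | simp only: sub_simps | (rule rel_app, assumption))+
lemma rel_AbsQ_app [rel_intros]: "cm \<Longrightarrow> rel s x \<Longrightarrow> rel (AbsQ \<cdot> s) (absq x)"
  unfolding absq_def by (rule rel_app [OF rel_AbsQ])

lemma Inv_Pow2_ty [sem_intros]: "has_ty [] Inv_Pow2 (N \<rightarrow> N)"
  unfolding Inv_Pow2_def lam_simps Pos_def by (rule sem_intros)+
lemma rel_Inv_Pow2: "cm \<Longrightarrow> rel Inv_Pow2 (\<lambda>n. ratM 1 0 (pow2 n))"
  unfolding Inv_Pow2_def [unfolded lam_simps, simplified]
  by (rule rel_closed)
    (assumption | rule rel_bracket wts_Fr rel_intros sem_intros | simp only: sub_simps | (rule rel_app, assumption))+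
lemma rel_Inv_Pow2_app [rel_intros]: "cm \<Longrightarrow> rel s x \<Longrightarrow> rel (Inv_Pow2 \<cdot> s) (inv_pow2 x)"
  unfolding inv_pow2_def by (rule rel_app [OF rel_Inv_Pow2])

lemma Of_Rat_ty [sem_intros]: "has_ty [] Of_Rat (N \<rightarrow> N \<rightarrow> N)"
  unfolding Of_Rat_def lam_simps Pos_def by (rule sem_intros)+
lemma rel_Of_Rat: "cm \<Longrightarrow> rel Of_Rat (\<lambda>(q :: mnat) (n :: mnat). q)"
  unfolding Of_Rat_def [unfolded lam_simps, simplified]
  by (rule rel_closed)
    (assumption | rule rel_bracket wts_Fr rel_intros sem_intros | simp only: sub_simps | (rule rel_app, assumption))+
lemma rel_Of_Rat_app [rel_intros]: "cm \<Longrightarrow> rel s x \<Longrightarrow> rel (Of_Rat \<cdot> s) (of_rat x)"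
  unfolding of_rat_def by (rule rel_app [OF rel_Of_Rat])

lemma AddR_fv [simp]: "fv_tm AddR = {}"
  by (auto simp: AddR_def lam_simps)
lemmas [simp, sub_simps] = closed_simps [OF AddR_fv]
lemma AddR_ty [sem_intros]: "has_ty [] AddR ((N \<rightarrow> N) \<rightarrow> (N \<rightarrow> N) \<rightarrow> N \<rightarrow> N)"
  unfolding AddR_def lam_simps Pos_def by (rule sem_intros)+
lemma rel_AddR: "cm \<Longrightarrow> rel AddR (\<lambda>(x :: mnat \<Rightarrow> mnat) y n. addq (x (sucM n)) (y (sucM n)))"
  unfolding AddR_def [unfolded lam_simps, simplified]
  by (rule rel_closed)
    (assumption | rule rel_bracket wts_Fr rel_intros sem_intros | simp only: sub_simps | (rule rel_app, assumption))+
lemma rel_AddR_app [rel_intros]: "cm \<Longrightarrow> rel s x \<Longrightarrow> rel t y \<Longrightarrow> rel (AddR \<cdot> s \<cdot> t) (addr x y)"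
  unfolding addr_def by (rule rel_app2 [OF rel_AddR])

lemma UminusR_fv [simp]: "fv_tm UminusR = {}"
  by (auto simp: UminusR_def lam_simps)
lemmas [simp, sub_simps] = closed_simps [OF UminusR_fv]
lemma UminusR_ty [sem_intros]: "has_ty [] UminusR ((N \<rightarrow> N) \<rightarrow> N \<rightarrow> N)"
  unfolding UminusR_def lam_simps Pos_def by (rule sem_intros)+
lemma rel_UminusR: "cm \<Longrightarrow> rel UminusR (\<lambda>(x :: mnat \<Rightarrow> mnat) n. uminusq (x n))"
  unfolding UminusR_def [unfolded lam_simps, simplified]
  by (rule rel_closed)
    (assumption | rule rel_bracket wts_Fr rel_intros sem_intros | simp only: sub_simps | (rule rel_app, assumption))+
lemma rel_UminusR_app [rel_intros]: "cm \<Longrightarrow> rel s x \<Longrightarrow> rel (UminusR \<cdot> s) (uminusr x)"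
  unfolding uminusr_def by (rule rel_app [OF rel_UminusR])

lemma AbsR_fv [simp]: "fv_tm AbsR = {}"
  by (auto simp: AbsR_def lam_simps)
lemmas [simp, sub_simps] = closed_simps [OF AbsR_fv]
lemma AbsR_ty [sem_intros]: "has_ty [] AbsR ((N \<rightarrow> N) \<rightarrow> N \<rightarrow> N)"
  unfolding AbsR_def lam_simps Pos_def by (rule sem_intros)+
lemma rel_AbsR: "cm \<Longrightarrow> rel AbsR (\<lambda>(x :: mnat \<Rightarrow> mnat) n. absq (x n))"
  unfolding AbsR_def [unfolded lam_simps, simplified]
  by (rule rel_closed)
    (assumption | rule rel_bracket wts_Fr rel_intros sem_intros | simp only: sub_simps | (rule rel_app, assumption))+
lemma rel_AbsR_app [rel_intros]: "cm \<Longrightarrow> rel s x \<Longrightarrow> rel (AbsR \<cdot> s) (absr x)"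
  unfolding absr_def by (rule rel_app [OF rel_AbsR])

lemma DistR_ty [sem_intros]: "has_ty [] DistR ((N \<rightarrow> N) \<rightarrow> (N \<rightarrow> N) \<rightarrow> N \<rightarrow> N)"
  unfolding DistR_def lam_simps Pos_def by (rule sem_intros)+
lemma rel_DistR: "cm \<Longrightarrow> rel DistR (\<lambda>x y. absr (addr x (uminusr y)))"
  unfolding DistR_def [unfolded lam_simps, simplified]
  by (rule rel_closed)
    (assumption | rule rel_bracket wts_Fr rel_intros sem_intros | simp only: sub_simps | (rule rel_app, assumption))+
lemma rel_DistR_app [rel_intros]: "cm \<Longrightarrow> rel s x \<Longrightarrow> rel t y \<Longrightarrow> rel (DistR \<cdot> s \<cdot> t) (distr x y)"
  unfolding distr_def by (rule rel_app2 [OF rel_DistR])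


section \<open>Meaning of the formulas\<close>

lemmas [sem_intros] = rel_intros

text \<open>Resolution with the following trivial fact restricts a simplifier call to goals of this form.\<close>

lemma rel_goal: "rel t x \<Longrightarrow> rel t x" .

text \<open>Beyond \<open>means_all\<close>, the body may use that applications of \<open>t\<close>
  denote applications of \<open>x\<close>. There is one rule per type, since unification does not
  invert \<open>tyc\<close>.\<close>

lemma means_all1':
  assumes "cm" "uniform_fm [N \<rightarrow> N] (\<lambda>ts. F (hd ts))" "\<And>t x. rel t x \<Longrightarrow> (\<And>s y. rel s y \<Longrightarrow> rel (t \<cdot> s) (x y)) \<Longrightarrow> means (F t) (P x)"
  shows "means (all (N \<rightarrow> N) F) (\<forall>x :: mnat \<Rightarrow> mnat. intl x \<longrightarrow> P x)"
proof -
  have "means (F t) (P x)" if r: "rel t x" for t x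
    by (rule assms(3) [OF r]; rule rel_app [OF r], assumption+)
  then show ?thesis using means_all [where 'a = "mnat \<Rightarrow> mnat", of F P] assms(1,2) by simp
qed
lemma means_all011':
  assumes "cm" "uniform_fm [N \<rightarrow> N \<rightarrow> N] (\<lambda>ts. F (hd ts))" "\<And>t x. rel t x \<Longrightarrow> (\<And>s y. rel s y \<Longrightarrow> rel (t \<cdot> s) (x y)) \<Longrightarrow> (\<And>s y u z. rel s y \<Longrightarrow> rel u z \<Longrightarrow> rel (t \<cdot> s \<cdot> u) (x y z)) \<Longrightarrow> means (F t) (P x)"
  shows "means (all (N \<rightarrow> N \<rightarrow> N) F) (\<forall>x :: mnat \<Rightarrow> mnat \<Rightarrow> mnat. intl x \<longrightarrow> P x)"
proof -
  have "means (F t) (P x)" if r: "rel t x" for t x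
    by (rule assms(3) [OF r]; rule rel_app [OF r] rel_app2 [OF r], assumption+)
  then show ?thesis using means_all [where 'a = "mnat \<Rightarrow> mnat \<Rightarrow> mnat", of F P] assms(1,2) by simp
qed
lemma rel_ty2: "rel t (x :: (mnat \<Rightarrow> mnat) \<Rightarrow> mnat) \<Longrightarrow> has_ty [] t ((N \<rightarrow> N) \<rightarrow> N)"
  by (drule rel_ty) simp
lemma means_all2':
  assumes "cm" "uniform_fm [(N \<rightarrow> N) \<rightarrow> N] (\<lambda>ts. F (hd ts))" "\<And>t x. rel t x \<Longrightarrow> (\<And>s y. rel s y \<Longrightarrow> rel (t \<cdot> s) (x y)) \<Longrightarrow> means (F t) (P x)"
  shows "means (all ((N \<rightarrow> N) \<rightarrow> N) F) (\<forall>x :: (mnat \<Rightarrow> mnat) \<Rightarrow> mnat. intl x \<longrightarrow> P x)"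
proof -
  have "means (F t) (P x)" if r: "rel t x" for t x
    by (rule assms(3) [OF r]; rule rel_app [OF r], assumption+)
  then show ?thesis using means_all [where 'a = "(mnat \<Rightarrow> mnat) \<Rightarrow> mnat", of F P] assms(1,2) by simp
qed
lemma rel_ty3: "rel t (x :: ((mnat \<Rightarrow> mnat) \<Rightarrow> mnat) \<Rightarrow> mnat) \<Longrightarrow> has_ty [] t (((N \<rightarrow> N) \<rightarrow> N) \<rightarrow> N)"
  by (drule rel_ty) simp
lemma means_all3':
  assumes "cm" "uniform_fm [((N \<rightarrow> N) \<rightarrow> N) \<rightarrow> N] (\<lambda>ts. F (hd ts))" "\<And>t x. rel t x \<Longrightarrow> (\<And>s y. rel s y \<Longrightarrow> rel (t \<cdot> s) (x y)) \<Longrightarrow> means (F t) (P x)"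
  shows "means (all (((N \<rightarrow> N) \<rightarrow> N) \<rightarrow> N) F) (\<forall>x :: ((mnat \<Rightarrow> mnat) \<Rightarrow> mnat) \<Rightarrow> mnat. intl x \<longrightarrow> P x)"
proof -
  have "means (F t) (P x)" if r: "rel t x" for t x
    by (rule assms(3) [OF r]; rule rel_app [OF r], assumption+)
  then show ?thesis using means_all [where 'a = "((mnat \<Rightarrow> mnat) \<Rightarrow> mnat) \<Rightarrow> mnat", of F P] assms(1,2) by simp
qed
lemma rel_ty11: "rel t (x :: (mnat \<Rightarrow> mnat) \<Rightarrow> mnat \<Rightarrow> mnat) \<Longrightarrow> has_ty [] t ((N \<rightarrow> N) \<rightarrow> N \<rightarrow> N)"
  by (drule rel_ty) simp
lemma means_all11':
  assumes "cm" "uniform_fm [(N \<rightarrow> N) \<rightarrow> N \<rightarrow> N] (\<lambda>ts. F (hd ts))" "\<And>t x. rel t x \<Longrightarrow> (\<And>s y. rel s y \<Longrightarrow> rel (t \<cdot> s) (x y)) \<Longrightarrow> (\<And>s y u z. rel s y \<Longrightarrow> rel u z \<Longrightarrow> rel (t \<cdot> s \<cdot> u) (x y z)) \<Longrightarrow> means (F t) (P x)"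
  shows "means (all ((N \<rightarrow> N) \<rightarrow> N \<rightarrow> N) F) (\<forall>x :: (mnat \<Rightarrow> mnat) \<Rightarrow> mnat \<Rightarrow> mnat. intl x \<longrightarrow> P x)"
proof -
  have "means (F t) (P x)" if r: "rel t x" for t x
    by (rule assms(3) [OF r]; rule rel_app [OF r] rel_app2 [OF r], assumption+)
  then show ?thesis using means_all [where 'a = "(mnat \<Rightarrow> mnat) \<Rightarrow> mnat \<Rightarrow> mnat", of F P] assms(1,2) by simp
qed
lemma rel_ty02: "rel t (x :: mnat \<Rightarrow> (mnat \<Rightarrow> mnat) \<Rightarrow> mnat) \<Longrightarrow> has_ty [] t (N \<rightarrow> (N \<rightarrow> N) \<rightarrow> N)"
  by (drule rel_ty) simp
lemma means_all02':
  assumes "cm" "uniform_fm [N \<rightarrow> (N \<rightarrow> N) \<rightarrow> N] (\<lambda>ts. F (hd ts))" "\<And>t x. rel t x \<Longrightarrow> (\<And>s y. rel s y \<Longrightarrow> rel (t \<cdot> s) (x y)) \<Longrightarrow> (\<And>s y u z. rel s y \<Longrightarrow> rel u z \<Longrightarrow> rel (t \<cdot> s \<cdot> u) (x y z)) \<Longrightarrow> means (F t) (P x)"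
  shows "means (all (N \<rightarrow> (N \<rightarrow> N) \<rightarrow> N) F) (\<forall>x :: mnat \<Rightarrow> (mnat \<Rightarrow> mnat) \<Rightarrow> mnat. intl x \<longrightarrow> P x)"
proof -
  have "means (F t) (P x)" if r: "rel t x" for t x
    by (rule assms(3) [OF r]; rule rel_app [OF r] rel_app2 [OF r], assumption+)
  then show ?thesis using means_all [where 'a = "mnat \<Rightarrow> (mnat \<Rightarrow> mnat) \<Rightarrow> mnat", of F P] assms(1,2) by simp
qed

lemmas rel_tys = rel_ty0 rel_ty1 rel_ty011 rel_ty2 rel_ty3 rel_ty11 rel_ty02
lemmas [sem_intros] = means_Fls means_Imp means_Neg means_Conj means_Iff means_eq0 means_all0 means_all1' means_all011' means_all2' means_all3' means_all11' means_all02'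

lemma means_ex0 [sem_intros]:
  assumes "cm" "uniform_fm [N] (\<lambda>ts. F (hd ts))" "\<And>t x. rel t x \<Longrightarrow> means (F t) (P x)"
  shows "means (ex (N) F) (\<exists>x :: mnat. P x)"
  unfolding ex_def by (rule means_cong, rule means_Neg, rule assms, rule means_all0 [where P = "\<lambda>x. \<not> P x"], rule assms,
    rule uniform_fm_Neg, rule assms, rule means_Neg, rule assms, erule assms) auto
lemma means_ex1 [sem_intros]:
  assumes "cm" "uniform_fm [N \<rightarrow> N] (\<lambda>ts. F (hd ts))" "\<And>t x. rel t x \<Longrightarrow> (\<And>s y. rel s y \<Longrightarrow> rel (t \<cdot> s) (x y)) \<Longrightarrow> means (F t) (P x)"
  shows "means (ex (N \<rightarrow> N) F) (\<exists>x :: mnat \<Rightarrow> mnat. intl x \<and> P x)"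
  unfolding ex_def by (rule means_cong, rule means_Neg, rule assms, rule means_all1' [where P = "\<lambda>x. \<not> P x"], rule assms,
    rule uniform_fm_Neg, rule assms, rule means_Neg, rule assms, rule assms, assumption+) auto
lemma means_ex011 [sem_intros]:
  assumes "cm" "uniform_fm [N \<rightarrow> N \<rightarrow> N] (\<lambda>ts. F (hd ts))" "\<And>t x. rel t x \<Longrightarrow> (\<And>s y. rel s y \<Longrightarrow> rel (t \<cdot> s) (x y)) \<Longrightarrow> (\<And>s y u z. rel s y \<Longrightarrow> rel u z \<Longrightarrow> rel (t \<cdot> s \<cdot> u) (x y z)) \<Longrightarrow> means (F t) (P x)"
  shows "means (ex (N \<rightarrow> N \<rightarrow> N) F) (\<exists>x :: mnat \<Rightarrow> mnat \<Rightarrow> mnat. intl x \<and> P x)"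
  unfolding ex_def by (rule means_cong, rule means_Neg, rule assms, rule means_all011' [where P = "\<lambda>x. \<not> P x"], rule assms,
    rule uniform_fm_Neg, rule assms, rule means_Neg, rule assms, rule assms, assumption+) auto
lemma means_ex2 [sem_intros]:
  assumes "cm" "uniform_fm [(N \<rightarrow> N) \<rightarrow> N] (\<lambda>ts. F (hd ts))" "\<And>t x. rel t x \<Longrightarrow> (\<And>s y. rel s y \<Longrightarrow> rel (t \<cdot> s) (x y)) \<Longrightarrow> means (F t) (P x)"
  shows "means (ex ((N \<rightarrow> N) \<rightarrow> N) F) (\<exists>x :: (mnat \<Rightarrow> mnat) \<Rightarrow> mnat. intl x \<and> P x)"
  unfolding ex_def by (rule means_cong, rule means_Neg, rule assms, rule means_all2' [where P = "\<lambda>x. \<not> P x"], rule assms,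
    rule uniform_fm_Neg, rule assms, rule means_Neg, rule assms, rule assms, assumption+) auto
lemma uniform_fm_le [sem_intros]: "uniform_tm \<Delta> f (N) \<Longrightarrow> uniform_tm \<Delta> g (N) \<Longrightarrow> uniform_fm \<Delta> (\<lambda>ts. le (f ts) (g ts))"
  unfolding le_def by (assumption | rule sem_intros)+
lemma means_le [sem_intros]:
  assumes cm: cm and r0: "rel s (x :: mnat)" and r1: "rel t (y :: mnat)"
  shows "means (le s t) (x \<le> y)"
  unfolding le_def mnat_le_iff
  by (insert cm r0 r1) (assumption | erule rel_tys | rule  sem_intros | (rule rel_goal, (simp only: rel_intros; fail)))+
lemma uniform_fm_less [sem_intros]: "uniform_tm \<Delta> f (N) \<Longrightarrow> uniform_tm \<Delta> g (N) \<Longrightarrow> uniform_fm \<Delta> (\<lambda>ts. less (f ts) (g ts))"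
  unfolding less_def by (assumption | rule sem_intros)+
lemma means_less [sem_intros]:
  assumes cm: cm and r0: "rel s (x :: mnat)" and r1: "rel t (y :: mnat)"
  shows "means (less s t) (x < y)"
  unfolding less_def less_iff_leM
  by (insert cm r0 r1) (assumption | erule rel_tys | rule  sem_intros | (rule rel_goal, (simp only: rel_intros; fail)))+
lemma uniform_fm_leQ [sem_intros]: "uniform_tm \<Delta> f (N) \<Longrightarrow> uniform_tm \<Delta> g (N) \<Longrightarrow> uniform_fm \<Delta> (\<lambda>ts. leQ (f ts) (g ts))"
  unfolding leQ_def Pos_def by (assumption | rule sem_intros)+
lemma means_leQ [sem_intros]:
  assumes cm: cm and r0: "rel s (x :: mnat)" and r1: "rel t (y :: mnat)"
  shows "means (leQ s t) (qv x \<le> qv y)"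
  unfolding leQ_def Pos_def leq_iff [symmetric] leq_def
  by (insert cm r0 r1) (assumption | erule rel_tys | rule  sem_intros | (rule rel_goal, (simp only: rel_intros; fail)))+
lemma uniform_fm_lessQ [sem_intros]: "uniform_tm \<Delta> f (N) \<Longrightarrow> uniform_tm \<Delta> g (N) \<Longrightarrow> uniform_fm \<Delta> (\<lambda>ts. lessQ (f ts) (g ts))"
  unfolding lessQ_def Pos_def by (assumption | rule sem_intros)+
lemma means_lessQ [sem_intros]:
  assumes cm: cm and r0: "rel s (x :: mnat)" and r1: "rel t (y :: mnat)"
  shows "means (lessQ s t) (qv x < qv y)"
  unfolding lessQ_def Pos_def lessq_iff [symmetric] lessq_def
  by (insert cm r0 r1) (assumption | erule rel_tys | rule  sem_intros | (rule rel_goal, (simp only: rel_intros; fail)))+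

type_synonym mreal = "mnat \<Rightarrow> mnat"

text \<open>Reals stay sequences of codes instead of classes modulo \<open>eqr\<close>, because
  internal functionals act on sequences and need not respect \<open>eqr\<close>.\<close>

definition isreal :: "mreal \<Rightarrow> bool" where "isreal x \<longleftrightarrow> (\<forall>n i. \<bar>qv (x n) - qv (x (n + i))\<bar> < eps n)"
definition eqr :: "mreal \<Rightarrow> mreal \<Rightarrow> bool" where "eqr x y \<longleftrightarrow> (\<forall>n. \<bar>qv (x n) - qv (y n)\<bar> \<le> eps n + eps n)"
definition ler :: "mreal \<Rightarrow> mreal \<Rightarrow> bool" where "ler x y \<longleftrightarrow> (\<forall>n. qv (x n) \<le> qv (y n) + (eps n + eps n))"
definition lessr :: "mreal \<Rightarrow> mreal \<Rightarrow> bool" where "lessr x y \<longleftrightarrow> \<not> ler y x"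
definition inball :: "mreal \<Rightarrow> mreal \<Rightarrow> mreal \<Rightarrow> bool" where "inball x y r \<longleftrightarrow> lessr (distr x y) r"
definition zeror :: mreal where "zeror = of_rat (ratM 0 0 1)"
definition oner :: mreal where "oner = of_rat (ratM 1 0 1)"
definition inunit :: "mreal \<Rightarrow> bool" where "inunit x \<longleftrightarrow> isreal x \<and> ler zeror x \<and> ler x oner"

lemma uniform_fm_is_real [sem_intros]: "uniform_tm \<Delta> f (N \<rightarrow> N) \<Longrightarrow> uniform_fm \<Delta> (\<lambda>ts. is_real (f ts))"
  unfolding is_real_def by (assumption | rule sem_intros)+
lemma means_is_real [sem_intros]:
  assumes cm: cm and r0: "rel t (x :: mreal)"
  shows "means (is_real t) (isreal x)"
proof (rule means_cong)
  show "means (is_real t) (\<forall>n i. qv (absq (addq (x n) (uminusq (x (n + i))))) < qv (inv_pow2 n))"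
    unfolding is_real_def
    by (insert cm r0) (assumption | erule rel_tys | rule rel_app [OF r0] sem_intros | (rule rel_goal, (simp only: rel_intros; fail)))+
qed (simp add: isreal_def)
lemma uniform_fm_eqR [sem_intros]: "uniform_tm \<Delta> f (N \<rightarrow> N) \<Longrightarrow> uniform_tm \<Delta> g (N \<rightarrow> N) \<Longrightarrow> uniform_fm \<Delta> (\<lambda>ts. eqR (f ts) (g ts))"
  unfolding eqR_def by (assumption | rule sem_intros)+
lemma means_eqR [sem_intros]:
  assumes cm: cm and r0: "rel s (x :: mreal)" and r1: "rel t (y :: mreal)"
  shows "means (eqR s t) (eqr x y)"
proof (rule means_cong)
  show "means (eqR s t) (\<forall>n. qv (absq (addq (x n) (uminusq (y n)))) \<le> qv (addq (inv_pow2 n) (inv_pow2 n)))"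
    unfolding eqR_def
    by (insert cm r0 r1) (assumption | erule rel_tys | rule rel_app [OF r0] rel_app [OF r1] sem_intros | (rule rel_goal, (simp only: rel_intros; fail)))+
qed (simp add: eqr_def)
lemma uniform_fm_leR [sem_intros]: "uniform_tm \<Delta> f (N \<rightarrow> N) \<Longrightarrow> uniform_tm \<Delta> g (N \<rightarrow> N) \<Longrightarrow> uniform_fm \<Delta> (\<lambda>ts. leR (f ts) (g ts))"
  unfolding leR_def by (assumption | rule sem_intros)+
lemma means_leR [sem_intros]:
  assumes cm: cm and r0: "rel s (x :: mreal)" and r1: "rel t (y :: mreal)"
  shows "means (leR s t) (ler x y)"
proof (rule means_cong)
  show "means (leR s t) (\<forall>n. qv (x n) \<le> qv (addq (y n) (addq (inv_pow2 n) (inv_pow2 n))))"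
    unfolding leR_def
    by (insert cm r0 r1) (assumption | erule rel_tys | rule rel_app [OF r0] rel_app [OF r1] sem_intros | (rule rel_goal, (simp only: rel_intros; fail)))+
qed (simp add: ler_def)
lemma uniform_fm_lessR [sem_intros]: "uniform_tm \<Delta> f (N \<rightarrow> N) \<Longrightarrow> uniform_tm \<Delta> g (N \<rightarrow> N) \<Longrightarrow> uniform_fm \<Delta> (\<lambda>ts. lessR (f ts) (g ts))"
  unfolding lessR_def by (assumption | rule sem_intros)+
lemma means_lessR [sem_intros]:
  assumes cm: cm and r0: "rel s (x :: mreal)" and r1: "rel t (y :: mreal)"
  shows "means (lessR s t) (lessr x y)"
  unfolding lessR_def lessr_def
  by (insert cm r0 r1) (assumption | erule rel_tys | rule rel_app [OF r0] rel_app [OF r1] sem_intros | (rule rel_goal, (simp only: rel_intros; fail)))+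
lemma uniform_fm_in_ball [sem_intros]: "uniform_tm \<Delta> f (N \<rightarrow> N) \<Longrightarrow> uniform_tm \<Delta> g (N \<rightarrow> N) \<Longrightarrow> uniform_tm \<Delta> h (N \<rightarrow> N) \<Longrightarrow> uniform_fm \<Delta> (\<lambda>ts. in_ball (f ts) (g ts) (h ts))"
  unfolding in_ball_def by (assumption | rule sem_intros)+
lemma means_in_ball [sem_intros]:
  assumes cm: cm and r0: "rel s (x :: mreal)" and r1: "rel t (y :: mreal)" and r2: "rel u (r :: mreal)"
  shows "means (in_ball s t u) (inball x y r)"
  unfolding in_ball_def inball_def
  by (insert cm r0 r1 r2) (assumption | erule rel_tys | rule rel_app [OF r0] rel_app [OF r1] rel_app [OF r2] sem_intros | (rule rel_goal, (simp only: rel_intros; fail)))+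
lemma uniform_fm_in_unit [sem_intros]: "uniform_tm \<Delta> f (N \<rightarrow> N) \<Longrightarrow> uniform_fm \<Delta> (\<lambda>ts. in_unit (f ts))"
  unfolding in_unit_def by (assumption | rule sem_intros)+
lemma means_in_unit [sem_intros]:
  assumes cm: cm and r0: "rel t (x :: mreal)"
  shows "means (in_unit t) (inunit x)"
  unfolding in_unit_def inunit_def zeror_def oner_def
  by (insert cm r0) (assumption | erule rel_tys | rule rel_app [OF r0] sem_intros | (rule rel_goal, (simp only: rel_intros; fail)))+
lemma uniform_fm_allR [sem_intros]: "uniform_fm ((N \<rightarrow> N) # \<Delta>) (\<lambda>ts. F (tl ts) (hd ts)) \<Longrightarrow> uniform_fm \<Delta> (\<lambda>ts. Defs.allR (F ts))"
  unfolding Defs.allR_def by (assumption | rule sem_intros)+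
lemma means_allR [sem_intros]:
  assumes "cm" "uniform_fm [N \<rightarrow> N] (\<lambda>ts. F (hd ts))"
    "\<And>t x. rel t x \<Longrightarrow> (\<And>s y. rel s y \<Longrightarrow> rel (t \<cdot> s) (x y)) \<Longrightarrow> means (F t) (P x)"
  shows "means (Defs.allR F) (\<forall>x :: mreal. intl x \<longrightarrow> isreal x \<longrightarrow> P x)"
  unfolding Defs.allR_def by (insert assms(1)) (assumption | rule assms(2,3) sem_intros)+
lemma uniform_fm_allI [sem_intros]: "uniform_fm ((N \<rightarrow> N) # \<Delta>) (\<lambda>ts. F (tl ts) (hd ts)) \<Longrightarrow> uniform_fm \<Delta> (\<lambda>ts. Defs.allI (F ts))"
  unfolding Defs.allI_def by (assumption | rule sem_intros)+
lemma means_allI [sem_intros]: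
  assumes "cm" "uniform_fm [N \<rightarrow> N] (\<lambda>ts. F (hd ts))"
    "\<And>t x. rel t x \<Longrightarrow> (\<And>s y. rel s y \<Longrightarrow> rel (t \<cdot> s) (x y)) \<Longrightarrow> means (F t) (P x)"
  shows "means (Defs.allI F) (\<forall>x :: mreal. intl x \<longrightarrow> inunit x \<longrightarrow> P x)"
  unfolding Defs.allI_def by (insert assms(1)) (assumption | rule assms(2,3) sem_intros)+

lemma means_exists2: "cm \<Longrightarrow> means exists2 (\<exists>\<phi> :: mreal \<Rightarrow> mnat. intl \<phi> \<and> (\<forall>f. intl f \<longrightarrow> \<phi> f \<le> 1) \<and>
    (\<forall>f. intl f \<longrightarrow> ((\<exists>n. f n = 0) \<longleftrightarrow> \<phi> f = 0)))"
  unfolding exists2_def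
  by (assumption | erule rel_tys | rule sem_intros | (rule rel_goal, (simp only: rel_intros; fail)))+

definition cantor :: "mreal \<Rightarrow> bool" where "cantor f \<longleftrightarrow> (\<forall>n. f n \<le> 1)"

lemma uniform_fm_in_cantor [sem_intros]: "uniform_tm \<Delta> f (N \<rightarrow> N) \<Longrightarrow> uniform_fm \<Delta> (\<lambda>ts. in_cantor (f ts))"
  unfolding in_cantor_def by (assumption | rule sem_intros)+
lemma means_in_cantor [sem_intros]:
  assumes cm: cm and r0: "rel t (x :: mreal)"
  shows "means (in_cantor t) (cantor x)"
  unfolding in_cantor_def cantor_def
  by (insert cm r0) (assumption | erule rel_tys | rule rel_app [OF r0] sem_intros | (rule rel_goal, (simp only: rel_intros; fail)))+

lemma means_eq1 [sem_intros]:
  assumes cm: cm and r: "rel s (x :: mreal)" "rel t y"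
  shows "means (eq (N \<rightarrow> N) s t) (\<forall>n. x n = y n)"
  unfolding eq.simps
  by (insert cm r) (assumption | erule rel_tys | rule sem_intros rel_app [OF r(1)] rel_app [OF r(2)] sem_intros)+

text \<open>Function quantifiers are guarded by \<open>intl\<close>; number quantifiers are not,
  since every \<open>mnat\<close> is internal.\<close>

definition IND0M :: bool where
  "IND0M \<longleftrightarrow> (\<forall>Y :: mreal \<Rightarrow> mnat \<Rightarrow> mnat. intl Y \<longrightarrow>
     (\<forall>n f. intl f \<longrightarrow> (\<forall>g. intl g \<longrightarrow> cantor f \<and> cantor g \<and> Y f n = 0 \<and> Y g n = 0 \<longrightarrow> (\<forall>n. f n = g n))) \<longrightarrow>
     (\<forall>k. \<exists>l. \<exists>w :: mnat \<Rightarrow> mreal. intl w \<and> (\<forall>m. m \<le> k \<longrightarrow>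
        ((\<exists>i. i < l \<and> cantor (w i) \<and> Y (w i) m = 0) \<longleftrightarrow> (\<exists>f. intl f \<and> cantor f \<and> Y f m = 0)))))"

lemma means_IND0: "cm \<Longrightarrow> means IND0 IND0M"
  unfolding IND0_def IND0M_def
  by (assumption | erule rel_tys | rule sem_intros | (rule rel_goal, (simp only: rel_intros; fail)))+

lemma means_NIN: "cm \<Longrightarrow> means NIN (\<not> (\<exists>Y :: mreal \<Rightarrow> mnat. intl Y \<and>
     (\<forall>x. intl x \<longrightarrow> inunit x \<longrightarrow> (\<forall>y. intl y \<longrightarrow> inunit y \<longrightarrow> eqr x y \<longrightarrow> Y x = Y y)) \<and>
     (\<forall>x. intl x \<longrightarrow> inunit x \<longrightarrow> (\<forall>y. intl y \<longrightarrow> inunit y \<longrightarrow> Y x = Y y \<longrightarrow> eqr x y))))"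
  unfolding NIN_def
  by (assumption | erule rel_tys | rule sem_intros | (rule rel_goal, (simp only: rel_intros; fail)))+

section \<open>Meaning of gauges, subcovers, semi-continuity and Borel sets\<close>

definition gaugeM :: "(mreal \<Rightarrow> mreal) \<Rightarrow> bool" where
  "gaugeM \<Psi> \<longleftrightarrow> (\<forall>x. intl x \<longrightarrow> inunit x \<longrightarrow> isreal (\<Psi> x) \<and> lessr zeror (\<Psi> x)) \<and>
     (\<forall>x. intl x \<longrightarrow> inunit x \<longrightarrow> (\<forall>y. intl y \<longrightarrow> inunit y \<longrightarrow> eqr x y \<longrightarrow> eqr (\<Psi> x) (\<Psi> y)))"

definition subcoverM :: "(mreal \<Rightarrow> mreal) \<Rightarrow> bool" where
  "subcoverM \<Psi> \<longleftrightarrow> (\<exists>k. \<exists>y :: mnat \<Rightarrow> mreal. intl y \<and> (\<forall>i. i \<le> k \<longrightarrow> inunit (y i)) \<and>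
     (\<forall>x. intl x \<longrightarrow> inunit x \<longrightarrow> (\<exists>i. i \<le> k \<and> inball x (y i) (\<Psi> (y i)))))"

definition uscM :: "(mreal \<Rightarrow> mreal) \<Rightarrow> bool" where
  "uscM \<Psi> \<longleftrightarrow> (\<forall>x0. intl x0 \<longrightarrow> inunit x0 \<longrightarrow> (\<forall>k. \<exists>n. \<forall>x. intl x \<longrightarrow> inunit x \<longrightarrow>
     lessr zeror (distr x x0) \<and> lessr (distr x x0) (of_rat (inv_pow2 n)) \<longrightarrow>
     ler (\<Psi> x) (addr (\<Psi> x0) (of_rat (inv_pow2 k)))))"

definition setM :: "(mreal \<Rightarrow> mnat) \<Rightarrow> bool" where
  "setM E \<longleftrightarrow> (\<forall>x. intl x \<longrightarrow> isreal x \<longrightarrow> E x \<le> 1) \<and>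
     (\<forall>x. intl x \<longrightarrow> isreal x \<longrightarrow> (\<forall>y. intl y \<longrightarrow> isreal y \<longrightarrow> eqr x y \<longrightarrow> E x = E y))"

definition openM :: "(mreal \<Rightarrow> mnat) \<Rightarrow> bool" where
  "openM E \<longleftrightarrow> (\<forall>x. intl x \<longrightarrow> isreal x \<longrightarrow> E x = 1 \<longrightarrow> (\<exists>n. \<forall>y. intl y \<longrightarrow> isreal y \<longrightarrow>
     inball y x (of_rat (inv_pow2 n)) \<longrightarrow> E y = 1))"

definition sigmaM :: "((mreal \<Rightarrow> mnat) \<Rightarrow> mnat) \<Rightarrow> bool" where
  "sigmaM S \<longleftrightarrow> (\<forall>E. intl E \<longrightarrow> setM E \<and> openM E \<longrightarrow> S E = 1) \<and>
     (\<forall>E. intl E \<longrightarrow> (\<forall>D. intl D \<longrightarrow> setM E \<and> setM D \<and> S E = 1 \<and>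
        (\<forall>x. intl x \<longrightarrow> isreal x \<longrightarrow> (D x = 1 \<longleftrightarrow> \<not> E x = 1)) \<longrightarrow> S D = 1)) \<and>
     (\<forall>E :: mnat \<Rightarrow> mreal \<Rightarrow> mnat. intl E \<longrightarrow> (\<forall>D. intl D \<longrightarrow> (\<forall>n. setM (E n) \<and> S (E n) = 1) \<and> setM D \<and>
        (\<forall>x. intl x \<longrightarrow> isreal x \<longrightarrow> (D x = 1 \<longleftrightarrow> (\<exists>n. E n x = 1))) \<longrightarrow> S D = 1))"

definition borelM :: "(mreal \<Rightarrow> mnat) \<Rightarrow> bool" where
  "borelM E \<longleftrightarrow> setM E \<and> (\<forall>S. intl S \<longrightarrow> sigmaM S \<longrightarrow> S E = 1)"

definition borelfunM :: "(mreal \<Rightarrow> mreal) \<Rightarrow> bool" where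
  "borelfunM \<Psi> \<longleftrightarrow> (\<forall>a. intl a \<longrightarrow> isreal a \<longrightarrow> (\<exists>E. intl E \<and> borelM E \<and>
     (\<forall>x. intl x \<longrightarrow> isreal x \<longrightarrow> (E x = 1 \<longleftrightarrow> inunit x \<and> lessr a (\<Psi> x)))))"

lemma uniform_fm_gauge [sem_intros]: "uniform_tm \<Delta> f ((N \<rightarrow> N) \<rightarrow> N \<rightarrow> N) \<Longrightarrow> uniform_fm \<Delta> (\<lambda>ts. gauge (f ts))"
  unfolding gauge_def by (assumption | rule sem_intros)+
lemma means_gauge [sem_intros]:
  assumes cm: cm and r0: "rel t (\<Psi> :: mreal \<Rightarrow> mreal)"
  shows "means (gauge t) (gaugeM \<Psi>)"
  unfolding gauge_def gaugeM_def zeror_def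
  by (insert cm r0) (assumption | erule rel_tys | rule rel_app [OF r0] sem_intros | (rule rel_goal, (simp only: rel_intros; fail)))+
lemma uniform_fm_has_finite_subcover [sem_intros]: "uniform_tm \<Delta> f ((N \<rightarrow> N) \<rightarrow> N \<rightarrow> N) \<Longrightarrow> uniform_fm \<Delta> (\<lambda>ts. has_finite_subcover (f ts))"
  unfolding has_finite_subcover_def by (assumption | rule sem_intros)+
lemma means_has_finite_subcover [sem_intros]:
  assumes cm: cm and r0: "rel t (\<Psi> :: mreal \<Rightarrow> mreal)"
  shows "means (has_finite_subcover t) (subcoverM \<Psi>)"
  unfolding has_finite_subcover_def subcoverM_def
  by (insert cm r0) (assumption | erule rel_tys | rule rel_app [OF r0] sem_intros | (rule rel_goal, (simp only: rel_intros; fail)))+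
lemma uniform_fm_upper_semicontinuous [sem_intros]: "uniform_tm \<Delta> f ((N \<rightarrow> N) \<rightarrow> N \<rightarrow> N) \<Longrightarrow> uniform_fm \<Delta> (\<lambda>ts. upper_semicontinuous (f ts))"
  unfolding upper_semicontinuous_def limsup_le_def by (assumption | rule sem_intros)+
lemma means_upper_semicontinuous [sem_intros]:
  assumes cm: cm and r0: "rel t (\<Psi> :: mreal \<Rightarrow> mreal)"
  shows "means (upper_semicontinuous t) (uscM \<Psi>)"
  unfolding upper_semicontinuous_def limsup_le_def uscM_def zeror_def
  by (insert cm r0) (assumption | erule rel_tys | rule rel_app [OF r0] sem_intros | (rule rel_goal, (simp only: rel_intros; fail)))+
lemma uniform_fm_is_setR [sem_intros]: "uniform_tm \<Delta> f ((N \<rightarrow> N) \<rightarrow> N) \<Longrightarrow> uniform_fm \<Delta> (\<lambda>ts. is_setR (f ts))"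
  unfolding is_setR_def by (assumption | rule sem_intros)+
lemma means_is_setR [sem_intros]:
  assumes cm: cm and r0: "rel t (E :: mreal \<Rightarrow> mnat)"
  shows "means (is_setR t) (setM E)"
  unfolding is_setR_def setM_def
  by (insert cm r0) (assumption | erule rel_tys | rule rel_app [OF r0] sem_intros | (rule rel_goal, (simp only: rel_intros; fail)))+
lemma uniform_fm_mem [sem_intros]: "uniform_tm \<Delta> f (N \<rightarrow> N) \<Longrightarrow> uniform_tm \<Delta> g ((N \<rightarrow> N) \<rightarrow> N) \<Longrightarrow> uniform_fm \<Delta> (\<lambda>ts. mem (f ts) (g ts))"
  unfolding mem_def by (assumption | rule sem_intros)+
lemma uniform_fm_is_open [sem_intros]: "uniform_tm \<Delta> f ((N \<rightarrow> N) \<rightarrow> N) \<Longrightarrow> uniform_fm \<Delta> (\<lambda>ts. is_open (f ts))"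
  unfolding is_open_def by (assumption | rule sem_intros)+
lemma means_is_open [sem_intros]:
  assumes cm: cm and r0: "rel t (E :: mreal \<Rightarrow> mnat)"
  shows "means (is_open t) (openM E)"
  unfolding is_open_def openM_def mem_def
  by (insert cm r0) (assumption | erule rel_tys | rule rel_app [OF r0] sem_intros | (rule rel_goal, (simp only: rel_intros; fail)))+
lemma uniform_fm_sigma [sem_intros]: "uniform_tm \<Delta> f (((N \<rightarrow> N) \<rightarrow> N) \<rightarrow> N) \<Longrightarrow> uniform_fm \<Delta> (\<lambda>ts. sigma_algebra_of_opens (f ts))"
  unfolding sigma_algebra_of_opens_def by (assumption | rule sem_intros)+
lemma means_sigma [sem_intros]:
  assumes cm: cm and r0: "rel t (S :: (mreal \<Rightarrow> mnat) \<Rightarrow> mnat)"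
  shows "means (sigma_algebra_of_opens t) (sigmaM S)"
  unfolding sigma_algebra_of_opens_def sigmaM_def mem_def
  by (insert cm r0) (assumption | erule rel_tys | rule rel_app [OF r0] sem_intros | (rule rel_goal, (simp only: rel_intros; fail)))+
lemma uniform_fm_is_borel_set [sem_intros]: "uniform_tm \<Delta> f ((N \<rightarrow> N) \<rightarrow> N) \<Longrightarrow> uniform_fm \<Delta> (\<lambda>ts. is_borel_set (f ts))"
  unfolding is_borel_set_def by (assumption | rule sem_intros)+
lemma means_is_borel_set [sem_intros]:
  assumes cm: cm and r0: "rel t (E :: mreal \<Rightarrow> mnat)"
  shows "means (is_borel_set t) (borelM E)"
  unfolding is_borel_set_def borelM_def mem_def
  by (insert cm r0) (assumption | erule rel_tys | rule rel_app [OF r0] sem_intros | (rule rel_goal, (simp only: rel_intros; fail)))+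
lemma uniform_fm_is_borel_function [sem_intros]: "uniform_tm \<Delta> f ((N \<rightarrow> N) \<rightarrow> N \<rightarrow> N) \<Longrightarrow> uniform_fm \<Delta> (\<lambda>ts. is_borel_function (f ts))"
  unfolding is_borel_function_def by (assumption | rule sem_intros)+
lemma means_is_borel_function [sem_intros]:
  assumes cm: cm and r0: "rel t (\<Psi> :: mreal \<Rightarrow> mreal)"
  shows "means (is_borel_function t) (borelfunM \<Psi>)"
  unfolding is_borel_function_def borelfunM_def mem_def
  by (insert cm r0) (assumption | erule rel_tys | rule rel_app [OF r0] sem_intros | (rule rel_goal, (simp only: rel_intros; fail)))+

lemma means_HBU_semi: "cm \<Longrightarrow> means HBU_semi (\<forall>\<Psi>. intl \<Psi> \<longrightarrow> gaugeM \<Psi> \<and> uscM \<Psi> \<longrightarrow> subcoverM \<Psi>)"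
  unfolding HBU_semi_def
  by (assumption | erule rel_tys | rule sem_intros | (rule rel_goal, (simp only: rel_intros; fail)))+

lemma means_HBU_Borel: "cm \<Longrightarrow> means HBU_Borel (\<forall>\<Psi>. intl \<Psi> \<longrightarrow> gaugeM \<Psi> \<and> borelfunM \<Psi> \<longrightarrow> subcoverM \<Psi>)"
  unfolding HBU_Borel_def
  by (assumption | erule rel_tys | rule sem_intros | (rule rel_goal, (simp only: rel_intros; fail)))+

lemma uniform_fm_principles: "uniform_fm [] (\<lambda>_. HBU_semi)" "uniform_fm [] (\<lambda>_. HBU_Borel)" "uniform_fm [] (\<lambda>_. NIN)" "uniform_fm [] (\<lambda>_. IND0)"
  unfolding HBU_semi_def HBU_Borel_def NIN_def IND0_def by (assumption | rule sem_intros)+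


section \<open>Arithmetical comprehension\<close>

text \<open>Only contexts denoted by terms matter. There the values of internal functions are
  internal, and it is for internal functions that the axioms make their claims.\<close>

lemma intlc_cong:
  assumes "intlc f" "\<And>ts c. crel ts c \<Longrightarrow> f c = g c" shows "intlc g"
  using assms unfolding intlc_def by metis

lemma intlc_intl: "intlc f \<Longrightarrow> crel ts c \<Longrightarrow> intl (f c)"
  unfolding intlc_def intl_def by blast

lemma exists2_functional:
  assumes cm shows "\<exists>\<phi> :: mreal \<Rightarrow> mnat. intl \<phi> \<and> (\<forall>f. intl f \<longrightarrow> ((\<exists>n. f n = 0) \<longleftrightarrow> \<phi> f = 0))"
proof -
  have "exists2 \<in> ACA0\<omega>" by (simp add: ACA0\<omega>_def)
  from means_axiom [OF assms this means_exists2 [OF assms]] show ?thesis by (elim exE conjE) (intro exI conjI)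
qed

text \<open>Arithmetical comprehension: the functional from \<open>exists2\<close>, applied to the
  section of \<open>P\<close>, decides the number quantifier.\<close>

lemma intlc_ex [intlc_intros]:
  fixes P :: "'c::mctx \<Rightarrow> mnat \<Rightarrow> bool"
  assumes P: "intlc (\<lambda>d. chi (P (snd d) (fst d)))" shows "intlc (\<lambda>c. chi (\<exists>n. P c n))"
proof (cases cm)
  case True
  from exists2_functional [OF this] obtain \<phi> :: "mreal \<Rightarrow> mnat"
    where \<phi>: "intl \<phi>" "\<And>f. intl f \<Longrightarrow> (\<exists>n. f n = 0) \<longleftrightarrow> \<phi> f = 0" by blast
  have P': "intlc (\<lambda>c n. chi (P c n))" by (rule intlc_lam) (rule P)
  then have "intlc (\<lambda>c. chi (\<phi> (\<lambda>n. chi (P c n)) = 0))" by (intro intlc_intros intlc_comp [OF \<phi>(1)])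
  then show ?thesis
  proof (rule intlc_cong)
    fix ts and c :: 'c assume "crel ts c"
    from \<phi>(2) [OF intlc_intl [OF P' this]]
    show "chi (\<phi> (\<lambda>n. chi (P c n)) = 0) = chi (\<exists>n. P c n)" by simp
  qed
qed (simp add: intlc_def)

lemma intlc_all [intlc_intros]:
  fixes P :: "'c::mctx \<Rightarrow> mnat \<Rightarrow> bool"
  assumes P: "intlc (\<lambda>d. chi (P (snd d) (fst d)))" shows "intlc (\<lambda>c. chi (\<forall>n. P c n))"
proof -
  have "intlc (\<lambda>c. chi (\<not> (\<exists>n. \<not> P c n)))" by (intro intlc_intros P)
  then show ?thesis by simp
qed

lemma all_cong: "(\<And>x. lc x \<Longrightarrow> F x = G x) \<Longrightarrow> all \<rho> F = all \<rho> G"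
  by (simp add: all_def)

lemma ex_cong:
  assumes "\<And>x. lc x \<Longrightarrow> F x = G x" shows "ex \<rho> F = ex \<rho> G"
proof -
  have "all \<rho> (\<lambda>x. \<^bold>\<not> F x) = all \<rho> (\<lambda>x. \<^bold>\<not> G x)" by (rule all_cong) (simp add: assms)
  then show ?thesis by (simp add: ex_def)
qed

text \<open>Quantifier-free choice for the matrix "if \<open>\<phi> f = 0\<close> then
  \<open>f n = 0\<close>", with the functional from \<open>exists2\<close> as a parameter. A
  suitable n always exists, because \<open>\<phi> f = 0\<close> means that f has a zero.\<close>

lemma exists_mu:
  assumes cm: cm
  shows "\<exists>\<mu> :: mreal \<Rightarrow> mnat. intl \<mu> \<and> (\<forall>f. intl f \<longrightarrow> (\<exists>n. f n = 0) \<longrightarrow> f (\<mu> f) = 0)"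
proof -
  from exists2_functional [OF cm] obtain \<phi> :: "mreal \<Rightarrow> mnat"
    where \<phi>: "intl \<phi>" "\<And>f. intl f \<Longrightarrow> (\<exists>n. f n = 0) \<longleftrightarrow> \<phi> f = 0" by blast
  then obtain \<Phi> where \<Phi>: "rel \<Phi> \<phi>" using cm unfolding intl_def by blast
  note ty = rel_ty2 [OF \<Phi>]
  have lc: "lc \<Phi>" using ty by (rule has_ty_lc) simp
  let ?\<chi> = "Imp (Eq (\<Phi> \<cdot> Bd 1) Zero) (Eq (Bd 1 \<cdot> Bd 0) Zero)"
  let ?F = "\<lambda>f n. Imp (Eq (\<Phi> \<cdot> f) Zero) (Eq (f \<cdot> n) Zero)"
  have bd: "has_ty [N, ty1] (Bd 0) N" "has_ty [N, ty1] (Bd 1) ty1"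
    using has_ty.intros(1) [of 0 "[N, ty1]"] has_ty.intros(1) [of 1 "[N, ty1]"] by simp_all
  have "wf_fm [N, ty1] ?\<chi>"
    using bd has_ty_weaken [OF ty refl] by (auto intro: has_ty.intros)
  then have "((\<^bold>\<forall>\<^sup>1 f. \<^bold>\<exists>\<^sup>0 n. inst_fm 1 f (inst_fm 0 n ?\<chi>))
       \<^bold>\<longrightarrow> (\<^bold>\<exists>\<^sup>2 Y. \<^bold>\<forall>\<^sup>1 f. inst_fm 1 f (inst_fm 0 (Y \<cdot> f) ?\<chi>))) \<in> QF_AC10"
    unfolding QF_AC10_def by (intro CollectI exI [of _ ?\<chi>] conjI refl) simp_all
  moreover have "(\<^bold>\<forall>\<^sup>1 f. \<^bold>\<exists>\<^sup>0 n. inst_fm 1 f (inst_fm 0 n ?\<chi>)) = (\<^bold>\<forall>\<^sup>1 f. \<^bold>\<exists>\<^sup>0 n. ?F f n)"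
    using lc by (intro all_cong ex_cong) simp
  moreover have "(\<^bold>\<exists>\<^sup>2 Y. \<^bold>\<forall>\<^sup>1 f. inst_fm 1 f (inst_fm 0 (Y \<cdot> f) ?\<chi>)) = (\<^bold>\<exists>\<^sup>2 Y. \<^bold>\<forall>\<^sup>1 f. ?F f (Y \<cdot> f))"
    using lc by (intro all_cong ex_cong) simp
  ultimately have "((\<^bold>\<forall>\<^sup>1 f. \<^bold>\<exists>\<^sup>0 n. ?F f n) \<^bold>\<longrightarrow> (\<^bold>\<exists>\<^sup>2 Y. \<^bold>\<forall>\<^sup>1 f. ?F f (Y \<cdot> f))) \<in> ACA0\<omega>"
    unfolding ACA0\<omega>_def RCA0\<omega>_def by simp
  moreover have "means ((\<^bold>\<forall>\<^sup>1 f. \<^bold>\<exists>\<^sup>0 n. ?F f n) \<^bold>\<longrightarrow> (\<^bold>\<exists>\<^sup>2 Y. \<^bold>\<forall>\<^sup>1 f. ?F f (Y \<cdot> f)))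
    ((\<forall>f. intl f \<longrightarrow> (\<exists>n. \<phi> f = 0 \<longrightarrow> f n = 0)) \<longrightarrow>
      (\<exists>\<mu>. intl \<mu> \<and> (\<forall>f. intl f \<longrightarrow> \<phi> f = 0 \<longrightarrow> f (\<mu> f) = 0)))"
    by (insert cm \<Phi>)
      (assumption | erule rel_tys | rule rel_app [OF \<Phi>] sem_intros
        | (rule rel_goal, (simp only: rel_intros; fail)))+
  ultimately have "(\<forall>f. intl f \<longrightarrow> (\<exists>n. \<phi> f = 0 \<longrightarrow> f n = 0)) \<longrightarrow>
      (\<exists>\<mu> :: mreal \<Rightarrow> mnat. intl \<mu> \<and> (\<forall>f. intl f \<longrightarrow> \<phi> f = 0 \<longrightarrow> f (\<mu> f) = 0))"
    by (rule means_axiom [OF cm])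
  then show ?thesis using \<phi>(2) by metis
qed


section \<open>Reals of the countermodel\<close>

lemma real_close: "isreal x \<Longrightarrow> n \<le> m \<Longrightarrow> \<bar>qv (x n) - qv (x m)\<bar> < eps n"
  unfolding isreal_def by (auto simp: le_iff_addM)

lemma qv_of_rat [simp]: "qv (of_rat q n) = qv q"
  by (simp add: of_rat_def)

lemma qv_zeror [simp]: "qv (zeror n) = 0" and qv_oner [simp]: "qv (oner n) = 1"
  by (simp_all add: zeror_def oner_def qv_ratM)

lemma qv_distr [simp]: "qv (distr x y n) = \<bar>qv (x (n + 1)) - qv (y (n + 1))\<bar>"
  by (simp add: distr_def absr_def addr_def uminusr_def sucM_conv)

lemma qv_addr [simp]: "qv (addr x y n) = qv (x (n + 1)) + qv (y (n + 1))"
  by (simp add: addr_def sucM_conv)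

lemma isreal_of_rat [simp]: "isreal (of_rat q)"
  by (simp add: isreal_def)

lemma eqr_sym: "eqr x y \<Longrightarrow> eqr y x"
  by (simp add: eqr_def abs_minus_commute)

lemma eps_halves: "eps (n + 1) + eps (n + 1) = eps n"
  by (simp add: eps_suc)

lemma intlc_of_rat [intlc_intros]: "intlc f \<Longrightarrow> intlc (\<lambda>c. of_rat (f c))"
  unfolding of_rat_def by (rule intlc_lam) (rule intlc_snd)

lemma intl_of_rat: "intl (of_rat q)"
  by (rule intlc_closed) (intro intlc_intros)

text \<open>Strictness is witnessed at a single index \<open>m\<close>. The shift to
  \<open>m + 1\<close> comes from the addition of reals, the summand \<open>eps m + eps m\<close>
  from the tolerance in \<open>ler\<close>.\<close>

lemma inball_rat:
  "inball x y (of_rat q) \<longleftrightarrow> (\<exists>m. \<bar>qv (x (m + 1)) - qv (y (m + 1))\<bar> + (eps m + eps m) < qv q)"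
  by (simp add: inball_def lessr_def ler_def not_le)

lemma inunit_real: "inunit x \<Longrightarrow> isreal x"
  by (simp add: inunit_def)

text \<open>Since \<open>eps\<close> is a power of two, the exponent is doubled to give 4^(-Y x -
  1). The constant sequence is a real at once.\<close>

definition gauge_of :: "(mreal \<Rightarrow> mnat) \<Rightarrow> mreal \<Rightarrow> mreal" where
  "gauge_of Y x = of_rat (inv_pow2 (Y x + Y x + 1 + 1))"

lemma intl_gauge_of: "intl Y \<Longrightarrow> intl (gauge_of Y)"
  unfolding gauge_of_def [abs_def] by (rule intl_funI) (intro intlc_intros intlc_comp [of Y])

lemma gauge_of_gauge:
  assumes "\<And>x y. intl x \<Longrightarrow> inunit x \<Longrightarrow> intl y \<Longrightarrow> inunit y \<Longrightarrow> eqr x y \<Longrightarrow> Y x = Y y"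
  shows "gaugeM (gauge_of Y)"
proof -
  have "lessr zeror (of_rat (inv_pow2 m))" for m
  proof -
    \<comment> \<open>Positivity shows at index m + 2, where the tolerance of \<open>ler\<close> is
      only half of 2^(-m).\<close>
    have "eps (m + 1 + 1) + eps (m + 1 + 1) < eps m"
      using eps_halves [of m] eps_halves [of "m + 1"] eps_gt_0 [of "m + 1"] by linarith
    then show ?thesis unfolding lessr_def ler_def not_all by (intro exI [of _ "m + 1 + 1"]) simp
  qed
  moreover have "eqr x x" for x by (simp add: eqr_def)
  ultimately show ?thesis
    unfolding gaugeM_def gauge_of_def by (intro conjI allI impI isreal_of_rat) (metis assms)+
qed


section \<open>A point outside the balls\<close>

text \<open>
  Nested intervals: at stage \<open>n\<close> the interval \<open>[v / 4\<^sup>n, (v + 1) / 4\<^sup>n]\<close> is replaced by its leftmost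
  or rightmost quarter, whichever avoids the ball of radius \<open>4\<^sup>-\<^sup>n\<^sup>-\<^sup>1\<close> around the point numbered \<open>n\<close>.
\<close>

theorem no_subcover:
  assumes Y: "intl Y"
    and inj: "\<And>x y. intl x \<Longrightarrow> inunit x \<Longrightarrow> intl y \<Longrightarrow> inunit y \<Longrightarrow> Y x = Y y \<Longrightarrow> eqr x y"
  shows "\<not> subcoverM (gauge_of Y)"
proof
  assume "subcoverM (gauge_of Y)"
  then obtain k and y :: "mnat \<Rightarrow> mreal" where y: "intl y" "\<And>i. i \<le> k \<Longrightarrow> inunit (y i)"
    and cover: "\<And>x. intl x \<Longrightarrow> inunit x \<Longrightarrow> \<exists>i. i \<le> k \<and> inball x (y i) (gauge_of Y (y i))"
    unfolding subcoverM_def by blast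
  note Yc = intlc_comp [OF Y] and yc = intlc_app [OF intlc_comp [OF y(1)]] and yc1 = intlc_comp [OF y(1)]
  \<comment> \<open>The rational v / 4^m.\<close>
  define q where "q v m = ratM v 0 (pow2 (m + m))" for v m
  have qv_q: "qv (q v m) = emb v * eps (m + m)" for v m
    by (simp add: q_def qv_ratM eps_def)
  have q_intl: "intlc f \<Longrightarrow> intlc g \<Longrightarrow> intlc (\<lambda>c. q (f c) (g c))" for f g :: "'c::mctx \<Rightarrow> mnat"
    unfolding q_def by (intro intlc_intros)
  \<comment> \<open>The right quarter is taken if a centre numbered m lies strictly left of the
    midpoint (4v + 2) / 4^(m+1). Only the centres of the given subcover are consulted, which keeps
    the condition arithmetical.\<close>
  define right where "right v m \<longleftrightarrow> (\<exists>i. i \<le> k \<and> Y (y i) = m \<and>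
      (\<exists>n. qv (addq (y i n) (addq (inv_pow2 n) (inv_pow2 n))) < qv (q (v + v + v + v + 1 + 1) (m + 1))))" for v m
  define g where "g v m = (if right v m then v + v + v + v + 1 + 1 + 1 else v + v + v + v)" for v m
  \<comment> \<open>The dummy only names the type of the remaining context, so that the fact is
    available for every context.\<close>
  have g: "intlc (\<lambda>d :: mnat \<times> mnat \<times> 'c. g (fst (snd d)) (fst d))" for dummy :: "'c::mctx"
    unfolding g_def right_def by (intro intlc_intros Yc yc yc1 q_intl)
  define V where "V n = recM n 0 g" for n
  have V_intl: "intlc f \<Longrightarrow> intlc (\<lambda>c. V (f c))" for f :: "'c::mctx \<Rightarrow> mnat"
    unfolding V_def by (rule intlc_rec, assumption, rule intlc_const0)
      (rule intlc_app [OF intlc_app [OF intlc_const]], rule intl_fun2I, rule g, (rule intlc_intros)+)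
  have V0: "V 0 = 0" unfolding V_def by (intro recM_0 intl_fun2I g)
  have VS: "V (n + 1) = g (V n) n" for n
    unfolding V_def sucM_conv [symmetric] by (rule recM_Suc) (rule g)
  define a where "a n = qv (q (V n) n)" for n
  define mid where "mid n = qv (q (V n + V n + V n + V n + 1 + 1) (n + 1))" for n
  \<comment> \<open>Both the radius of the balls whose centre has number n and a quarter of the
    length of the interval at stage n.\<close>
  define r where "r n = eps (n + n + 1 + 1)" for n
  have r: "eps (n + n) = 4 * r n" "0 < r n" for n
    using eps_halves [of "n + n"] eps_halves [of "n + n + 1"] by (simp_all add: r_def)
  have r': "eps (n + 1 + (n + 1)) = r n" for n by (simp add: r_def ac_simps)
  have mid: "mid n = a n + 2 * r n" for n
    unfolding mid_def a_def qv_q r' [of n] r(1) [of n] by (simp add: algebra_simps)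
  have aS: "a (n + 1) = (if right (V n) n then mid n + r n else mid n - 2 * r n)" for n
    unfolding mid unfolding a_def VS qv_q r' [of n] r(1) [of n] g_def by (simp add: algebra_simps)
  have bounds: "a n \<le> a (n + j) \<and> a (n + j) + eps (n + j + (n + j)) \<le> a n + eps (n + n)" for n j
  proof -
    \<comment> \<open>The nesting is phrased with codes so that the induction on \<open>j\<close> is
      internal.\<close>
    have "qv (q (V n) n) \<le> qv (q (V (n + j)) (n + j)) \<and>
        qv (addq (q (V (n + j)) (n + j)) (inv_pow2 (n + j + (n + j)))) \<le> qv (addq (q (V n) n) (inv_pow2 (n + n)))"
    proof (induction j rule: internal_induct)
      case (Suc j)
      have "a (n + j) \<le> a (n + (j + 1))" "a (n + (j + 1)) + eps (n + (j + 1) + (n + (j + 1))) \<le> a (n + j) + eps (n + j + (n + j))"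
        using aS [of "n + j"] mid [of "n + j"] r [of "n + j"] r' [of "n + j"] by (simp_all add: add.assoc split: if_splits)
      then show ?case using Suc unfolding a_def by auto
    qed (intro intlc_intros q_intl V_intl, simp)
    then show ?thesis by (simp add: a_def)
  qed
  \<comment> \<open>The number of centres may be nonstandard, so a bound on their numbers is found
    by internal induction; the predicate is arithmetical.\<close>
  have "\<exists>K. \<forall>i. i \<le> k \<longrightarrow> Y (y i) < K"
  proof (induction k rule: internal_induct)
    case 0
    show ?case by (rule exI [of _ "Y (y 0) + 1"]) (metis antisym less_add_one mnat_ge_0)
  next
    case (Suc k)
    then obtain K where K: "\<forall>i. i \<le> k \<longrightarrow> Y (y i) < K" by blast
    show ?case
    proof (intro exI allI impI)
      fix i assume "i \<le> k + 1"
      then have "i \<le> k \<or> i = k + 1" by (metis antisym mnat_less_iff not_le)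
      then show "Y (y i) < K + (Y (y (k + 1)) + 1)"
      proof
        assume "i \<le> k"
        with K have "Y (y i) < K" by blast
        then show ?thesis by (rule less_le_trans) (simp add: add_increasing2)
      next
        assume "i = k + 1"
        then show ?thesis by (simp add: add_increasing mnat_less_iff)
      qed
    qed
  qed (intro intlc_intros Yc yc yc1)
  then obtain K where K: "\<And>i. i \<le> k \<Longrightarrow> Y (y i) < K" by blast
  \<comment> \<open>By stage \<open>K\<close> all centres have been avoided, so the left endpoint
    reached there is already uncovered.\<close>
  define p where "p = of_rat (q (V K) K)"
  have p: "qv (p n) = a K" for n by (simp add: p_def a_def)
  have "a 0 = 0" by (simp add: a_def V0 qv_q)
  then have "0 \<le> a K" "a K + eps (K + K) \<le> 1" using bounds [of 0 K] by auto
  then have "0 \<le> a K" "a K \<le> 1" using eps_ge_0 [of "K + K"] by linarith+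
  then have "inunit p" unfolding inunit_def ler_def by (auto simp: p add_nonneg_nonneg add_increasing2 p_def [symmetric]) (simp add: p_def)
  moreover have "intl p" unfolding p_def by (rule intl_of_rat)
  ultimately obtain i where i: "i \<le> k" "inball p (y i) (gauge_of Y (y i))" using cover by blast
  define n where "n = Y (y i)"
  obtain j where j: "K = n + 1 + j" using K [OF i(1)] unfolding n_def mnat_less_iff le_iff_addM by blast
  \<comment> \<open>The uncovered point lies in the quarter chosen at stage n.\<close>
  from bounds [of "n + 1" j] have aK: "a (n + 1) \<le> a K" "a K \<le> a (n + 1) + r n"
    using eps_ge_0 [of "n + 1 + j + (n + 1 + j)"] r' [of n] unfolding j by linarith+
  from i(2) obtain m where m: "\<bar>a K - qv (y i (m + 1))\<bar> + (eps m + eps m) < r n"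
    unfolding gauge_of_def inball_rat by (auto simp: p r_def n_def)
  have real: "isreal (y i)" using y i inunit_real by blast
  show False
  proof (cases "right (V n) n")
    case False
    \<comment> \<open>The centre is not left of the midpoint, whereas the point is at most
      \<open>mid n - r n\<close>; their distance is at least the radius.\<close>
    then have "mid n \<le> qv (y i (m + 1)) + (eps (m + 1) + eps (m + 1))"
      using i unfolding right_def mid_def n_def by (metis not_le qv_addq qv_inv_pow2)
    moreover have "a (n + 1) = mid n - 2 * r n" using aS [of n] False by simp
    ultimately show False using m aK r(2) [of n] eps_gt_0 [of m] eps_halves [of m] by linarith
  next
    case True
    \<comment> \<open>The centre left of the midpoint need not be \<open>y i\<close>, but it has the
      same number and by injectivity is the same real. The point is at least
      \<open>mid n + r n\<close>.\<close>
    then obtain i' l where i': "i' \<le> k" "Y (y i') = n" "qv (y i' l) + (eps l + eps l) < mid n"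
      unfolding right_def mid_def by auto
    have real': "isreal (y i')" using y i' inunit_real by blast
    have "eqr (y i) (y i')" using inj i' i y intl_app intl_mnat n_def by metis
    \<comment> \<open>A common later index, at which the two sequences for this real are
      compared.\<close>
    define h where "h = l + (m + 1)"
    from \<open>eqr (y i) (y i')\<close> have "\<bar>qv (y i h) - qv (y i' h)\<bar> \<le> eps h + eps h" unfolding eqr_def by blast
    moreover have "\<bar>qv (y i' l) - qv (y i' h)\<bar> < eps l"
      using real_close [OF real'] by (simp add: h_def)
    moreover have "\<bar>qv (y i (m + 1)) - qv (y i h)\<bar> < eps (m + 1)"
      using real_close [OF real] by (simp add: h_def)
    moreover have "eps h \<le> eps (m + 1)" by (rule eps_antimono) (simp add: h_def)
    moreover have "a (n + 1) = mid n + r n" using aS [of n] True by simp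
    ultimately show False
      using m aK i'(3) eps_gt_0 [of l] eps_gt_0 [of m] eps_halves [of m] by linarith
  qed
qed


section \<open>Apartness\<close>

text \<open>At index j a real is known up to 2^(-j), so for reals the inequality witnesses a
  distance greater than 2^(-n).\<close>

definition apart :: "mreal \<Rightarrow> mreal \<Rightarrow> mnat \<Rightarrow> bool" where
  "apart x y n \<longleftrightarrow> (\<exists>j. eps j + eps j + eps n < \<bar>qv (x j) - qv (y j)\<bar>)"

lemma apart_mono: "apart x y n \<Longrightarrow> n \<le> m \<Longrightarrow> apart x y m"
  unfolding apart_def using eps_antimono [of n m] by (meson add_left_mono le_less_trans)

lemma not_eqr_apart:
  assumes "\<not> eqr x y" shows "\<exists>n. apart x y n"
proof -
  obtain j where "eps j + eps j < \<bar>qv (x j) - qv (y j)\<bar>" using assms by (auto simp: eqr_def not_le)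
  then obtain n where "eps n < \<bar>qv (x j) - qv (y j)\<bar> - (eps j + eps j)"
    using eps_archimedean [of "\<bar>qv (x j) - qv (y j)\<bar> - (eps j + eps j)"] by auto
  then have "eps j + eps j + eps n < \<bar>qv (x j) - qv (y j)\<bar>" by linarith
  then show ?thesis unfolding apart_def by blast
qed

text \<open>Triangle inequality at an index beyond both witnesses: z cannot be near x and equal to y
  across the gap between x and y.\<close>

lemma apart_not_inball:
  assumes real: "isreal x" "isreal y" "isreal z" and xy: "apart x y n" and zy: "eqr z y"
  shows "\<not> inball z x (of_rat (inv_pow2 n))"
proof
  assume "inball z x (of_rat (inv_pow2 n))"
  then obtain m where m: "\<bar>qv (z (m + 1)) - qv (x (m + 1))\<bar> + (eps m + eps m) < eps n"
    unfolding inball_rat by auto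
  from xy obtain j where j: "eps j + eps j + eps n < \<bar>qv (x j) - qv (y j)\<bar>" unfolding apart_def by blast
  define p where "p = m + 1 + j"
  have "\<bar>qv (x j) - qv (x p)\<bar> < eps j" "\<bar>qv (y j) - qv (y p)\<bar> < eps j"
    "\<bar>qv (z (m + 1)) - qv (z p)\<bar> < eps (m + 1)" "\<bar>qv (x (m + 1)) - qv (x p)\<bar> < eps (m + 1)"
    using real by (auto intro!: real_close simp: p_def)
  moreover have "\<bar>qv (z p) - qv (y p)\<bar> \<le> eps p + eps p" using zy unfolding eqr_def by blast
  moreover have "eps p \<le> eps (m + 1)" by (rule eps_antimono) (simp add: p_def)
  ultimately show False using m j eps_halves [of m] by linarith
qed

text \<open>Passing from y at n to x at n + 2 costs 2^(-n) + 2^(-n-1), and the bound on x there has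
  tolerance 2^(-n-1). The sum is 2 * 2^(-n), exactly the tolerance of \<open>ler\<close> at
  n.\<close>

lemma inunit_eqr:
  assumes x: "inunit x" and y: "isreal y" and xy: "eqr x y" shows "inunit y"
proof -
  have *: "qv (y n) < qv (x (n + 1 + 1)) + (eps n + eps n) \<and> qv (x (n + 1 + 1)) < qv (y n) + (eps n + eps n) \<and>
      qv (y n) < qv (x (n + 1 + 1)) + eps n + eps (n + 1) \<and> qv (x (n + 1 + 1)) < qv (y n) + eps n + eps (n + 1)" for n
  proof -
    have "\<bar>qv (y n) - qv (y (n + 1 + 1))\<bar> < eps n" using y by (auto intro!: real_close simp: add.assoc)
    moreover have "\<bar>qv (x (n + 1 + 1)) - qv (y (n + 1 + 1))\<bar> \<le> eps (n + 1 + 1) + eps (n + 1 + 1)"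
      using xy unfolding eqr_def by blast
    ultimately show ?thesis using eps_halves [of n] eps_halves [of "n + 1"] eps_gt_0 [of "n + 1"] by linarith
  qed
  have le: "0 \<le> qv (x n) + (eps n + eps n)" "qv (x n) \<le> 1 + (eps n + eps n)" for n
    using x unfolding inunit_def ler_def by auto
  have "0 \<le> qv (y n) + (eps n + eps n) \<and> qv (y n) \<le> 1 + (eps n + eps n)" for n
    using * [of n] le [of "n + 1 + 1"] eps_halves [of n] eps_halves [of "n + 1"] by linarith
  then show ?thesis using y unfolding inunit_def ler_def by auto
qed

lemma intlc_ler [intlc_intros]:
  fixes f :: "'c::mctx \<Rightarrow> mreal"
  assumes "intlc f" "intlc g" shows "intlc (\<lambda>c. chi (ler (f c) (g c)))"
proof -
  have *: "ler x y \<longleftrightarrow> (\<forall>n. qv (x n) \<le> qv (addq (y n) (addq (inv_pow2 n) (inv_pow2 n))))" for x y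
    by (simp add: ler_def)
  show ?thesis unfolding * by (intro intlc_intros intlc_app [OF intlc_snd [OF assms(1)]] intlc_app [OF intlc_snd [OF assms(2)]])
qed

lemma intlc_isreal [intlc_intros]:
  fixes f :: "'c::mctx \<Rightarrow> mreal"
  assumes "intlc f" shows "intlc (\<lambda>c. chi (isreal (f c)))"
proof -
  have *: "isreal x \<longleftrightarrow> (\<forall>n i. qv (absq (addq (x n) (uminusq (x (n + i))))) < qv (inv_pow2 n))" for x
    by (simp add: isreal_def)
  show ?thesis unfolding * by (intro intlc_intros intlc_app [OF intlc_snd [OF intlc_snd [OF assms(1)]]])
qed

lemma intlc_inunit [intlc_intros]:
  fixes f :: "'c::mctx \<Rightarrow> mreal"
  assumes "intlc f" shows "intlc (\<lambda>c. chi (inunit (f c)))"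
  unfolding inunit_def zeror_def oner_def by (intro intlc_intros assms)

lemma intlc_apart [intlc_intros]:
  fixes f :: "'c::mctx \<Rightarrow> mreal"
  assumes "intlc f" "intlc g" "intlc h" shows "intlc (\<lambda>c. chi (apart (f c) (g c) (h c)))"
proof -
  have *: "apart x y n \<longleftrightarrow> (\<exists>j. qv (addq (addq (inv_pow2 j) (inv_pow2 j)) (inv_pow2 n)) < qv (absq (addq (x j) (uminusq (y j)))))" for x y n
    by (simp add: apart_def)
  show ?thesis unfolding *
    by (intro intlc_intros intlc_app [OF intlc_snd [OF assms(1)]] intlc_app [OF intlc_snd [OF assms(2)]] intlc_snd [OF assms(3)])
qed


section \<open>The gauge is Borel\<close>

lemma sigmaM_open: "sigmaM S \<Longrightarrow> intl E \<Longrightarrow> setM E \<Longrightarrow> openM E \<Longrightarrow> S E = 1"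
  unfolding sigmaM_def by blast

lemma sigmaM_compl:
  assumes "sigmaM S" "intl E" "intl D" "setM E" "setM D" "S E = 1" "\<And>x. D x = 1 \<longleftrightarrow> \<not> E x = 1"
  shows "S D = 1"
  using assms(1) [unfolded sigmaM_def, THEN conjunct2, THEN conjunct1, THEN spec, THEN mp, OF assms(2),
    THEN spec, THEN mp, OF assms(3), THEN mp] assms(4-7) by blast

lemma sigmaM_union:
  assumes "sigmaM S" "intl (E :: mnat \<Rightarrow> mreal \<Rightarrow> mnat)" "intl D" "\<And>n. setM (E n)" "\<And>n. S (E n) = 1" "setM D"
    "\<And>x. D x = 1 \<longleftrightarrow> (\<exists>n. E n x = 1)"
  shows "S D = 1"
  using assms(1) [unfolded sigmaM_def, THEN conjunct2, THEN conjunct2, THEN spec, THEN mp, OF assms(2),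
    THEN spec, THEN mp, OF assms(3), THEN mp] assms(4-7) by blast

text \<open>Each set \<open>F n\<close> has at most one point up to equality of reals, and its
  complement \<open>G n\<close> is open. The condition on \<open>Q\<close> appears at two contexts
  because a hypothesis cannot be polymorphic.\<close>

lemma borel_preimage:
  assumes Y: "intl Y"
    and resp: "\<And>x y. intl x \<Longrightarrow> inunit x \<Longrightarrow> intl y \<Longrightarrow> inunit y \<Longrightarrow> eqr x y \<Longrightarrow> Y x = Y y"
    and inj: "\<And>x y. intl x \<Longrightarrow> inunit x \<Longrightarrow> intl y \<Longrightarrow> inunit y \<Longrightarrow> Y x = Y y \<Longrightarrow> eqr x y"
    and Q: "\<And>f :: mreal \<times> unit \<Rightarrow> mnat. intlc f \<Longrightarrow> intlc (\<lambda>c. chi (Q (f c)))"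
      "\<And>f :: mreal \<times> mnat \<times> unit \<Rightarrow> mnat. intlc f \<Longrightarrow> intlc (\<lambda>c. chi (Q (f c)))"
  shows "\<exists>E. intl E \<and> borelM E \<and> (\<forall>x. intl x \<longrightarrow> isreal x \<longrightarrow> (E x = 1 \<longleftrightarrow> inunit x \<and> Q (Y x)))"
proof -
  \<comment> \<open>Sets code membership by 1 while \<open>chi\<close> codes truth by 0, hence the
    subtraction; \<open>G\<close>, being a complement, does without it.\<close>
  define E where "E x = 1 - chi (inunit x \<and> Q (Y x))" for x
  define F where "F n x = 1 - chi (inunit x \<and> Y x = n \<and> Q (Y x))" for n x
  define G where "G n x = chi (inunit x \<and> Y x = n \<and> Q (Y x))" for n x
  have E1: "E x = 1 \<longleftrightarrow> inunit x \<and> Q (Y x)" for x by (auto simp: E_def chi_def)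
  have F1: "F n x = 1 \<longleftrightarrow> inunit x \<and> Y x = n \<and> Q (Y x)" for n x by (auto simp: F_def chi_def)
  have G1: "G n x = 1 \<longleftrightarrow> \<not> (inunit x \<and> Y x = n \<and> Q (Y x))" for n x by (auto simp: G_def chi_def)
  have E: "intl E" unfolding E_def by (rule intl_funI) (intro intlc_intros intlc_comp [OF Y] Q)
  have F: "intl F" unfolding F_def by (rule intl_fun2I) (intro intlc_intros intlc_comp [OF Y] Q)
  have G: "intl (G n)" for n unfolding G_def by (rule intl_funI) (intro intlc_intros intlc_comp [OF Y] Q)
  have cong: "inunit x \<longleftrightarrow> inunit y" "inunit x \<Longrightarrow> Y x = Y y"
    if "intl x" "intl y" "isreal x" "isreal y" "eqr x y" for x y
    using that inunit_eqr [of x y] inunit_eqr [of y x] eqr_sym [of x y] resp [of x y] by blast+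
  have setE: "setM E"
    unfolding setM_def E_def using cong by (auto simp: chi_def)
  have setF: "setM (F n)" for n
    unfolding setM_def F_def using cong by (auto simp: chi_def)
  have setG: "setM (G n)" for n
    unfolding setM_def G_def using cong by (auto simp: chi_def)
  have openG: "openM (G n)" for n
    unfolding openM_def
  proof (intro allI impI)
    fix x assume x: "intl x" "isreal x" "G n x = 1"
    show "\<exists>m. \<forall>z. intl z \<longrightarrow> isreal z \<longrightarrow> inball z x (of_rat (inv_pow2 m)) \<longrightarrow> G n z = 1"
    \<comment> \<open>If no point has number n and property \<open>Q\<close>, the complement is
      everything. Otherwise x is apart from the only such point, and the witness of apartness
      supplies the radius.\<close>
    proof (cases "\<exists>y. intl y \<and> inunit y \<and> Y y = n \<and> Q n")
      case False
      then show ?thesis unfolding G1 by blast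
    next
      case True
      then obtain y where y: "intl y" "inunit y" "Y y = n" "Q n" by blast
      have "\<not> eqr x y"
      proof
        assume e: "eqr x y"
        then have "inunit x" using inunit_eqr [OF y(2) x(2) eqr_sym] by blast
        then show False using x(3) resp [OF x(1) _ y(1,2) e] y unfolding G1 by simp
      qed
      then obtain m where m: "apart x y m" using not_eqr_apart by blast
      have "G n z = 1" if z: "intl z" "isreal z" "inball z x (of_rat (inv_pow2 m))" for z
      proof (rule ccontr)
        assume "G n z \<noteq> 1"
        then have u: "inunit z" "Y z = n" unfolding G1 by blast+
        have "eqr z y" by (rule inj [OF z(1) u(1) y(1,2)]) (simp only: u(2) y(3))
        then show False using apart_not_inball [OF x(2) inunit_real [OF y(2)] z(2) m] z(3) by blast
      qed
      then show ?thesis by blast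
    qed
  qed
  have "borelM E"
    unfolding borelM_def
  proof (intro conjI setE allI impI)
    fix S assume S: "intl S" "sigmaM S"
    have "S (G n) = 1" for n by (rule sigmaM_open [OF S(2) G setG openG])
    moreover have F': "intl (F n)" for n by (rule intl_app [OF F intl_mnat])
    moreover have "F n x = 1 \<longleftrightarrow> \<not> G n x = 1" for n x unfolding F1 G1 by blast
    ultimately have "S (F n) = 1" for n by (intro sigmaM_compl [OF S(2) G F' setG setF])
    moreover have "E x = 1 \<longleftrightarrow> (\<exists>n. F n x = 1)" for x unfolding E1 F1 by blast
    ultimately show "S E = 1" by (intro sigmaM_union [OF S(2) F E setF _ setE])
  qed
  then show ?thesis using E E1 by blast
qed

text \<open>The gauge at x depends on \<open>Y x\<close> alone, so exceeding \<open>a\<close> is a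
  condition \<open>Q\<close> on that number.\<close>

lemma gauge_of_borel:
  assumes "intl Y"
    and "\<And>x y. intl x \<Longrightarrow> inunit x \<Longrightarrow> intl y \<Longrightarrow> inunit y \<Longrightarrow> eqr x y \<Longrightarrow> Y x = Y y"
    and "\<And>x y. intl x \<Longrightarrow> inunit x \<Longrightarrow> intl y \<Longrightarrow> inunit y \<Longrightarrow> Y x = Y y \<Longrightarrow> eqr x y"
  shows "borelfunM (gauge_of Y)"
  unfolding borelfunM_def
proof (intro allI impI)
  fix a assume a: "intl a" "isreal a"
  define Q where "Q n \<longleftrightarrow> \<not> ler (of_rat (inv_pow2 (n + n + 1 + 1))) a" for n
  have Q: "intlc (\<lambda>c. chi (Q (f c)))" if "intlc f" for f :: "'c::mctx \<Rightarrow> mnat"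
    unfolding Q_def by (intro intlc_intros that intlc_const a)
  show "\<exists>E. intl E \<and> borelM E \<and>
      (\<forall>x. intl x \<longrightarrow> isreal x \<longrightarrow> (E x = 1 \<longleftrightarrow> inunit x \<and> lessr a (gauge_of Y x)))"
    using borel_preimage [OF assms, of Q, OF _ _ _ _ _ _ _ _ _ _ Q Q] unfolding Q_def lessr_def gauge_of_def by blast
qed


section \<open>The gauge is upper semi-continuous\<close>

text \<open>
  A real is coded in Cantor space by its left cut, from which \<open>recover\<close> computes an equal real.
\<close>

definition below :: "mnat \<Rightarrow> mreal \<Rightarrow> bool" where
  "below q x \<longleftrightarrow> (\<exists>n. qv q + (eps n + eps n) < qv (x n))"

definition cut :: "mreal \<Rightarrow> mreal" where "cut x q = chi (below q x)"

text \<open>Such a \<open>q\<close> approximates the real with cut \<open>f\<close> from below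
  within 2^(-n-1); the spare factor two yields fast convergence.\<close>

definition brackets :: "mreal \<Rightarrow> mnat \<Rightarrow> mnat \<Rightarrow> bool" where
  "brackets f n q \<longleftrightarrow> f q = 0 \<and> f (addq q (inv_pow2 (n + 1))) \<noteq> 0"

definition recover :: "(mreal \<Rightarrow> mnat) \<Rightarrow> mreal \<Rightarrow> mreal" where
  "recover \<mu> f n = \<mu> (\<lambda>q. chi (brackets f n q))"

lemma below_less: "isreal x \<Longrightarrow> below q x \<Longrightarrow> qv q < qv (x m) + eps m"
proof -
  assume x: "isreal x" and "below q x"
  then obtain n where n: "qv q + (eps n + eps n) < qv (x n)" unfolding below_def by blast
  have "n \<le> m \<or> m \<le> n" by (rule linear)
  then show ?thesis
  proof
    assume "n \<le> m"
    from real_close [OF x this] show ?thesis using n eps_gt_0 [of n] eps_gt_0 [of m] by linarith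
  next
    assume "m \<le> n"
    from real_close [OF x this] show ?thesis using n eps_gt_0 [of n] by linarith
  qed
qed

lemma not_below_le: "\<not> below q x \<Longrightarrow> qv (x m) \<le> qv q + (eps m + eps m)"
  by (auto simp: below_def not_less)

text \<open>Of the margin 2 * 2^(-n), convergence up to index n + 2 uses 2^(-n) and equality
  2^(-n-1); the remaining 2^(-n-1) is the margin required at n + 2.\<close>

lemma below_eqr:
  assumes y: "isreal y" "isreal x" and xy: "eqr x y" and b: "below q x" shows "below q y"
proof -
  from b obtain n where n: "qv q + (eps n + eps n) < qv (x n)" unfolding below_def by blast
  have "\<bar>qv (x n) - qv (x (n + 1 + 1))\<bar> < eps n" using y by (auto intro!: real_close simp: add.assoc)
  moreover have "\<bar>qv (x (n + 1 + 1)) - qv (y (n + 1 + 1))\<bar> \<le> eps (n + 1 + 1) + eps (n + 1 + 1)"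
    using xy unfolding eqr_def by blast
  ultimately have "qv q + (eps (n + 1 + 1) + eps (n + 1 + 1)) < qv (y (n + 1 + 1))"
    using n eps_halves [of n] eps_halves [of "n + 1"] by linarith
  then show ?thesis unfolding below_def by blast
qed

text \<open>Equality of reals turns into equality of functions, which is the uniqueness that
  \<open>IND0\<close> asks for.\<close>

lemma cut_eqr:
  assumes "isreal x" "isreal y" "eqr x y" shows "cut x = cut y"
proof
  fix q
  have "below q x \<longleftrightarrow> below q y"
    using below_eqr [OF assms(2,1,3)] below_eqr [OF assms(1,2) eqr_sym [OF assms(3)]] by blast
  then show "cut x q = cut y q" by (simp add: cut_def)
qed

lemma intlc_below:
  fixes f :: "'c::mctx \<Rightarrow> mreal"
  assumes "intlc f" "intlc g" shows "intlc (\<lambda>c. chi (below (g c) (f c)))"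
proof -
  have *: "below q x \<longleftrightarrow> (\<exists>n. qv (addq q (addq (inv_pow2 n) (inv_pow2 n))) < qv (x n))" for q x
    by (simp add: below_def)
  show ?thesis unfolding * by (intro intlc_intros intlc_app [OF intlc_snd [OF assms(1)]] intlc_snd [OF assms(2)])
qed

lemma intlc_brackets:
  fixes f :: "'c::mctx \<Rightarrow> mreal"
  assumes "intlc f" "intlc g" "intlc h" shows "intlc (\<lambda>c. chi (brackets (f c) (g c) (h c)))"
  unfolding brackets_def by (intro intlc_intros intlc_app [OF assms(1)] assms)

lemma intl_cut: "intl x \<Longrightarrow> intl (cut x)"
  unfolding cut_def [abs_def] by (rule intl_funI) (intro intlc_below intlc_const intlc_intros)

lemma intlc_recover:
  fixes f :: "'c::mctx \<Rightarrow> mreal"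
  assumes \<mu>: "intl \<mu>" and f: "intlc f" shows "intlc (\<lambda>c. recover \<mu> (f c))"
  unfolding recover_def [abs_def]
  by (rule intlc_lam) (rule intlc_comp [OF \<mu>], rule intlc_lam,
    rule intlc_brackets, (rule intlc_snd)+, rule f, rule intlc_snd, rule intlc_fst, rule intlc_fst)

lemma recover_cut:
  assumes \<mu>: "\<forall>f. intl f \<longrightarrow> (\<exists>n. f n = 0) \<longrightarrow> f (\<mu> f) = 0"
    and x: "intl x" "isreal x"
  shows "isreal (recover \<mu> (cut x))" "eqr (recover \<mu> (cut x)) x"
proof -
  let ?r = "recover \<mu> (cut x)"
  have br: "below (?r n) x \<and> \<not> below (addq (?r n) (inv_pow2 (n + 1))) x" for n
  proof -
    \<comment> \<open>For m = n + 3 and q = x_m - 2^(-n-2), the real x, known up to 2^(-m), lies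
      strictly between q and q + 2^(-n-1).\<close>
    define m where "m = n + 1 + 1 + 1"
    define q where "q = addq (x m) (uminusq (inv_pow2 (n + 1 + 1)))"
    have q: "qv q = qv (x m) - eps (n + 1 + 1)" by (simp add: q_def)
    have e: "eps (n + 1) = 4 * eps m" "eps (n + 1 + 1) = 2 * eps m" "0 < eps m"
      using eps_halves [of "n + 1"] eps_halves [of "n + 1 + 1"] by (simp_all add: m_def)
    have "below q x"
    proof -
      have le: "m \<le> m + 1 + 1" by (simp add: add.assoc)
      have "qv q + (eps (m + 1 + 1) + eps (m + 1 + 1)) < qv (x (m + 1 + 1))"
        using real_close [OF x(2) le] eps_halves [of m] eps_halves [of "m + 1"] e unfolding q by linarith
      then show ?thesis unfolding below_def by blast
    qed
    moreover have "\<not> below (addq q (inv_pow2 (n + 1))) x"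
      using below_less [OF x(2), of "addq q (inv_pow2 (n + 1))" m] q e by auto
    ultimately have "\<exists>q. chi (brackets (cut x) n q) = 0" unfolding brackets_def cut_def by auto
    moreover have "intl (\<lambda>q. chi (brackets (cut x) n q))"
      by (rule intl_funI) (intro intlc_brackets intlc_const intl_cut x intl_mnat intlc_fst)
    ultimately have "chi (brackets (cut x) n (?r n)) = 0" unfolding recover_def
      by (rule \<mu> [THEN spec, THEN mp, THEN mp, rotated])
    then show ?thesis unfolding brackets_def cut_def by simp
  qed
  have lo: "qv (?r n) < qv (x m) + eps m" and up: "qv (x m) \<le> qv (?r n) + eps (n + 1) + (eps m + eps m)" for n m
    using below_less [OF x(2)] br not_below_le [of "addq (?r n) (inv_pow2 (n + 1))" x m] by auto
  show "isreal ?r"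
    unfolding isreal_def
  proof (intro allI)
    fix n i :: mnat
    \<comment> \<open>At this index the three error terms \<open>eps m\<close> stay below 2^(-n-1)
      together.\<close>
    define m where "m = n + i + 1 + 1 + 1"
    have "eps (n + i + 1) \<le> eps (n + 1)" "eps m \<le> eps (n + 1 + 1 + 1)"
      unfolding m_def by (rule eps_antimono, simp add: ac_simps)+
    then show "\<bar>qv (?r n) - qv (?r (n + i))\<bar> < eps n"
      using lo [of n m] up [of m n] lo [of "n + i" m] up [of m "n + i"] eps_gt_0 [of m]
        eps_halves [of n] eps_halves [of "n + 1"] eps_halves [of "n + 1 + 1"] by linarith
  qed
  show "eqr ?r x"
    unfolding eqr_def
  proof
    fix n
    show "\<bar>qv (?r n) - qv (x n)\<bar> \<le> eps n + eps n"
    proof (rule ccontr)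
      assume "\<not> ?thesis"
      \<comment> \<open>The estimates \<open>lo\<close> and \<open>up\<close> hold for every m, with
        errors that shrink; an excess above 2^(-d) is refuted at m = n + d + 2.\<close>
      then obtain d where d: "eps d < \<bar>qv (?r n) - qv (x n)\<bar> - (eps n + eps n)"
        using eps_archimedean [of "\<bar>qv (?r n) - qv (x n)\<bar> - (eps n + eps n)"] by auto
      define m where "m = n + (d + 1 + 1)"
      have "eps m \<le> eps (d + 1 + 1)" unfolding m_def by (rule eps_antimono) simp
      moreover have "\<bar>qv (x n) - qv (x m)\<bar> < eps n" using real_close [OF x(2)] by (simp add: m_def)
      ultimately show False
        using d lo [of n m] up [of m n] eps_halves [of n] eps_halves [of d] eps_halves [of "d + 1"] eps_gt_0 [of n] by linarith
    qed
  qed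
qed

text \<open>In a punctured neighbourhood of x0 all points have a number above k. The gauge is
  therefore at most 2^(-k) there, whatever its value at x0.\<close>

theorem gauge_of_usc:
  assumes cm: cm and IND: IND0M and Y: "intl Y"
    and resp: "\<And>x y. intl x \<Longrightarrow> inunit x \<Longrightarrow> intl y \<Longrightarrow> inunit y \<Longrightarrow> eqr x y \<Longrightarrow> Y x = Y y"
    and inj: "\<And>x y. intl x \<Longrightarrow> inunit x \<Longrightarrow> intl y \<Longrightarrow> inunit y \<Longrightarrow> Y x = Y y \<Longrightarrow> eqr x y"
  shows "uscM (gauge_of Y)"
proof -
  from exists_mu [OF cm] obtain \<mu> :: "mreal \<Rightarrow> mnat"
    where \<mu>: "intl \<mu>" "\<forall>f. intl f \<longrightarrow> (\<exists>n. f n = 0) \<longrightarrow> f (\<mu> f) = 0" by (elim exE conjE)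
  let ?r = "recover \<mu>"
  have r_intl: "intl (?r f)" if "intl f" for f
    by (rule intlc_closed) (intro intlc_recover \<mu> intlc_const that)
  \<comment> \<open>\<open>f\<close> codes a point with number n. The middle clause requires
    \<open>f\<close> to be exactly the cut of the real recovered from it, so that no number has two
    codes.\<close>
  define Z where "Z f n = chi (inunit (?r f) \<and> (\<forall>q. f q = cut (?r f) q) \<and> Y (?r f) = n)" for f n
  have Z0: "Z f n = 0 \<longleftrightarrow> inunit (?r f) \<and> (\<forall>q. f q = cut (?r f) q) \<and> Y (?r f) = n" for f n
    by (simp add: Z_def)
  have Z: "intl Z"
    unfolding Z_def cut_def
    by (rule intl_fun2I) (intro intlc_intros intlc_comp [OF Y] intlc_recover \<mu> intlc_below)
  have "\<forall>n f. intl f \<longrightarrow> (\<forall>g. intl g \<longrightarrow> cantor f \<and> cantor g \<and> Z f n = 0 \<and> Z g n = 0 \<longrightarrow> (\<forall>q. f q = g q))"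
  proof (intro allI impI)
    fix n f g q assume fg: "intl f" "intl g" "cantor f \<and> cantor g \<and> Z f n = 0 \<and> Z g n = 0"
    then have "eqr (?r f) (?r g)" unfolding Z0 by (intro inj r_intl) auto
    then have "cut (?r f) = cut (?r g)" using fg inunit_real unfolding Z0 by (intro cut_eqr) auto
    then show "f q = g q" using fg unfolding Z0 by metis
  qed
  from IND [unfolded IND0M_def, THEN spec, THEN mp, OF Z, THEN mp, OF this, THEN spec]
  have enum: "\<exists>l. \<exists>w :: mnat \<Rightarrow> mreal. intl w \<and> (\<forall>m. m \<le> k \<longrightarrow>
        ((\<exists>i. i < l \<and> cantor (w i) \<and> Z (w i) m = 0) \<longleftrightarrow> (\<exists>f. intl f \<and> cantor f \<and> Z f m = 0)))" for k
    .
  show ?thesis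
    unfolding uscM_def
  proof (intro allI impI)
    fix x0 k assume x0: "intl x0" "inunit x0"
    obtain l and w :: "mnat \<Rightarrow> mreal" where w: "intl w"
      and l: "\<And>m. m \<le> k \<Longrightarrow> (\<exists>i. i < l \<and> cantor (w i) \<and> Z (w i) m = 0) \<longleftrightarrow> (\<exists>f. intl f \<and> cantor f \<and> Z f m = 0)"
      using enum [of k] by blast
    \<comment> \<open>A common distance from x0, by internal induction on the possibly nonstandard
      length; the guard leaves out the points equal to x0.\<close>
    have "\<exists>n. \<forall>i. i < l \<longrightarrow> (\<exists>m. apart x0 (?r (w i)) m) \<longrightarrow> apart x0 (?r (w i)) n"
    proof (induction l rule: internal_induct)
      case intl
      show ?case by (intro intlc_intros intlc_recover \<mu> intlc_comp [OF w] intlc_const x0)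
    next
      case 0
      have "\<not> i < 0" for i :: mnat by (simp add: not_less)
      then show ?case by blast
    next
      case (Suc l)
      then obtain n where n: "\<And>i. i < l \<Longrightarrow> (\<exists>m. apart x0 (?r (w i)) m) \<Longrightarrow> apart x0 (?r (w i)) n" by blast
      \<comment> \<open>If the new point is not apart from x0, any \<open>n'\<close> will
        do.\<close>
      obtain n' where n': "(\<exists>m. apart x0 (?r (w l)) m) \<Longrightarrow> apart x0 (?r (w l)) n'" by blast
      show ?case
      proof (intro exI allI impI)
        fix i assume i: "i < l + 1" "\<exists>m. apart x0 (?r (w i)) m"
        then have "i < l \<or> i = l" by (metis mnat_less_iff add_le_cancel_right le_less)
        then show "apart x0 (?r (w i)) (n + n')"
        proof
          assume "i < l"
          with n i have "apart x0 (?r (w i)) n" by blast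
          then show ?thesis by (rule apart_mono) simp
        next
          assume "i = l"
          with n' i have "apart x0 (?r (w i)) n'" by blast
          then show ?thesis by (rule apart_mono) simp
        qed
      qed
    qed
    then obtain n where n: "\<And>i. i < l \<Longrightarrow> (\<exists>m. apart x0 (?r (w i)) m) \<Longrightarrow> apart x0 (?r (w i)) n" by blast
    show "\<exists>n. \<forall>x. intl x \<longrightarrow> inunit x \<longrightarrow> lessr zeror (distr x x0) \<and> lessr (distr x x0) (of_rat (inv_pow2 n)) \<longrightarrow>
        ler (gauge_of Y x) (addr (gauge_of Y x0) (of_rat (inv_pow2 k)))"
    proof (intro exI allI impI)
      fix x assume x: "intl x" "inunit x"
        and d: "lessr zeror (distr x x0) \<and> lessr (distr x x0) (of_rat (inv_pow2 n))"
      note rx = inunit_real [OF x(2)] and rx0 = inunit_real [OF x0(2)]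
      \<comment> \<open>Otherwise the cut of x is in the list and x equals a listed point. That
        point is not x0, since x has positive distance from x0; so it is more than 2^(-n) away from
        x0, and x is not.\<close>
      have "\<not> Y x \<le> k"
      proof
        assume "Y x \<le> k"
        note rc = recover_cut [OF \<mu>(2) x(1) rx]
        have u: "inunit (?r (cut x))" using inunit_eqr [OF x(2) rc(1) eqr_sym [OF rc(2)]] .
        have "Z (cut x) (Y x) = 0"
          unfolding Z0 using u cut_eqr [OF rc(1) rx rc(2)] resp [OF r_intl [OF intl_cut [OF x(1)]] u x rc(2)] by simp
        moreover have "cantor (cut x)" unfolding cantor_def cut_def by simp
        ultimately obtain i where i: "i < l" "Z (w i) (Y x) = 0"
          using l [OF \<open>Y x \<le> k\<close>] intl_cut [OF x(1)] by blast
        then have g: "inunit (?r (w i))" "Y (?r (w i)) = Y x" unfolding Z0 by auto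
        have wi: "intl (w i)" using w intl_app intl_mnat by blast
        have e: "eqr x (?r (w i))" using inj [OF x r_intl [OF wi] g(1)] g(2) by simp
        have "\<not> eqr x0 (?r (w i))"
        proof
          assume e0: "eqr x0 (?r (w i))"
          have "Y x0 = Y x" using resp [OF x0 r_intl [OF wi] g(1) e0] g(2) by simp
          then have "eqr x x0" by (intro inj x x0) simp
          moreover from d obtain j where "eps j + eps j < \<bar>qv (x (j + 1)) - qv (x0 (j + 1))\<bar>"
            unfolding lessr_def ler_def by (auto simp: not_le)
          moreover have "\<bar>qv (x (j + 1)) - qv (x0 (j + 1))\<bar> \<le> eps (j + 1) + eps (j + 1)"
            using \<open>eqr x x0\<close> unfolding eqr_def by blast
          ultimately show False using eps_halves [of j] eps_gt_0 [of j] by linarith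
        qed
        then have "apart x0 (?r (w i)) n" using n i(1) not_eqr_apart by blast
        then have "\<not> inball x x0 (of_rat (inv_pow2 n))"
          using rx0 inunit_real [OF g(1)] rx e by (intro apart_not_inball)
        then show False using d unfolding inball_def by blast
      qed
      \<comment> \<open>As \<open>Y x\<close> exceeds k, so does the exponent in the gauge at
        x.\<close>
      then have "eps (Y x + Y x + 1 + 1) \<le> eps k" by (intro eps_antimono) (simp add: not_le add_increasing2 add_increasing)
      then show "ler (gauge_of Y x) (addr (gauge_of Y x0) (of_rat (inv_pow2 k)))"
        unfolding ler_def gauge_of_def by (auto simp: add_increasing2 add_increasing add_nonneg_nonneg)
    qed
  qed
qed


theorem no_countermodel: "\<not> cm"
proof
  assume cm: cm
  note W = countermodel_W0 [OF cm, unfolded countermodel_def]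
  from W have "NIN \<notin> W0" by blast
  then obtain Y :: "mreal \<Rightarrow> mnat" where Y: "intl Y"
    and resp: "\<And>x y. intl x \<Longrightarrow> inunit x \<Longrightarrow> intl y \<Longrightarrow> inunit y \<Longrightarrow> eqr x y \<Longrightarrow> Y x = Y y"
    and inj: "\<And>x y. intl x \<Longrightarrow> inunit x \<Longrightarrow> intl y \<Longrightarrow> inunit y \<Longrightarrow> Y x = Y y \<Longrightarrow> eqr x y"
    using means_NIN [OF cm] unfolding means_def by blast
  have "\<not> subcoverM (gauge_of Y)" by (rule no_subcover [OF Y inj])
  moreover have "gaugeM (gauge_of Y)" by (rule gauge_of_gauge [OF resp])
  moreover have "borelfunM (gauge_of Y)" by (rule gauge_of_borel [OF Y resp inj])
  moreover have "uscM (gauge_of Y)" if "IND0 \<in> W0"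
    using that means_IND0 [OF cm] unfolding means_def by (intro gauge_of_usc [OF cm _ Y resp inj]) auto
  moreover note intl_gauge_of [OF Y] W means_HBU_semi [OF cm] means_HBU_Borel [OF cm]
  ultimately show False unfolding means_def by metis
qed

text \<open>\<open>T\<close> is left open so that one argument serves with and without
  \<open>IND0\<close>. If the implication were underivable, the Henkin clause for implication would
  put \<open>P\<close> inside and \<open>NIN\<close> outside some complete set.\<close>

lemma provable:
  assumes T: "ACA0\<omega> \<subseteq> T" and P: "P = HBU_Borel \<or> P = HBU_semi \<and> IND0 \<in> T"
  shows "T \<turnstile> P \<^bold>\<longrightarrow> NIN"
proof (rule ccontr)
  assume not: "\<not> (T \<turnstile> P \<^bold>\<longrightarrow> NIN)"
  \<comment> \<open>Only well-formed axioms are guaranteed to enter the Henkin set, and only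
    well-formed implications can be split there.\<close>
  have wf: "wf_fm [] P" "wf_fm [] NIN" "wf_fm [] IND0" using P uniform_fm_principles uniform_fm_wf by auto
  then obtain W where W: "henkin W" "\<forall>\<psi>\<in>T. wf_fm [] \<psi> \<longrightarrow> \<psi> \<in> W" "(P \<^bold>\<longrightarrow> NIN) \<notin> W"
    using henkin_extension [OF not] by auto
  then have "P \<in> W" "NIN \<notin> W" using wf unfolding henkin_def by blast+
  then have "countermodel W" using W T P wf unfolding countermodel_def by blast
  then show False using no_countermodel unfolding cm_def by blast
qed

theorem theorem6:
  shows "(ACA0\<omega> \<union> {IND0} \<turnstile> HBU_semi \<^bold>\<longrightarrow> NIN) \<and>
         (ACA0\<omega> \<union> {IND0} \<turnstile> HBU_Borel \<^bold>\<longrightarrow> NIN) \<and>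
         (ACA0\<omega> \<turnstile> HBU_Borel \<^bold>\<longrightarrow> NIN)"
  by (intro conjI provable) auto

end
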